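(* Any two solutions of problem $(\mathcal{P})$ corresponding to the same data $\{f,M,u_0,\dot u_0,P_0,\dot P_0\}$ are equal.
   Context: Setting. $\Omega\subset\mathbb{R}^3$ is a bounded domain with piecewise smooth boundary $\partial\Omega$ and outward unit normal $n$; $T>0$. On $\mathbb{R}^{3\times3}$: $\langle X,Y\rangle=\mathrm{tr}(XY^T)$, $\|X\|^2=\langle X,X\rangle$, $\mathrm{sym}\,X=\frac12(X+X^T)$; $\mathrm{Sym}(3)$ is the set of symmetric matrices. For a vector field $u$, $\nabla u$ is the matrix field whose $i$-th row is the gradient of $u_i$; for a matrix field, $\mathrm{Curl}$ and $\mathrm{Div}$ act row-wise (curl, resp. divergence, of each row). All derivatives are in the sense of distributions. $H^1_0(\Omega)$ is the closure of $C_0^\infty(\Omega)$ in $H^1(\Omega)$ (vector-valued); $H(\mathrm{Curl};\Omega)$ is the space of $L^2$ matrix fields $P$ with $\mathrm{Curl}\,P\in L^2(\Omega)$, and $H_0(\mathrm{Curl};\Omega)$ is the closure of $C_0^\infty(\Omega)$ in it for the norm $(\|P\|^2_{L^2(\Omega)}+\|\mathrm{Curl}\,P\|_{L^2(\Omega)}^2)^{1/2}$ (this encodes $P_i\times n=0$ on $\partial\Omega$ for the rows $P_i$). Coefficients. $\mathbb{C},\mathbb{H},\mathbb{L}_c$ are fourth order tensor fields of class $C^1(\Omega)$, acting by $(\mathbb{C}.X)_{ij}=\sum_{k,l}\mathbb{C}_{ijkl}X_{kl}$, with symmetries $\mathbb{C}_{ijrs}=\mathbb{C}_{rsij}=\mathbb{C}_{jirs}$,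 $\mathbb{H}_{ijrs}=\mathbb{H}_{rsij}=\mathbb{H}_{jirs}$, $(\mathbb{L}_c)_{ijrs}=(\mathbb{L}_c)_{rsij}$, and there are positive constants $c_m,c_M,h_m,h_M,(L_c)_m,(L_c)_M$ such that at every point of $\Omega$: $c_m\|X\|^2\le\langle\mathbb{C}.X,X\rangle\le c_M\|X\|^2$ and $h_m\|X\|^2\le\langle\mathbb{H}.X,X\rangle\le h_M\|X\|^2$ for all $X\in\mathrm{Sym}(3)$, and $(L_c)_m\|X\|^2\le\langle\mathbb{L}_c.X,X\rangle\le (L_c)_M\|X\|^2$ for all $X\in\mathbb{R}^{3\times3}$. Problem $(\mathcal{P})$. Find $u:\Omega\times[0,T]\to\mathbb{R}^3$, $P:\Omega\times[0,T]\to\mathbb{R}^{3\times3}$ with $u_{,tt}=\mathrm{Div}[\mathbb{C}.\,\mathrm{sym}(\nabla u-P)]+f$, $P_{,tt}=-\mathrm{Curl}[\mathbb{L}_c.\,\mathrm{Curl}\,P]+\mathbb{C}.\,\mathrm{sym}(\nabla u-P)-\mathbb{H}.\,\mathrm{sym}\,P+M$ in $\Omega\times[0,T]$; $u=0$ and $P_i\times n=0$ ($i=1,2,3$) on $\partial\Omega\times[0,T]$; $u(0)=u_0$, $u_{,t}(0)=\dot u_0$, $P(0)=P_0$, $P_{,t}(0)=\dot P_0$. Solution. Let $\mathcal{X}=H_0^1(\Omega)\times L^2(\Omega)\times H_0(\mathrm{Curl};\Omega)\times L^2(\Omega)$ (elements $w=(u,v,P,K)$), $\mathcal{A}w=(v,\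 \mathrm{Div}[\mathbb{C}.\mathrm{sym}(\nabla u-P)],\ K,\ -\mathrm{Curl}[\mathbb{L}_c.\mathrm{Curl}\,P]+\mathbb{C}.\mathrm{sym}(\nabla u-P)-\mathbb{H}.\mathrm{sym}\,P)$, $\mathcal{D}(\mathcal{A})=\{w\in\mathcal{X}:\mathcal{A}w\in\mathcal{X}\}$. With $f,M\in L^1(0,T;L^2(\Omega))$, $\{u,P\}$ is a solution of $(\mathcal{P})$ if $w=(u,u_{,t},P,P_{,t})$ is continuous from $[0,T]$ to $\mathcal{X}$, continuously differentiable on $(0,T]$, $w(t)\in\mathcal{D}(\mathcal{A})$ and $w'(t)=\mathcal{A}w(t)+(0,f(t),0,M(t))$ for $t\in(0,T]$, and $w(0)=(u_0,\dot u_0,P_0,\dot P_0)$. *)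

theory Defs
  imports "HOL-Analysis.Analysis"
begin

section \<open>Smooth functions and domains\<close>

text \<open>Meaningful for open \<open>S\<close>: all iterated directional derivatives up to order \<open>k\<close> exist
  and are continuous.\<close>

fun Ck_on :: "nat \<Rightarrow> 'a::real_normed_vector set \<Rightarrow> ('a \<Rightarrow> 'b::real_normed_vector) \<Rightarrow> bool" where
  "Ck_on 0 S g \<longleftrightarrow> continuous_on S g"
| "Ck_on (Suc k) S g \<longleftrightarrow>
     (\<forall>x\<in>S. g differentiable (at x)) \<and> (\<forall>v. Ck_on k S (\<lambda>x. frechet_derivative g (at x) v))"

definition smooth_on :: "'a::real_normed_vector set \<Rightarrow> ('a \<Rightarrow> 'b::real_normed_vector) \<Rightarrow> bool" where
  "smooth_on S g \<longleftrightarrow> (\<forall>k. Ck_on k S g)"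

text \<open>A smooth patch is parametrized by the closed unit square, smoothly up to the edges and
  as a regular surface in the interior; it may degenerate on the edges (as at the apex of a cone).\<close>

definition smooth_patch :: "(real^2 \<Rightarrow> real^3) \<Rightarrow> bool" where
  "smooth_patch \<psi> \<longleftrightarrow>
     (\<exists>U. open U \<and> cbox 0 1 \<subseteq> U \<and> smooth_on U \<psi>) \<and>
     (\<forall>s\<in>box 0 1. inj (frechet_derivative \<psi> (at s)))"

definition outward_unit_normal ::
    "(real^3) set \<Rightarrow> (real^2 \<Rightarrow> real^3) \<Rightarrow> real^2 \<Rightarrow> real^3 \<Rightarrow> bool" where
  "outward_unit_normal \<Omega> \<psi> s n \<longleftrightarrow>
     norm n = 1 \<and> (\<forall>v. n \<bullet> frechet_derivative \<psi> (at s) v = 0) \<and>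
     (\<exists>\<epsilon>>0. \<forall>r. 0 < r \<and> r < \<epsilon> \<longrightarrow> \<psi> s - r *\<^sub>R n \<in> \<Omega> \<and> \<psi> s + r *\<^sub>R n \<notin> closure \<Omega>)"

text \<open>The boundary consists of finitely many smooth patches which meet only along their edges,
  and the outward unit normal exists in the interior of every patch.\<close>

definition piecewise_smooth_boundary :: "(real^3) set \<Rightarrow> bool" where
  "piecewise_smooth_boundary \<Omega> \<longleftrightarrow>
     (\<exists>\<Psi>. finite \<Psi> \<and> (\<forall>\<psi>\<in>\<Psi>. smooth_patch \<psi>) \<and>
        frontier \<Omega> = (\<Union>\<psi>\<in>\<Psi>. \<psi> ` cbox 0 1) \<and>
        (\<forall>\<psi>\<in>\<Psi>. \<forall>\<eta>\<in>\<Psi>. \<forall>s\<in>box 0 1. \<forall>t\<in>cbox 0 1. \<psi> s = \<eta> t \<longrightarrow> \<psi> = \<eta> \<and> s = t) \<and>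
        (\<forall>\<psi>\<in>\<Psi>. \<forall>s\<in>box 0 1. \<exists>n. outward_unit_normal \<Omega> \<psi> s n))"

definition bounded_domain :: "(real^3) set \<Rightarrow> bool" where
  "bounded_domain \<Omega> \<longleftrightarrow> \<Omega> \<noteq> {} \<and> open \<Omega> \<and> connected \<Omega> \<and> bounded \<Omega>"


section \<open>Matrices and fourth order tensors\<close>

text \<open>On \<^typ>\<open>real^3^3\<close> (entries \<open>X $ i $ j\<close>, row \<open>i\<close>, column \<open>j\<close>) the inner product and norm of
  the library are those of the trace form \<open>tr (X Y\<^sup>T)\<close>.\<close>

definition symm :: "real^3^3 \<Rightarrow> real^3^3" where
  "symm X = (1/2) *\<^sub>R (X + transpose X)"

definition Sym3 :: "(real^3^3) set" where
  "Sym3 = {X. transpose X = X}"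

type_synonym tensor4 = "real^3^3^3^3"

definition tensor_act :: "tensor4 \<Rightarrow> real^3^3 \<Rightarrow> real^3^3" where
  "tensor_act A X = (\<chi> i j. \<Sum>k\<in>UNIV. \<Sum>l\<in>UNIV. A $ i $ j $ k $ l * X $ k $ l)"

definition major_symmetric :: "tensor4 \<Rightarrow> bool" where
  "major_symmetric A \<longleftrightarrow> (\<forall>i j r s. A $ i $ j $ r $ s = A $ r $ s $ i $ j)"

definition minor_symmetric :: "tensor4 \<Rightarrow> bool" where
  "minor_symmetric A \<longleftrightarrow> (\<forall>i j r s. A $ i $ j $ r $ s = A $ j $ i $ r $ s)"

definition form_bounds :: "(real^3^3) set \<Rightarrow> real \<Rightarrow> real \<Rightarrow> tensor4 \<Rightarrow> bool" where
  "form_bounds S m M A \<longleftrightarrow>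
     (\<forall>X\<in>S. m * (norm X)\<^sup>2 \<le> tensor_act A X \<bullet> X \<and> tensor_act A X \<bullet> X \<le> M * (norm X)\<^sup>2)"


section \<open>Function spaces\<close>

text \<open>Elements of \<open>L\<^sup>2(\<Omega>)\<close> are represented by functions on the whole of \<^typ>\<open>real^3\<close> whose values
  outside \<open>\<Omega>\<close> play no role; equality in \<open>L\<^sup>2(\<Omega>)\<close> is equality almost everywhere in \<open>\<Omega>\<close>.\<close>

definition L2 :: "(real^3) set \<Rightarrow> (real^3 \<Rightarrow> 'b::euclidean_space) set" where
  "L2 \<Omega> = {g. g \<in> borel_measurable (lebesgue_on \<Omega>) \<and>
              integrable (lebesgue_on \<Omega>) (\<lambda>x. (norm (g x))\<^sup>2)}"

definition L2_norm :: "(real^3) set \<Rightarrow> (real^3 \<Rightarrow> 'b::euclidean_space) \<Rightarrow> real" where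
  "L2_norm \<Omega> g = sqrt (\<integral>x. (norm (g x))\<^sup>2 \<partial>lebesgue_on \<Omega>)"

definition eq_ae :: "(real^3) set \<Rightarrow> (real^3 \<Rightarrow> 'b) \<Rightarrow> (real^3 \<Rightarrow> 'b) \<Rightarrow> bool" where
  "eq_ae \<Omega> g h \<longleftrightarrow> (AE x in lebesgue_on \<Omega>. g x = h x)"

definition C0inf :: "(real^3) set \<Rightarrow> (real^3 \<Rightarrow> 'b::real_normed_vector) set" where
  "C0inf \<Omega> = {\<phi>. smooth_on UNIV \<phi> \<and> compact (closure {x. \<phi> x \<noteq> 0}) \<and> closure {x. \<phi> x \<noteq> 0} \<subseteq> \<Omega>}"

text \<open>The regular distribution of \<open>g\<close>, and its \<open>j\<close>-th distributional partial derivative, applied to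
  a test function \<open>\<phi>\<close>.\<close>

definition dist_of :: "(real^3) set \<Rightarrow> (real^3 \<Rightarrow> real) \<Rightarrow> (real^3 \<Rightarrow> real) \<Rightarrow> real" where
  "dist_of \<Omega> g \<phi> = (\<integral>x. g x * \<phi> x \<partial>lebesgue_on \<Omega>)"

definition dist_pd :: "(real^3) set \<Rightarrow> 3 \<Rightarrow> (real^3 \<Rightarrow> real) \<Rightarrow> (real^3 \<Rightarrow> real) \<Rightarrow> real" where
  "dist_pd \<Omega> j g \<phi> = - (\<integral>x. g x * frechet_derivative \<phi> (at x) (axis j 1) \<partial>lebesgue_on \<Omega>)"

definition dist_Div :: "(real^3) set \<Rightarrow> (real^3 \<Rightarrow> real^3^3) \<Rightarrow> (real^3 \<Rightarrow> real) \<Rightarrow> real^3" where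
  "dist_Div \<Omega> S \<phi> = (\<chi> i. \<Sum>j\<in>UNIV. dist_pd \<Omega> j (\<lambda>x. S x $ i $ j) \<phi>)"

definition dist_curl :: "(real^3) set \<Rightarrow> (real^3 \<Rightarrow> real^3) \<Rightarrow> (real^3 \<Rightarrow> real) \<Rightarrow> real^3" where
  "dist_curl \<Omega> p \<phi> = vector
     [dist_pd \<Omega> 2 (\<lambda>x. p x $ 3) \<phi> - dist_pd \<Omega> 3 (\<lambda>x. p x $ 2) \<phi>,
      dist_pd \<Omega> 3 (\<lambda>x. p x $ 1) \<phi> - dist_pd \<Omega> 1 (\<lambda>x. p x $ 3) \<phi>,
      dist_pd \<Omega> 1 (\<lambda>x. p x $ 2) \<phi> - dist_pd \<Omega> 2 (\<lambda>x. p x $ 1) \<phi>]"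

definition dist_Curl :: "(real^3) set \<Rightarrow> (real^3 \<Rightarrow> real^3^3) \<Rightarrow> (real^3 \<Rightarrow> real) \<Rightarrow> real^3^3" where
  "dist_Curl \<Omega> P \<phi> = (\<chi> i. dist_curl \<Omega> (\<lambda>x. P x $ i) \<phi>)"

definition is_grad :: "(real^3) set \<Rightarrow> (real^3 \<Rightarrow> real^3) \<Rightarrow> (real^3 \<Rightarrow> real^3^3) \<Rightarrow> bool" where
  "is_grad \<Omega> u G \<longleftrightarrow> G \<in> L2 \<Omega> \<and>
     (\<forall>\<phi>\<in>C0inf \<Omega>. \<forall>i j. dist_pd \<Omega> j (\<lambda>x. u x $ i) \<phi> = dist_of \<Omega> (\<lambda>x. G x $ i $ j) \<phi>)"

definition is_Curl :: "(real^3) set \<Rightarrow> (real^3 \<Rightarrow> real^3^3) \<Rightarrow> (real^3 \<Rightarrow> real^3^3) \<Rightarrow> bool" where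
  "is_Curl \<Omega> P Q \<longleftrightarrow> Q \<in> L2 \<Omega> \<and>
     (\<forall>\<phi>\<in>C0inf \<Omega>. \<forall>i k. dist_Curl \<Omega> P \<phi> $ i $ k = dist_of \<Omega> (\<lambda>x. Q x $ i $ k) \<phi>)"

text \<open>Weak derivatives are determined up to null sets, so the choice of representative in
  \<open>grad\<close> and \<open>Curl\<close> is immaterial.\<close>

definition grad :: "(real^3) set \<Rightarrow> (real^3 \<Rightarrow> real^3) \<Rightarrow> (real^3 \<Rightarrow> real^3^3)" where
  "grad \<Omega> u = (SOME G. is_grad \<Omega> u G)"

definition Curl :: "(real^3) set \<Rightarrow> (real^3 \<Rightarrow> real^3^3) \<Rightarrow> (real^3 \<Rightarrow> real^3^3)" where
  "Curl \<Omega> P = (SOME Q. is_Curl \<Omega> P Q)"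

definition H1 :: "(real^3) set \<Rightarrow> (real^3 \<Rightarrow> real^3) set" where
  "H1 \<Omega> = {u \<in> L2 \<Omega>. \<exists>G. is_grad \<Omega> u G}"

definition H1_norm :: "(real^3) set \<Rightarrow> (real^3 \<Rightarrow> real^3) \<Rightarrow> real" where
  "H1_norm \<Omega> u = sqrt ((L2_norm \<Omega> u)\<^sup>2 + (L2_norm \<Omega> (grad \<Omega> u))\<^sup>2)"

definition H10 :: "(real^3) set \<Rightarrow> (real^3 \<Rightarrow> real^3) set" where
  "H10 \<Omega> = {u \<in> H1 \<Omega>. \<forall>\<epsilon>>0. \<exists>\<phi>\<in>C0inf \<Omega>. H1_norm \<Omega> (u - \<phi>) < \<epsilon>}"

definition HCurl :: "(real^3) set \<Rightarrow> (real^3 \<Rightarrow> real^3^3) set" where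
  "HCurl \<Omega> = {P \<in> L2 \<Omega>. \<exists>Q. is_Curl \<Omega> P Q}"

definition HCurl_norm :: "(real^3) set \<Rightarrow> (real^3 \<Rightarrow> real^3^3) \<Rightarrow> real" where
  "HCurl_norm \<Omega> P = sqrt ((L2_norm \<Omega> P)\<^sup>2 + (L2_norm \<Omega> (Curl \<Omega> P))\<^sup>2)"

definition H0Curl :: "(real^3) set \<Rightarrow> (real^3 \<Rightarrow> real^3^3) set" where
  "H0Curl \<Omega> = {P \<in> HCurl \<Omega>. \<forall>\<epsilon>>0. \<exists>\<phi>\<in>C0inf \<Omega>. HCurl_norm \<Omega> (P - \<phi>) < \<epsilon>}"

text \<open>\<open>L\<^sup>1(0,T;L\<^sup>2(\<Omega>))\<close> in the sense of Bochner: almost everywhere limits of simple functions,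
  with integrable norm.\<close>

definition simple_L2 ::
    "real \<Rightarrow> (real^3) set \<Rightarrow> (real \<Rightarrow> real^3 \<Rightarrow> 'b::euclidean_space) \<Rightarrow> bool" where
  "simple_L2 T \<Omega> s \<longleftrightarrow> finite (s ` {0..T}) \<and>
     (\<forall>t\<in>{0..T}. s t \<in> L2 \<Omega> \<and> {r \<in> {0..T}. s r = s t} \<in> sets lebesgue)"

definition L1_L2 :: "real \<Rightarrow> (real^3) set \<Rightarrow> (real \<Rightarrow> real^3 \<Rightarrow> 'b::euclidean_space) set" where
  "L1_L2 T \<Omega> = {f.
     (AE t in lebesgue_on {0..T}. f t \<in> L2 \<Omega>) \<and>
     (\<exists>s. (\<forall>n. simple_L2 T \<Omega> (s n)) \<and>
          (AE t in lebesgue_on {0..T}. (\<lambda>n. L2_norm \<Omega> (s n t - f t)) \<longlonglongrightarrow> 0)) \<and>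
     integrable (lebesgue_on {0..T}) (\<lambda>t. L2_norm \<Omega> (f t))}"


section \<open>The operator \<open>\<A>\<close>\<close>

text \<open>A state is a quadruple \<open>w = (u, v, P, K)\<close>.\<close>

type_synonym state =
  "(real^3 \<Rightarrow> real^3) \<times> (real^3 \<Rightarrow> real^3) \<times> (real^3 \<Rightarrow> real^3^3) \<times> (real^3 \<Rightarrow> real^3^3)"

definition X_space :: "(real^3) set \<Rightarrow> state set" where
  "X_space \<Omega> = H10 \<Omega> \<times> L2 \<Omega> \<times> H0Curl \<Omega> \<times> L2 \<Omega>"

fun X_norm :: "(real^3) set \<Rightarrow> state \<Rightarrow> real" where
  "X_norm \<Omega> (u, v, P, K) =
     sqrt ((H1_norm \<Omega> u)\<^sup>2 + (L2_norm \<Omega> v)\<^sup>2 + (HCurl_norm \<Omega> P)\<^sup>2 + (L2_norm \<Omega> K)\<^sup>2)"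

fun X_eq :: "(real^3) set \<Rightarrow> state \<Rightarrow> state \<Rightarrow> bool" where
  "X_eq \<Omega> (u, v, P, K) (u', v', P', K') \<longleftrightarrow>
     eq_ae \<Omega> u u' \<and> eq_ae \<Omega> v v' \<and> eq_ae \<Omega> P P' \<and> eq_ae \<Omega> K K'"

fun X_scale :: "real \<Rightarrow> state \<Rightarrow> state" where
  "X_scale c (u, v, P, K) =
     ((\<lambda>x. c *\<^sub>R u x), (\<lambda>x. c *\<^sub>R v x), (\<lambda>x. c *\<^sub>R P x), (\<lambda>x. c *\<^sub>R K x))"

fun X_add :: "state \<Rightarrow> state \<Rightarrow> state" where
  "X_add (u, v, P, K) (u', v', P', K') =
     ((\<lambda>x. u x + u' x), (\<lambda>x. v x + v' x), (\<lambda>x. P x + P' x), (\<lambda>x. K x + K' x))"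

definition stress ::
    "(real^3) set \<Rightarrow> (real^3 \<Rightarrow> tensor4) \<Rightarrow> (real^3 \<Rightarrow> real^3) \<Rightarrow> (real^3 \<Rightarrow> real^3^3) \<Rightarrow> real^3 \<Rightarrow> real^3^3"
  where "stress \<Omega> C u P x = tensor_act (C x) (symm (grad \<Omega> u x - P x))"

text \<open>\<open>is_A \<Omega> C H L w z\<close> says \<open>\<A> w = z\<close>. For general \<open>w\<close> in the state space \<open>\<A> w\<close> has
  components which are mere distributions, hence the second and fourth equations are equalities of
  distributions on \<open>\<Omega>\<close>.\<close>

fun is_A :: "(real^3) set \<Rightarrow> (real^3 \<Rightarrow> tensor4) \<Rightarrow> (real^3 \<Rightarrow> tensor4) \<Rightarrow> (real^3 \<Rightarrow> tensor4)
    \<Rightarrow> state \<Rightarrow> state \<Rightarrow> bool" where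
  "is_A \<Omega> C H L (u, v, P, K) (z1, z2, z3, z4) \<longleftrightarrow>
     eq_ae \<Omega> z1 v \<and>
     (\<forall>\<phi>\<in>C0inf \<Omega>. \<forall>i. dist_of \<Omega> (\<lambda>x. z2 x $ i) \<phi> = dist_Div \<Omega> (stress \<Omega> C u P) \<phi> $ i) \<and>
     eq_ae \<Omega> z3 K \<and>
     (\<forall>\<phi>\<in>C0inf \<Omega>. \<forall>i k. dist_of \<Omega> (\<lambda>x. z4 x $ i $ k) \<phi> =
        - dist_Curl \<Omega> (\<lambda>x. tensor_act (L x) (Curl \<Omega> P x)) \<phi> $ i $ k
        + dist_of \<Omega> (\<lambda>x. (stress \<Omega> C u P x - tensor_act (H x) (symm (P x))) $ i $ k) \<phi>)"

definition dom_A :: "(real^3) set \<Rightarrow> (real^3 \<Rightarrow> tensor4) \<Rightarrow> (real^3 \<Rightarrow> tensor4)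
    \<Rightarrow> (real^3 \<Rightarrow> tensor4) \<Rightarrow> state set" where
  "dom_A \<Omega> C H L = {w \<in> X_space \<Omega>. \<exists>z\<in>X_space \<Omega>. is_A \<Omega> C H L w z}"


section \<open>Solutions\<close>

definition X_continuous_on :: "(real^3) set \<Rightarrow> real set \<Rightarrow> (real \<Rightarrow> state) \<Rightarrow> bool" where
  "X_continuous_on \<Omega> I w \<longleftrightarrow> (\<forall>t\<in>I. w t \<in> X_space \<Omega>) \<and>
     (\<forall>t\<in>I. ((\<lambda>s. X_norm \<Omega> (w s - w t)) \<longlongrightarrow> 0) (at t within I))"

definition X_deriv_on ::
    "(real^3) set \<Rightarrow> real set \<Rightarrow> (real \<Rightarrow> state) \<Rightarrow> (real \<Rightarrow> state) \<Rightarrow> bool" where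
  "X_deriv_on \<Omega> I w w' \<longleftrightarrow> (\<forall>t\<in>I. w' t \<in> X_space \<Omega>) \<and>
     (\<forall>t\<in>I. ((\<lambda>s. X_norm \<Omega> (X_scale (1 / (s - t)) (w s - w t) - w' t)) \<longlongrightarrow> 0) (at t within I))"

definition L2_deriv_on :: "(real^3) set \<Rightarrow> real set \<Rightarrow> (real \<Rightarrow> real^3 \<Rightarrow> 'b::euclidean_space)
    \<Rightarrow> (real \<Rightarrow> real^3 \<Rightarrow> 'b) \<Rightarrow> bool" where
  "L2_deriv_on \<Omega> I g g' \<longleftrightarrow> (\<forall>t\<in>I. g t \<in> L2 \<Omega> \<and> g' t \<in> L2 \<Omega>) \<and>
     (\<forall>t\<in>I. ((\<lambda>s. L2_norm \<Omega> (\<lambda>x. (1 / (s - t)) *\<^sub>R (g s x - g t x) - g' t x)) \<longlongrightarrow> 0)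
        (at t within I))"

text \<open>The functions \<open>ut\<close> and \<open>Pt\<close> are the time derivatives \<open>u\<^sub>,\<^sub>t\<close> and \<open>P\<^sub>,\<^sub>t\<close>. They are taken in
  \<open>L\<^sup>2(\<Omega>)\<close>, because at \<open>t = 0\<close> (where the derivative is one-sided) the initial velocities
  only belong to \<open>L\<^sup>2(\<Omega>)\<close>; on \<open>(0,T]\<close> the stronger topology comes from \<open>X_deriv_on\<close>.\<close>

definition is_solution ::
    "(real^3) set \<Rightarrow> real \<Rightarrow> (real^3 \<Rightarrow> tensor4) \<Rightarrow> (real^3 \<Rightarrow> tensor4) \<Rightarrow> (real^3 \<Rightarrow> tensor4)
     \<Rightarrow> (real \<Rightarrow> real^3 \<Rightarrow> real^3) \<Rightarrow> (real \<Rightarrow> real^3 \<Rightarrow> real^3^3)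
     \<Rightarrow> (real^3 \<Rightarrow> real^3) \<Rightarrow> (real^3 \<Rightarrow> real^3) \<Rightarrow> (real^3 \<Rightarrow> real^3^3) \<Rightarrow> (real^3 \<Rightarrow> real^3^3)
     \<Rightarrow> (real \<Rightarrow> real^3 \<Rightarrow> real^3) \<Rightarrow> (real \<Rightarrow> real^3 \<Rightarrow> real^3^3) \<Rightarrow> bool" where
  "is_solution \<Omega> T C H L f M u0 v0 P0 K0 u P \<longleftrightarrow>
     (\<exists>ut Pt. L2_deriv_on \<Omega> {0..T} u ut \<and> L2_deriv_on \<Omega> {0..T} P Pt \<and>
       (let w = (\<lambda>t. (u t, ut t, P t, Pt t)) in
          X_continuous_on \<Omega> {0..T} w \<and>
          (\<exists>w'. X_deriv_on \<Omega> {0<..T} w w' \<and> X_continuous_on \<Omega> {0<..T} w' \<and>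
             (\<forall>t\<in>{0<..T}. w t \<in> dom_A \<Omega> C H L \<and>
                (\<exists>z\<in>X_space \<Omega>. is_A \<Omega> C H L (w t) z \<and>
                   X_eq \<Omega> (w' t) (X_add z ((\<lambda>_. 0), f t, (\<lambda>_. 0), M t))))) \<and>
          X_eq \<Omega> (w 0) (u0, v0, P0, K0)))"

end

theory Submission
  imports Defs
begin

text \<open>
  Uniqueness is an energy argument. Let \<open>(U, P)\<close> be the difference of two solutions, \<open>V\<close> and \<open>K\<close>
  the differences of their velocities, and \<open>e = \<nabla>U - P\<close>. The energy
  \<open>E(t) = \<integral> \<bar>V\<bar>\<^sup>2 + \<bar>K\<bar>\<^sup>2 + \<langle>C. sym e, e\<rangle> + \<langle>H. sym P, P\<rangle> + \<langle>L. Curl P, Curl P\<rangle>\<close>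
  is continuous on \<open>[0,T]\<close> and vanishes at \<open>0\<close>. On \<open>(0,T]\<close> its derivative is
  \<open>2 \<integral> \<langle>V', V\<rangle> + \<langle>K', K\<rangle> + \<langle>C. sym e, e'\<rangle> + \<langle>H. sym P, P'\<rangle> + \<langle>L. Curl P, Curl P'\<rangle>\<close>.
  The data cancel in \<open>V'\<close> and \<open>K'\<close>, so \<open>V' = Div (C. sym e)\<close> and
  \<open>K' = - Curl (L. Curl P) + C. sym e - H. sym P\<close> weakly. Almost everywhere \<open>V\<close> equals \<open>U'\<close>, a
  difference of two elements of \<open>H\<^sub>0\<^sup>1\<close>, and \<open>K\<close> equals \<open>P'\<close>, a difference of two elements of
  \<open>H\<^sub>0(Curl)\<close>. These are admissible test functions, and with them all terms of the derivative cancel.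
  Hence \<open>E = 0\<close>, and as the elastic terms are nonnegative, \<open>V = K = 0\<close>. Then \<open>\<integral> \<bar>U\<bar>\<^sup>2\<close> and \<open>\<integral> \<bar>P\<bar>\<^sup>2\<close>
  have vanishing time derivative and initial value, that is \<open>U = 0\<close> and \<open>P = 0\<close>. This is
  \<open>energy_solution_unique\<close>; the bookkeeping that turns a solution into curves in \<open>L\<^sup>2\<close> is
  \<open>solution_energy_solution\<close>, and the differentiation of quadratic functionals along such curves is
  \<open>quad_has_derivative\<close>.

  Two facts about weak derivatives carry the argument. The norms of the state space involve the
  weak derivative of a difference of fields, chosen arbitrarily among all its representatives;
  comparing it with the difference of the weak derivatives needs their uniqueness up to null sets,
  which is the \<open>fundamental_lemma\<close>. It is obtained from explicit smooth functions that converge to the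
  indicator of a box. Partial integration against an element of \<open>H\<^sub>0\<^sup>1\<close> or \<open>H\<^sub>0(Curl)\<close> is the
  definition of a weak derivative for test functions, extended by density (\<open>weak_op_parts\<close>). Here one
  has to know that the classical derivatives of a test function are its weak derivatives
  (\<open>weak_op_C0inf\<close>), which rests on \<open>integral_derivative_compact_support\<close>. To treat \<open>\<nabla>\<close> and \<open>Curl\<close>
  simultaneously, both are regarded as instances of an operator \<open>\<Sum>\<^sub>j B\<^sub>j \<partial>\<^sub>j\<close> with constant
  coefficients, whose formal adjoint is \<open>- \<Sum>\<^sub>j B\<^sub>j\<^sup>* \<partial>\<^sub>j\<close>.
\<close>

section \<open>Square integrable fields\<close>

definition ip :: "(real^3) set \<Rightarrow> (real^3 \<Rightarrow> 'b::euclidean_space) \<Rightarrow> (real^3 \<Rightarrow> 'b) \<Rightarrow> real" where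
  "ip \<Omega> f g = (\<integral>x. f x \<bullet> g x \<partial>lebesgue_on \<Omega>)"

lemma ip_commute: "ip \<Omega> f g = ip \<Omega> g f"
  by (simp add: ip_def inner_commute)

lemma L2_norm_nonneg [simp]: "0 \<le> L2_norm \<Omega> f"
  by (simp add: L2_norm_def)

lemma L2_norm_power2: "(L2_norm \<Omega> f)\<^sup>2 = ip \<Omega> f f"
  by (simp add: L2_norm_def ip_def power2_norm_eq_inner)

lemma L2_measurable: "f \<in> L2 \<Omega> \<Longrightarrow> f \<in> borel_measurable (lebesgue_on \<Omega>)"
  by (simp add: L2_def)

lemma L2_bound:
  assumes f: "f \<in> L2 \<Omega>" and g: "g \<in> borel_measurable (lebesgue_on \<Omega>)"
    and le: "\<And>x. x \<in> \<Omega> \<Longrightarrow> norm (g x) \<le> M * norm (f x)"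
  shows "g \<in> L2 \<Omega>"
proof -
  have "integrable (lebesgue_on \<Omega>) (\<lambda>x. M\<^sup>2 * (norm (f x))\<^sup>2)"
    using f by (simp add: L2_def)
  then have "integrable (lebesgue_on \<Omega>) (\<lambda>x. (norm (g x))\<^sup>2)"
  proof (rule Bochner_Integration.integrable_bound)
    show "(\<lambda>x. (norm (g x))\<^sup>2) \<in> borel_measurable (lebesgue_on \<Omega>)"
      using g by measurable
    show "AE x in lebesgue_on \<Omega>. norm ((norm (g x))\<^sup>2) \<le> norm (M\<^sup>2 * (norm (f x))\<^sup>2)"
    proof (rule AE_I2)
      fix x assume "x \<in> space (lebesgue_on \<Omega>)"
      then have "norm (g x) \<le> M * norm (f x)"
        using le by simp
      then have "(norm (g x))\<^sup>2 \<le> (M * norm (f x))\<^sup>2"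
        by (rule power_mono) simp
      then show "norm ((norm (g x))\<^sup>2) \<le> norm (M\<^sup>2 * (norm (f x))\<^sup>2)"
        by (simp add: power_mult_distrib)
    qed
  qed
  with g show ?thesis by (simp add: L2_def)
qed

lemma L2_linear_image:
  fixes f :: "real^3 \<Rightarrow> 'b::euclidean_space" and h :: "'b \<Rightarrow> 'c::euclidean_space"
  assumes "linear h" "f \<in> L2 \<Omega>"
  shows "(\<lambda>x. h (f x)) \<in> L2 \<Omega>"
proof -
  have bl: "bounded_linear h"
    using assms(1) by (simp add: linear_conv_bounded_linear)
  then obtain M where M: "\<And>x. norm (h x) \<le> norm x * M"
    using bounded_linear.bounded by blast
  show ?thesis
  proof (rule L2_bound[OF assms(2), where M = M])
    have "h \<in> borel_measurable borel"
      using bl by (intro borel_measurable_continuous_onI linear_continuous_on)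
    then show "(\<lambda>x. h (f x)) \<in> borel_measurable (lebesgue_on \<Omega>)"
      using L2_measurable[OF assms(2)] by measurable
  qed (use M in \<open>auto simp: mult.commute\<close>)
qed

lemma integrable_inner:
  assumes "f \<in> L2 \<Omega>" "g \<in> L2 \<Omega>"
  shows "integrable (lebesgue_on \<Omega>) (\<lambda>x. f x \<bullet> g x)"
proof (rule Bochner_Integration.integrable_bound)
  show "integrable (lebesgue_on \<Omega>) (\<lambda>x. (norm (f x))\<^sup>2 + (norm (g x))\<^sup>2)"
    using assms by (simp add: L2_def)
  show "(\<lambda>x. f x \<bullet> g x) \<in> borel_measurable (lebesgue_on \<Omega>)"
    using assms[THEN L2_measurable] by measurable
  have "\<bar>a \<bullet> b\<bar> \<le> (norm a)\<^sup>2 + (norm b)\<^sup>2" for a b :: 'a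
  proof -
    have "\<bar>a \<bullet> b\<bar> \<le> norm a * norm b" by (rule Cauchy_Schwarz_ineq2)
    also have "2 * norm a * norm b \<le> (norm a)\<^sup>2 + (norm b)\<^sup>2"
      by (rule sum_squares_bound)
    then have "norm a * norm b \<le> (norm a)\<^sup>2 + (norm b)\<^sup>2"
      using mult_nonneg_nonneg[OF norm_ge_zero norm_ge_zero, of a b] by linarith
    finally show ?thesis .
  qed
  then show "AE x in lebesgue_on \<Omega>. norm (f x \<bullet> g x) \<le> norm ((norm (f x))\<^sup>2 + (norm (g x))\<^sup>2)"
    by (intro AE_I2) (simp add: abs_of_nonneg)
qed

lemma L2_add:
  assumes "f \<in> L2 \<Omega>" "g \<in> L2 \<Omega>"
  shows "(\<lambda>x. f x + g x) \<in> L2 \<Omega>"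
proof -
  have "integrable (lebesgue_on \<Omega>) (\<lambda>x. f x \<bullet> f x + 2 * (f x \<bullet> g x) + g x \<bullet> g x)"
    using assms by (simp add: integrable_inner)
  then show ?thesis
    using assms[THEN L2_measurable] unfolding L2_def
    by (simp add: power2_norm_eq_inner inner_add inner_commute algebra_simps)
qed

lemma L2_scaleR: "f \<in> L2 \<Omega> \<Longrightarrow> (\<lambda>x. c *\<^sub>R f x) \<in> L2 \<Omega>"
  by (rule L2_linear_image[where h = "\<lambda>y. c *\<^sub>R y"]) (auto intro!: linearI simp: algebra_simps)

lemma L2_diff: "f \<in> L2 \<Omega> \<Longrightarrow> g \<in> L2 \<Omega> \<Longrightarrow> (\<lambda>x. f x - g x) \<in> L2 \<Omega>"
  using L2_add[of f \<Omega> "\<lambda>x. (-1) *\<^sub>R g x"] L2_scaleR[of g \<Omega> "-1"] by simp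

lemma L2_zero: "(\<lambda>x. 0) \<in> L2 \<Omega>"
  by (simp add: L2_def)

lemma L2_sum: "(\<And>i. i \<in> I \<Longrightarrow> f i \<in> L2 \<Omega>) \<Longrightarrow> (\<lambda>x. \<Sum>i\<in>I. f i x) \<in> L2 \<Omega>"
  by (induction I rule: infinite_finite_induct) (auto simp: L2_zero L2_add)

lemmas L2_closure = L2_add L2_diff L2_scaleR L2_zero

lemma ip_add_left:
  "f \<in> L2 \<Omega> \<Longrightarrow> g \<in> L2 \<Omega> \<Longrightarrow> h \<in> L2 \<Omega> \<Longrightarrow> ip \<Omega> (\<lambda>x. f x + g x) h = ip \<Omega> f h + ip \<Omega> g h"
  unfolding ip_def by (simp add: inner_add_left integrable_inner)

lemma ip_diff_left:
  "f \<in> L2 \<Omega> \<Longrightarrow> g \<in> L2 \<Omega> \<Longrightarrow> h \<in> L2 \<Omega> \<Longrightarrow> ip \<Omega> (\<lambda>x. f x - g x) h = ip \<Omega> f h - ip \<Omega> g h"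
  unfolding ip_def by (simp add: inner_diff_left integrable_inner)

lemma ip_diff_right:
  "f \<in> L2 \<Omega> \<Longrightarrow> g \<in> L2 \<Omega> \<Longrightarrow> h \<in> L2 \<Omega> \<Longrightarrow> ip \<Omega> h (\<lambda>x. f x - g x) = ip \<Omega> h f - ip \<Omega> h g"
  using ip_diff_left[of f \<Omega> g h] by (simp add: ip_commute[of \<Omega> h])

lemma ip_add_right:
  "f \<in> L2 \<Omega> \<Longrightarrow> g \<in> L2 \<Omega> \<Longrightarrow> h \<in> L2 \<Omega> \<Longrightarrow> ip \<Omega> h (\<lambda>x. f x + g x) = ip \<Omega> h f + ip \<Omega> h g"
  using ip_add_left[of f \<Omega> g h] by (simp add: ip_commute[of \<Omega> h])

lemma ip_scaleR_left: "ip \<Omega> (\<lambda>x. c *\<^sub>R f x) h = c * ip \<Omega> f h"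
  unfolding ip_def by simp


lemma ip_scaleR_right: "ip \<Omega> h (\<lambda>x. c *\<^sub>R f x) = c * ip \<Omega> h f"
  unfolding ip_def by simp

lemma ip_cong_ae:
  assumes "f \<in> L2 \<Omega>" "f' \<in> L2 \<Omega>" "g \<in> L2 \<Omega>" "g' \<in> L2 \<Omega>" "eq_ae \<Omega> f f'" "eq_ae \<Omega> g g'"
  shows "ip \<Omega> f g = ip \<Omega> f' g'"
  unfolding ip_def
proof (rule integral_cong_AE)
  show "AE x in lebesgue_on \<Omega>. f x \<bullet> g x = f' x \<bullet> g' x"
    using assms(5,6) unfolding eq_ae_def by eventually_elim simp
qed (use assms(1-4)[THEN L2_measurable] in measurable)

lemma L2_norm_cong_ae:
  assumes "f \<in> L2 \<Omega>" "g \<in> L2 \<Omega>" "eq_ae \<Omega> f g"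
  shows "L2_norm \<Omega> f = L2_norm \<Omega> g"
proof -
  have "(L2_norm \<Omega> f)\<^sup>2 = (L2_norm \<Omega> g)\<^sup>2"
    unfolding L2_norm_power2 by (rule ip_cong_ae) (use assms in auto)
  then show ?thesis by simp
qed

lemma L2_norm_zeroD:
  assumes "f \<in> L2 \<Omega>" "L2_norm \<Omega> f = 0"
  shows "eq_ae \<Omega> f (\<lambda>x. 0)"
proof -
  have "integrable (lebesgue_on \<Omega>) (\<lambda>x. (norm (f x))\<^sup>2)"
    using assms by (simp add: L2_def)
  moreover have "(\<integral>x. (norm (f x))\<^sup>2 \<partial>lebesgue_on \<Omega>) = 0"
    using assms(2) by (simp add: L2_norm_def)
  ultimately have "AE x in lebesgue_on \<Omega>. (norm (f x))\<^sup>2 = 0"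
    by (subst (asm) integral_nonneg_eq_0_iff_AE) auto
  then show ?thesis by (simp add: eq_ae_def)
qed

lemma ip_self_nonneg: "0 \<le> ip \<Omega> f f"
  by (simp add: ip_def)

text \<open>The quadratic polynomial \<open>c \<mapsto> \<integral> \<bar>f - c g\<bar>\<^sup>2\<close> is nonnegative; evaluate it at its minimum.\<close>

lemma ip_Cauchy_Schwarz:
  assumes f: "f \<in> L2 \<Omega>" and g: "g \<in> L2 \<Omega>"
  shows "\<bar>ip \<Omega> f g\<bar> \<le> L2_norm \<Omega> f * L2_norm \<Omega> g"
proof -
  have eq: "ip \<Omega> (\<lambda>x. f x - c *\<^sub>R g x) (\<lambda>x. f x - c *\<^sub>R g x)
      = ip \<Omega> f f - 2 * c * ip \<Omega> f g + c\<^sup>2 * ip \<Omega> g g" for c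
    using f g ip_commute[of \<Omega> g f]
    by (simp add: ip_diff_left ip_diff_right ip_scaleR_left ip_scaleR_right L2_closure
        power2_eq_square algebra_simps)
  have pos: "0 \<le> ip \<Omega> f f - 2 * c * ip \<Omega> f g + c\<^sup>2 * ip \<Omega> g g" for c
    using ip_self_nonneg[of \<Omega> "\<lambda>x. f x - c *\<^sub>R g x"] by (simp only: eq)
  have "(ip \<Omega> f g)\<^sup>2 \<le> ip \<Omega> f f * ip \<Omega> g g"
  proof (cases "ip \<Omega> g g = 0")
    case True
    \<comment> \<open>The polynomial is affine, and at the chosen point it would be \<open>- 1\<close>.\<close>
    have "ip \<Omega> f g = 0"
    proof (rule ccontr)
      assume "ip \<Omega> f g \<noteq> 0"
      then show False
        using pos[of "(ip \<Omega> f f + 1) / (2 * ip \<Omega> f g)"] True by simp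
    qed
    then show ?thesis using True by simp
  next
    case False
    then have "ip \<Omega> g g > 0" using ip_self_nonneg[of \<Omega> g] by simp
    then show ?thesis
      using pos[of "ip \<Omega> f g / ip \<Omega> g g"]
      by (simp add: power2_eq_square field_simps)
  qed
  then have "(ip \<Omega> f g)\<^sup>2 \<le> (L2_norm \<Omega> f * L2_norm \<Omega> g)\<^sup>2"
    by (simp add: power_mult_distrib L2_norm_power2)
  then show ?thesis
    by (simp add: abs_le_square_iff[symmetric] abs_of_nonneg)
qed

lemma L2_norm_triangle:
  assumes f: "f \<in> L2 \<Omega>" and g: "g \<in> L2 \<Omega>"
  shows "L2_norm \<Omega> (\<lambda>x. f x + g x) \<le> L2_norm \<Omega> f + L2_norm \<Omega> g"
proof (rule power2_le_imp_le)
  have "(L2_norm \<Omega> (\<lambda>x. f x + g x))\<^sup>2 = ip \<Omega> f f + 2 * ip \<Omega> f g + ip \<Omega> g g"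
    using f g by (simp add: L2_norm_power2 ip_add_left ip_add_right L2_closure ip_commute[of \<Omega> g f])
  also have "\<dots> \<le> (L2_norm \<Omega> f + L2_norm \<Omega> g)\<^sup>2"
    using ip_Cauchy_Schwarz[OF f g] by (simp add: L2_norm_power2[symmetric] power2_sum)
  finally show "(L2_norm \<Omega> (\<lambda>x. f x + g x))\<^sup>2 \<le> (L2_norm \<Omega> f + L2_norm \<Omega> g)\<^sup>2" .
qed simp

lemma L2_norm_scaleR: "L2_norm \<Omega> (\<lambda>x. c *\<^sub>R f x) = \<bar>c\<bar> * L2_norm \<Omega> f"
  by (simp add: L2_norm_def power_mult_distrib real_sqrt_mult)

lemma L2_norm_triangle_diff:
  assumes f: "f \<in> L2 \<Omega>" and g: "g \<in> L2 \<Omega>"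
  shows "L2_norm \<Omega> (\<lambda>x. f x - g x) \<le> L2_norm \<Omega> f + L2_norm \<Omega> g"
  using L2_norm_triangle[OF f L2_scaleR[OF g, of "-1"]] L2_norm_scaleR[of \<Omega> "-1" g] by simp

lemma L2_norm_bound:
  assumes f: "f \<in> L2 \<Omega>" and g: "g \<in> L2 \<Omega>" and "M \<ge> 0"
    and le: "\<And>x. x \<in> \<Omega> \<Longrightarrow> norm (g x) \<le> M * norm (f x)"
  shows "L2_norm \<Omega> g \<le> M * L2_norm \<Omega> f"
proof (rule power2_le_imp_le)
  have "(L2_norm \<Omega> g)\<^sup>2 = (\<integral>x. (norm (g x))\<^sup>2 \<partial>lebesgue_on \<Omega>)"
    by (simp add: L2_norm_def)
  also have "\<dots> \<le> (\<integral>x. M\<^sup>2 * (norm (f x))\<^sup>2 \<partial>lebesgue_on \<Omega>)"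
    using f g le[THEN power_mono[where n = 2]]
    by (intro integral_mono) (auto simp: L2_def power_mult_distrib)
  also have "\<dots> = (M * L2_norm \<Omega> f)\<^sup>2"
    by (simp add: L2_norm_def power_mult_distrib)
  finally show "(L2_norm \<Omega> g)\<^sup>2 \<le> (M * L2_norm \<Omega> f)\<^sup>2" .
qed (use \<open>M \<ge> 0\<close> in simp)


section \<open>Smooth functions and test functions\<close>

lemma Ck_on_SucD: "Ck_on (Suc k) S g \<Longrightarrow> Ck_on k S g"
proof (induction k arbitrary: g)
  case 0
  then have "\<forall>x\<in>S. g differentiable (at x)" by simp
  then have "continuous_on S g"
    by (meson continuous_at_imp_continuous_on differentiable_imp_continuous_within)
  then show ?case by simp
next
  case (Suc k)
  have "\<forall>x\<in>S. g differentiable (at x)"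
    and "\<forall>v. Ck_on (Suc k) S (\<lambda>x. frechet_derivative g (at x) v)"
    using Suc.prems Ck_on.simps(2)[of "Suc k" S g] by blast+
  then show ?case using Suc.IH Ck_on.simps(2)[of k S g] by blast
qed

lemma Ck_on_const: "Ck_on k S (\<lambda>x. c)"
  by (induction k arbitrary: c) (auto simp: frechet_derivative_const)

lemma Ck_on_linear:
  assumes h: "bounded_linear h"
  shows "Ck_on k UNIV g \<Longrightarrow> Ck_on k UNIV (\<lambda>x. h (g x))"
proof (induction k arbitrary: g)
  case 0
  then show ?case using bounded_linear.continuous_on[OF h] by simp
next
  case (Suc k)
  have D: "((\<lambda>x. h (g x)) has_derivative (\<lambda>v. h (frechet_derivative g (at x) v))) (at x)" for x
    using Suc.prems frechet_derivative_works[of g "at x"] bounded_linear.has_derivative[OF h] by auto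
  then have "frechet_derivative (\<lambda>x. h (g x)) (at x) = (\<lambda>v. h (frechet_derivative g (at x) v))" for x
    by (metis frechet_derivative_at)
  with D Suc show ?case by (auto simp: differentiable_def)
qed

lemma Ck_on_add: "Ck_on k UNIV f \<Longrightarrow> Ck_on k UNIV g \<Longrightarrow> Ck_on k UNIV (\<lambda>x. f x + g x)"
proof (induction k arbitrary: f g)
  case 0
  then show ?case by (simp add: continuous_on_add)
next
  case (Suc k)
  then have "frechet_derivative (\<lambda>x. f x + g x) (at x)
      = (\<lambda>v. frechet_derivative f (at x) v + frechet_derivative g (at x) v)" for x
    by (intro frechet_derivative_at[symmetric] has_derivative_add)
       (auto simp: frechet_derivative_works[symmetric])
  with Suc show ?case by auto
qed

text \<open>The product rules below hold for any bounded bilinear product; they serve for the multiplication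
  of a vector field with a scalar function.\<close>

lemma (in bounded_bilinear) has_frechet_derivative_prod:
  assumes "f differentiable (at x)" "g differentiable (at x)"
  shows "((\<lambda>x. prod (f x) (g x)) has_derivative (\<lambda>v. prod (f x) (frechet_derivative g (at x) v)
      + prod (frechet_derivative f (at x) v) (g x))) (at x)"
  using FDERIV[of f _ x UNIV g] assms by (auto simp: frechet_derivative_works[symmetric])

lemma (in bounded_bilinear) Ck_on_prod:
  "Ck_on k UNIV f \<Longrightarrow> Ck_on k UNIV g \<Longrightarrow> Ck_on k UNIV (\<lambda>x. prod (f x) (g x))"
proof (induction k arbitrary: f g)
  case 0
  then show ?case by (simp add: continuous_on)
next
  case (Suc k)
  have D: "((\<lambda>x. prod (f x) (g x)) has_derivative (\<lambda>v. prod (f x) (frechet_derivative g (at x) v)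
      + prod (frechet_derivative f (at x) v) (g x))) (at x)" for x
    using Suc.prems by (intro has_frechet_derivative_prod) auto
  then have "frechet_derivative (\<lambda>x. prod (f x) (g x)) (at x)
     = (\<lambda>v. prod (f x) (frechet_derivative g (at x) v) + prod (frechet_derivative f (at x) v) (g x))" for x
    by (metis frechet_derivative_at)
  moreover have "Ck_on k UNIV f" "Ck_on k UNIV g"
    using Suc.prems Ck_on_SucD by blast+
  ultimately show ?case using D Suc by (auto simp: differentiable_def intro!: Ck_on_add)
qed

lemma smooth_on_linear: "bounded_linear h \<Longrightarrow> smooth_on UNIV g \<Longrightarrow> smooth_on UNIV (\<lambda>x. h (g x))"
  by (simp add: smooth_on_def Ck_on_linear)

lemma smooth_on_scaleR:
  fixes f :: "'a::real_normed_vector \<Rightarrow> real"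
  shows "smooth_on UNIV f \<Longrightarrow> smooth_on UNIV g \<Longrightarrow> smooth_on UNIV (\<lambda>x. f x *\<^sub>R g x)"
  by (simp add: smooth_on_def bounded_bilinear.Ck_on_prod[OF bounded_bilinear_scaleR])

lemma smooth_on_prod:
  fixes f :: "'i \<Rightarrow> 'a::real_normed_vector \<Rightarrow> real"
  shows "(\<And>i. i \<in> I \<Longrightarrow> smooth_on UNIV (f i)) \<Longrightarrow> smooth_on UNIV (\<lambda>x. \<Prod>i\<in>I. f i x)"
proof (induction I rule: infinite_finite_induct)
  case (insert i I)
  then show ?case using smooth_on_scaleR[of "f i" "\<lambda>x. \<Prod>i\<in>I. f i x"] by simp
qed (auto simp: smooth_on_def Ck_on_const)

lemma smooth_on_differentiable: "smooth_on UNIV g \<Longrightarrow> g differentiable (at x)"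
  unfolding smooth_on_def using Ck_on.simps(2)[of 0 UNIV g] by blast

lemma smooth_on_derivative: "smooth_on UNIV g \<Longrightarrow> smooth_on UNIV (\<lambda>x. frechet_derivative g (at x) v)"
  unfolding smooth_on_def using Ck_on.simps(2)[of _ UNIV g] by blast

lemma smooth_on_continuous: "smooth_on UNIV g \<Longrightarrow> continuous_on UNIV g"
  unfolding smooth_on_def using Ck_on.simps(1) by blast

text \<open>To recognise a test function it suffices to bound its support by that of a known test function.
  This covers linear images, derivatives and products.\<close>

lemma C0infI:
  assumes "smooth_on UNIV g" "\<phi> \<in> C0inf \<Omega>"
    and "\<And>x. x \<notin> closure {x. \<phi> x \<noteq> 0} \<Longrightarrow> g x = 0"
  shows "g \<in> C0inf \<Omega>"
proof -
  have sub: "closure {x. g x \<noteq> 0} \<subseteq> closure {x. \<phi> x \<noteq> 0}"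
    by (rule closure_minimal) (use assms(3) in auto)
  moreover have "compact (closure {x. g x \<noteq> 0})"
    using compact_Int_closed[of "closure {x. \<phi> x \<noteq> 0}" "closure {x. g x \<noteq> 0}"] assms(2) sub
    by (simp add: C0inf_def Int_absorb1)
  ultimately show ?thesis
    using assms(1,2) by (auto simp: C0inf_def)
qed

lemma C0inf_smooth: "\<phi> \<in> C0inf \<Omega> \<Longrightarrow> smooth_on UNIV \<phi>"
  by (simp add: C0inf_def)

lemma C0inf_linear:
  assumes "bounded_linear h" "\<phi> \<in> C0inf \<Omega>"
  shows "(\<lambda>x. h (\<phi> x)) \<in> C0inf \<Omega>"
proof (rule C0infI[OF smooth_on_linear[OF assms(1)] assms(2)])
  show "smooth_on UNIV \<phi>" using assms(2) by (rule C0inf_smooth)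
  show "h (\<phi> x) = 0" if "x \<notin> closure {x. \<phi> x \<noteq> 0}" for x
  proof -
    have "\<phi> x = 0" using that closure_subset[of "{x. \<phi> x \<noteq> 0}"] by auto
    then show ?thesis by (simp add: linear_0[OF bounded_linear.linear[OF assms(1)]])
  qed
qed

lemma C0inf_derivative:
  assumes "\<phi> \<in> C0inf \<Omega>"
  shows "(\<lambda>x. frechet_derivative \<phi> (at x) v) \<in> C0inf \<Omega>"
proof (rule C0infI[OF smooth_on_derivative assms])
  show "smooth_on UNIV \<phi>" using assms by (rule C0inf_smooth)
  fix x assume x: "x \<notin> closure {x. \<phi> x \<noteq> 0}"
  have "(\<phi> has_derivative (\<lambda>v. 0)) (at x)"
  proof (rule has_derivative_transform_within_open[of "\<lambda>x. 0"])
    show "open (- closure {x. \<phi> x \<noteq> 0})" by auto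
    show "0 = \<phi> y" if "y \<in> - closure {x. \<phi> x \<noteq> 0}" for y
      using that closure_subset[of "{x. \<phi> x \<noteq> 0}"] by auto
  qed (use x in auto)
  then show "frechet_derivative \<phi> (at x) v = 0"
    by (simp add: frechet_derivative_at[symmetric])
qed

lemma lebesgue_on_measurable_continuous:
  fixes g :: "real^3 \<Rightarrow> 'b::euclidean_space"
  assumes "continuous_on UNIV g"
  shows "g \<in> borel_measurable (lebesgue_on \<Omega>)"
  using assms by (intro measurable_restrict_space1 measurable_completion)
    (simp add: borel_measurable_continuous_onI)

lemma integrable_compact_support:
  fixes g :: "real^3 \<Rightarrow> 'b::euclidean_space"
  assumes "continuous_on UNIV g" "compact K" "\<And>x. x \<notin> K \<Longrightarrow> g x = 0"
  shows "integrable lebesgue g"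
proof -
  have "integrable lborel (\<lambda>x. indicator K x *\<^sub>R g x)"
    using assms by (intro borel_integrable_compact) (auto intro: continuous_on_subset)
  moreover have "(\<lambda>x. indicator K x *\<^sub>R g x) = g"
    using assms(3) by (auto simp: indicator_def)
  ultimately show ?thesis
    using assms(1) by (simp add: integrable_completion borel_measurable_continuous_onI)
qed

lemma C0inf_L2:
  fixes \<phi> :: "real^3 \<Rightarrow> 'b::euclidean_space"
  assumes "\<phi> \<in> C0inf \<Omega>" "open \<Omega>"
  shows "\<phi> \<in> L2 \<Omega>"
proof -
  have cont: "continuous_on UNIV \<phi>"
    using assms by (simp add: C0inf_smooth smooth_on_continuous)
  have "integrable lebesgue (\<lambda>x. (norm (\<phi> x))\<^sup>2)"
  proof (rule integrable_compact_support)
    show "compact (closure {x. \<phi> x \<noteq> 0})" using assms(1) by (simp add: C0inf_def)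
    show "(norm (\<phi> x))\<^sup>2 = 0" if "x \<notin> closure {x. \<phi> x \<noteq> 0}" for x
      using that closure_subset[of "{x. \<phi> x \<noteq> 0}"] by auto
  qed (intro continuous_intros cont)
  then have "integrable (lebesgue_on \<Omega>) (\<lambda>x. (norm (\<phi> x))\<^sup>2)"
    using assms(2) integrable_mult_indicator[of \<Omega> lebesgue "\<lambda>x. (norm (\<phi> x))\<^sup>2"]
    by (simp add: integrable_restrict_space)
  then show ?thesis
    using lebesgue_on_measurable_continuous[OF cont] by (simp add: L2_def)
qed

section \<open>Integrals of derivatives\<close>

text \<open>Difference quotients of \<open>g\<close> integrate to \<open>0\<close> by translation invariance, and they converge
  boundedly to the directional derivative.\<close>

lemma integral_derivative_compact_support:
  fixes g :: "real^3 \<Rightarrow> 'b::euclidean_space"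
  assumes diff: "\<And>x. g differentiable (at x)"
    and cont: "continuous_on UNIV (\<lambda>x. frechet_derivative g (at x) v)"
    and K: "compact K" "\<And>x. x \<notin> K \<Longrightarrow> g x = 0"
  shows "(\<integral>x. frechet_derivative g (at x) v \<partial>lebesgue) = 0"
proof -
  let ?h = "\<lambda>x. frechet_derivative g (at x) v"
  have gc: "continuous_on UNIV g"
    using diff by (simp add: continuous_at_imp_continuous_on differentiable_imp_continuous_within)
  have hz: "?h x = 0" if "x \<notin> K" for x
  proof -
    have "(g has_derivative (\<lambda>v. 0)) (at x)"
    proof (rule has_derivative_transform_within_open[of "\<lambda>x. 0"])
      show "open (- K)" using K(1) by (simp add: compact_imp_closed open_Compl)
    qed (use that K in auto)
    then show ?thesis by (simp add: frechet_derivative_at[symmetric])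
  qed
  obtain M where M: "\<And>x. norm (?h x) \<le> M" "M \<ge> 0"
  proof -
    have "bounded (?h ` K)"
      using K(1) cont by (intro compact_imp_bounded compact_continuous_image) (auto intro: continuous_on_subset)
    then obtain M where M: "\<And>x. x \<in> K \<Longrightarrow> norm (?h x) \<le> M" "M > 0"
      unfolding bounded_pos by auto
    show ?thesis
    proof (rule that[of M])
      show "norm (?h x) \<le> M" for x using M hz by (cases "x \<in> K") auto
    qed (use M in auto)
  qed
  have line: "((\<lambda>t. g (x + t *\<^sub>R v)) has_vector_derivative ?h (x + t *\<^sub>R v)) (at t)" for x t
  proof -
    have "(g has_derivative frechet_derivative g (at (x + t *\<^sub>R v))) (at (x + t *\<^sub>R v))"
      using diff frechet_derivative_works by blast
    moreover have "((\<lambda>t. x + t *\<^sub>R v) has_derivative (\<lambda>s. s *\<^sub>R v)) (at t)"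
      by (auto intro!: derivative_eq_intros)
    ultimately have "(g \<circ> (\<lambda>t. x + t *\<^sub>R v) has_derivative
        frechet_derivative g (at (x + t *\<^sub>R v)) \<circ> (\<lambda>s. s *\<^sub>R v)) (at t)"
      by (intro diff_chain_at)
    moreover have "frechet_derivative g (at (x + t *\<^sub>R v)) (s *\<^sub>R v) = s *\<^sub>R ?h (x + t *\<^sub>R v)" for s
      using diff by (simp add: linear_frechet_derivative linear_scale)
    ultimately show ?thesis
      by (simp add: has_vector_derivative_def o_def)
  qed
  \<comment> \<open>The difference quotients with step \<open>1 / (n + 1)\<close> are all supported in the \<open>\<bar>v\<bar>\<close>-neighbourhood
    of \<open>K\<close>, where the mean value theorem bounds them by \<open>M\<close>.\<close>
  let ?q = "\<lambda>n x. real (Suc n) *\<^sub>R (g (x + inverse (real (Suc n)) *\<^sub>R v) - g x)"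
  let ?K = "{x + y |x y. x \<in> K \<and> y \<in> cball 0 (norm v)}"
  have cK: "compact ?K" using K(1) by (intro compact_sums) auto
  have bound: "norm (?q n x) \<le> M * indicat_real ?K x" for n x
  proof (cases "x \<in> ?K")
    case True
    let ?e = "inverse (real (Suc n))"
    have "norm (g (x + ?e *\<^sub>R v) - g (x + 0 *\<^sub>R v)) \<le> M * norm (?e - 0)"
    proof (rule differentiable_bound[where S = UNIV and f' = "\<lambda>t s. s *\<^sub>R ?h (x + t *\<^sub>R v)"])
      show "((\<lambda>t. g (x + t *\<^sub>R v)) has_derivative (\<lambda>s. s *\<^sub>R ?h (x + t *\<^sub>R v))) (at t within UNIV)" for t
        using line[of x t] by (simp add: has_vector_derivative_def)
      show "onorm (\<lambda>s. s *\<^sub>R ?h (x + t *\<^sub>R v)) \<le> M" for t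
        by (rule onorm_le) (simp add: mult.commute[of M] mult_left_mono M(1))
    qed auto
    then have "real (Suc n) * norm (g (x + ?e *\<^sub>R v) - g x) \<le> M"
      by (simp add: field_simps)
    then show ?thesis using True by simp
  next
    case False
    have "x \<notin> K" using False by force
    moreover have "x + inverse (real (Suc n)) *\<^sub>R v \<notin> K"
    proof
      assume *: "x + inverse (real (Suc n)) *\<^sub>R v \<in> K"
      have "norm v * inverse (real (Suc n)) \<le> norm v * 1"
        by (intro mult_left_mono) (auto simp: field_simps)
      then have "- (inverse (real (Suc n)) *\<^sub>R v) \<in> cball 0 (norm v)"
        by (simp add: mult.commute)
      with * have "(x + inverse (real (Suc n)) *\<^sub>R v) + - (inverse (real (Suc n)) *\<^sub>R v) \<in> ?K"
        by blast
      then have "x \<in> ?K" by (simp only: add.assoc right_minus add_0_right)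
      with False show False by blast
    qed
    ultimately have "?q n x = 0" using K(2) by simp
    then show ?thesis by (simp only: indicator_simps(2)[OF False]) simp
  qed
  have gi: "integrable lborel g"
    using integrable_compact_support[OF gc K] gc by (simp add: integrable_completion borel_measurable_continuous_onI)
  have trans: "integrable lborel (\<lambda>x. g (x + a)) \<and> (\<integral>x. g (x + a) \<partial>lborel) = (\<integral>x. g x \<partial>lborel)" for a
  proof -
    have "lborel = distr lborel borel (\<lambda>x. x + a)"
      using lborel_distr_plus[of a] by (simp add: add.commute[of _ a])
    moreover have "integrable (distr lborel borel (\<lambda>x. x + a)) g = integrable lborel (\<lambda>x. g (x + a))"
      using gc by (intro integrable_distr_eq) (auto intro: borel_measurable_continuous_onI)
    moreover have "integral\<^sup>L (distr lborel borel (\<lambda>x. x + a)) g = (\<integral>x. g (x + a) \<partial>lborel)"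
      using gc by (intro integral_distr) (auto intro: borel_measurable_continuous_onI)
    ultimately show ?thesis using gi by simp
  qed
  have zero: "(\<integral>x. ?q n x \<partial>lborel) = 0" for n
    using trans gi by simp
  have "(\<lambda>n. \<integral>x. ?q n x \<partial>lborel) \<longlonglongrightarrow> (\<integral>x. ?h x \<partial>lborel)"
  proof (rule integral_dominated_convergence)
    show "?h \<in> borel_measurable lborel" using cont by (simp add: borel_measurable_continuous_onI)
    show "?q n \<in> borel_measurable lborel" for n
    proof -
      have "continuous_on UNIV (?q n)"
        by (intro continuous_intros continuous_on_compose2[OF gc]) auto
      then show ?thesis by (simp add: borel_measurable_continuous_onI)
    qed
    show "integrable lborel (\<lambda>x. M * indicat_real ?K x)"
      using cK emeasure_compact_finite[OF cK]
      by (intro integrable_mult_right integrable_real_indicator) (simp_all only: sets_lborel borel_compact)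
    show "AE x in lborel. (\<lambda>n. ?q n x) \<longlonglongrightarrow> ?h x"
    proof (rule AE_I2)
      fix x
      have "((\<lambda>t. norm (g (x + t *\<^sub>R v) - g x - t *\<^sub>R ?h x) / norm t) \<longlongrightarrow> 0) (at 0)"
        using line[of x 0] by (simp add: has_vector_derivative_def has_derivative_at)
      then have "((\<lambda>t. norm ((1/t) *\<^sub>R (g (x + t *\<^sub>R v) - g x) - ?h x)) \<longlongrightarrow> 0) (at 0)"
      proof (rule Lim_transform_eventually)
        have "norm (g (x + t *\<^sub>R v) - g x - t *\<^sub>R ?h x) / norm t
            = norm ((1/t) *\<^sub>R (g (x + t *\<^sub>R v) - g x) - ?h x)" if "t \<noteq> 0" for t
        proof -
          have "(1/t) *\<^sub>R (g (x + t *\<^sub>R v) - g x) - ?h x = (1/t) *\<^sub>R (g (x + t *\<^sub>R v) - g x - t *\<^sub>R ?h x)"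
            using that by (simp add: scaleR_diff_right)
          then show ?thesis by simp
        qed
        then show "\<forall>\<^sub>F t in at 0. norm (g (x + t *\<^sub>R v) - g x - t *\<^sub>R ?h x) / norm t
            = norm ((1/t) *\<^sub>R (g (x + t *\<^sub>R v) - g x) - ?h x)"
          by (simp add: eventually_at_filter)
      qed
      then have "((\<lambda>t. (1/t) *\<^sub>R (g (x + t *\<^sub>R v) - g x)) \<longlongrightarrow> ?h x) (at 0)"
        using LIM_zero_iff tendsto_norm_zero_iff by blast
      moreover have "filterlim (\<lambda>n. inverse (real (Suc n))) (at 0) sequentially"
        using LIMSEQ_inverse_real_of_nat by (simp add: filterlim_at)
      ultimately have "(\<lambda>n. (1/inverse (real (Suc n))) *\<^sub>R (g (x + inverse (real (Suc n)) *\<^sub>R v) - g x)) \<longlonglongrightarrow> ?h x"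
        by (rule filterlim_compose)
      then show "(\<lambda>n. ?q n x) \<longlonglongrightarrow> ?h x"
        by (simp only: divide_inverse inverse_inverse_eq mult_1_left)
    qed
    show "AE x in lborel. norm (?q n x) \<le> M * indicat_real ?K x" for n
      using bound by (intro AE_I2)
  qed
  then have "(\<integral>x. ?h x \<partial>lborel) = 0"
    unfolding zero using LIMSEQ_unique tendsto_const by blast
  then show ?thesis
    using cont by (simp add: integral_completion borel_measurable_continuous_onI)
qed

lemma C0inf_integral_derivative:
  fixes \<phi> :: "real^3 \<Rightarrow> 'b::euclidean_space"
  assumes "open \<Omega>" and \<phi>: "\<phi> \<in> C0inf \<Omega>"
  shows "(\<integral>x. frechet_derivative \<phi> (at x) v \<partial>lebesgue_on \<Omega>) = 0"
proof -
  have sm: "smooth_on UNIV \<phi>" using \<phi> by (rule C0inf_smooth)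
  let ?K = "closure {x. \<phi> x \<noteq> 0}"
  have K: "compact ?K" "?K \<subseteq> \<Omega>" using \<phi> by (auto simp: C0inf_def)
  have "{x. frechet_derivative \<phi> (at x) v \<noteq> 0} \<subseteq> \<Omega>"
    using C0inf_derivative[OF \<phi>, of v] closure_subset by (fastforce simp: C0inf_def)
  then have "indicat_real \<Omega> x *\<^sub>R frechet_derivative \<phi> (at x) v = frechet_derivative \<phi> (at x) v" for x
    by (auto simp: indicator_def)
  then have "(\<integral>x. frechet_derivative \<phi> (at x) v \<partial>lebesgue_on \<Omega>)
      = (\<integral>x. frechet_derivative \<phi> (at x) v \<partial>lebesgue)"
    using \<open>open \<Omega>\<close> by (simp add: integral_restrict_space)
  also have "\<dots> = 0"
  proof (rule integral_derivative_compact_support[OF _ _ K(1)])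
    show "\<phi> differentiable at x" for x using sm by (rule smooth_on_differentiable)
    show "continuous_on UNIV (\<lambda>x. frechet_derivative \<phi> (at x) v)"
      using sm by (intro smooth_on_continuous smooth_on_derivative)
    show "\<phi> x = 0" if "x \<notin> ?K" for x
      using that closure_subset[of "{x. \<phi> x \<noteq> 0}"] by auto
  qed
  finally show ?thesis .
qed


section \<open>Bump functions on boxes\<close>

text \<open>The functions \<open>p(1/t) exp(-1/t)\<close> for \<open>t > 0\<close>, extended by \<open>0\<close>. As \<open>p\<close> ranges over all
  polynomials, this family is closed under differentiation, which makes smoothness a
  plain induction.\<close>

definition flat :: "real poly \<Rightarrow> real \<Rightarrow> real" where
  "flat p t = (if t > 0 then poly p (1 / t) * exp (- (1 / t)) else 0)"

lemma poly_div_exp_tendsto_0: "((\<lambda>y. poly p y * exp (- y)) \<longlongrightarrow> 0) at_top" for p :: "real poly"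
proof -
  have "((\<lambda>y. \<Sum>i\<le>degree p. coeff p i * (y ^ i / exp y)) \<longlongrightarrow> (\<Sum>i\<le>degree p. coeff p i * 0)) at_top"
    by (intro tendsto_sum tendsto_mult_left tendsto_power_div_exp_0)
  then show ?thesis
    by (simp add: poly_altdef sum_distrib_right exp_minus divide_inverse mult.assoc)
qed

text \<open>Away from \<open>0\<close> this is the chain rule; the factor \<open>[:0, 0, 1:]\<close>, evaluated at \<open>1/t\<close>, is \<open>1/t\<^sup>2\<close>.
  At \<open>0\<close> the difference quotient is again of the form \<open>q(1/h) exp(-1/h)\<close>, hence tends to \<open>0\<close>.\<close>

lemma DERIV_flat: "(flat p has_real_derivative flat ([:0, 0, 1:] * (p - pderiv p)) t) (at t)"
proof -
  let ?q = "[:0, 0, 1:] * (p - pderiv p)"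
  consider "t > 0" | "t < 0" | "t = 0" by linarith
  then show ?thesis
  proof cases
    case 1
    have "((\<lambda>t. poly p (1 / t) * exp (- (1 / t))) has_real_derivative flat ?q t) (at t)"
      using 1 by (auto intro!: derivative_eq_intros DERIV_chain2[OF poly_DERIV]
          simp: flat_def field_simps power2_eq_square)
    then show ?thesis
    proof (rule has_field_derivative_transform_within_open[where S = "{0<..}"])
      show "poly p (1 / x) * exp (- (1 / x)) = flat p x" if "x \<in> {0<..}" for x
        using that by (simp add: flat_def)
    qed (use 1 in auto)
  next
    case 2
    have "((\<lambda>t. 0) has_real_derivative flat ?q t) (at t)"
      using 2 by (auto simp: flat_def)
    then show ?thesis
    proof (rule has_field_derivative_transform_within_open[where S = "{..<0}"])
      show "0 = flat p x" if "x \<in> {..<0}" for x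
        using that by (simp add: flat_def)
    qed (use 2 in auto)
  next
    case 3
    have "((\<lambda>h. flat p h / h) \<longlongrightarrow> 0) (at_right 0)"
    proof (rule Lim_transform_eventually)
      show "((\<lambda>h. poly (pCons 0 p) (inverse h) * exp (- inverse h)) \<longlongrightarrow> 0) (at_right 0)"
        by (rule filterlim_compose[OF poly_div_exp_tendsto_0 filterlim_inverse_at_top_right])
      show "\<forall>\<^sub>F h in at_right 0. poly (pCons 0 p) (inverse h) * exp (- inverse h) = flat p h / h"
        using eventually_at_right_less by eventually_elim (simp add: flat_def field_simps)
    qed
    moreover have "((\<lambda>h. flat p h / h) \<longlongrightarrow> 0) (at_left 0)"
    proof (rule Lim_transform_eventually)
      show "\<forall>\<^sub>F h in at_left 0. 0 = flat p h / h"
        by (auto simp: eventually_at_filter flat_def)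
    qed simp
    ultimately have "((\<lambda>h. flat p h / h) \<longlongrightarrow> 0) (at 0)"
      by (simp add: filterlim_split_at)
    then show ?thesis
      using 3 by (simp add: DERIV_def flat_def)
  qed
qed

lemma Ck_on_flat:
  assumes h: "bounded_linear h"
  shows "Ck_on k UNIV (\<lambda>x. flat p (h x + c))"
proof (induction k arbitrary: p)
  have D: "((\<lambda>x. flat p (h x + c)) has_derivative
      (\<lambda>v. flat ([:0, 0, 1:] * (p - pderiv p)) (h x + c) * h v)) (at x)" for p x
  proof -
    have "((\<lambda>x. h x + c) has_derivative h) (at x)"
      using bounded_linear_imp_has_derivative[OF h] by (auto intro!: derivative_eq_intros)
    from has_derivative_compose[OF this has_field_derivative_imp_has_derivative[OF DERIV_flat]]
    show ?thesis .
  qed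
  {
    case 0
    show ?case
      using D by (auto intro!: continuous_at_imp_continuous_on has_derivative_continuous)
  next
    case (Suc k)
    have "frechet_derivative (\<lambda>x. flat p (h x + c)) (at x)
        = (\<lambda>v. flat ([:0, 0, 1:] * (p - pderiv p)) (h x + c) * h v)" for x
      by (rule frechet_derivative_at[OF D, symmetric])
    moreover have "Ck_on k UNIV (\<lambda>x. flat ([:0, 0, 1:] * (p - pderiv p)) (h x + c) * h v)" for v
      by (rule Ck_on_linear[OF bounded_linear_mult_left Suc.IH])
    moreover have "(\<lambda>x. flat p (h x + c)) differentiable (at x)" for x
      using D differentiable_def by blast
    ultimately show ?case
      by (simp only: Ck_on.simps) blast
  }
qed

text \<open>For \<open>p = 1\<close> the function \<open>flat p (n t) = exp (-1/(n t))\<close> increases to \<open>1\<close> for each \<open>t > 0\<close> as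
  \<open>n\<close> grows. With such factors for the distances to all faces, the bumps increase to the
  indicator function of the open box.\<close>

definition box_bump :: "'a::euclidean_space \<Rightarrow> 'a \<Rightarrow> nat \<Rightarrow> 'a \<Rightarrow> real" where
  "box_bump a b n x = (\<Prod>i\<in>Basis. flat 1 (real (Suc n) * ((x - a) \<bullet> i)) * flat 1 (real (Suc n) * ((b - x) \<bullet> i)))"

lemma flat_1_bounds: "0 \<le> flat 1 t \<and> flat 1 t \<le> 1"
  by (simp add: flat_def)

lemma box_bump_bounds: "0 \<le> box_bump a b n x" "box_bump a b n x \<le> indicat_real (box a b) x"
proof -
  show "0 \<le> box_bump a b n x"
    unfolding box_bump_def using flat_1_bounds by (intro prod_nonneg ballI mult_nonneg_nonneg) auto
  show "box_bump a b n x \<le> indicat_real (box a b) x"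
  proof (cases "x \<in> box a b")
    case True
    have "box_bump a b n x \<le> 1"
      unfolding box_bump_def using flat_1_bounds
      by (intro prod_le_1 conjI mult_nonneg_nonneg mult_le_one) auto
    then show ?thesis using True by simp
  next
    case False
    then obtain i where i: "i \<in> Basis" "x \<bullet> i \<le> a \<bullet> i \<or> b \<bullet> i \<le> x \<bullet> i"
      by (force simp: mem_box)
    then have "(x - a) \<bullet> i \<le> 0 \<or> (b - x) \<bullet> i \<le> 0"
      by (auto simp: inner_diff_left)
    then have "real (Suc n) * ((x - a) \<bullet> i) \<le> 0 \<or> real (Suc n) * ((b - x) \<bullet> i) \<le> 0"
      by (metis mult_nonneg_nonpos of_nat_0_le_iff)
    then have "flat 1 (real (Suc n) * ((x - a) \<bullet> i)) * flat 1 (real (Suc n) * ((b - x) \<bullet> i)) = 0"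
      by (auto simp: flat_def)
    with i have "box_bump a b n x = 0"
      unfolding box_bump_def by (intro prod_zero) auto
    then show ?thesis by simp
  qed
qed

lemma box_bump_tendsto: "(\<lambda>n. box_bump a b n x) \<longlonglongrightarrow> indicat_real (box a b) x"
proof (cases "x \<in> box a b")
  case True
  have lim: "(\<lambda>n. flat 1 (real (Suc n) * c)) \<longlonglongrightarrow> 1" if "c > 0" for c
  proof -
    have "(\<lambda>n. inverse (real (Suc n)) * inverse c) \<longlonglongrightarrow> 0 * inverse c"
      by (intro tendsto_mult_right LIMSEQ_inverse_real_of_nat)
    then have "(\<lambda>n. exp (- (inverse (real (Suc n)) * inverse c))) \<longlonglongrightarrow> exp (- (0 * inverse c))"
      by (intro tendsto_exp tendsto_minus)
    then show ?thesis using that by (simp add: flat_def divide_inverse)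
  qed
  have "(\<lambda>n. box_bump a b n x) \<longlonglongrightarrow> (\<Prod>i\<in>(Basis::'a set). 1 * 1)"
    unfolding box_bump_def
    using True by (intro tendsto_prod tendsto_mult lim) (auto simp: mem_box inner_diff_left)
  then show ?thesis using True by simp
next
  case False
  then have "box_bump a b n x = 0" for n
    using box_bump_bounds[of a b n x] by simp
  then show ?thesis using False by simp
qed

lemma box_bump_C0inf:
  assumes "cbox a b \<subseteq> \<Omega>"
  shows "box_bump a b n \<in> C0inf \<Omega>"
proof -
  have sm: "smooth_on UNIV (\<lambda>x::real^3. flat 1 (real (Suc n) * ((x - a) \<bullet> i)) * flat 1 (real (Suc n) * ((b - x) \<bullet> i)))" for i
  proof -
    have "smooth_on UNIV (\<lambda>x. flat 1 ((real (Suc n) *\<^sub>R i) \<bullet> x + - (real (Suc n) * (a \<bullet> i))))"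
      "smooth_on UNIV (\<lambda>x. flat 1 ((- real (Suc n) *\<^sub>R i) \<bullet> x + real (Suc n) * (b \<bullet> i)))"
      unfolding smooth_on_def by (intro allI Ck_on_flat bounded_linear_inner_right)+
    from smooth_on_scaleR[OF this] show ?thesis
      by (simp add: inner_diff_left inner_commute[of i] algebra_simps)
  qed
  have "smooth_on UNIV (box_bump a b n)"
    using smooth_on_prod[OF sm] unfolding box_bump_def[abs_def] .
  moreover have sub: "closure {x. box_bump a b n x \<noteq> 0} \<subseteq> cbox a b"
  proof (rule closure_minimal)
    show "{x. box_bump a b n x \<noteq> 0} \<subseteq> cbox a b"
    proof
      fix x assume "x \<in> {x. box_bump a b n x \<noteq> 0}"
      then have "x \<in> box a b"
        using box_bump_bounds[of a b n x] by (cases "x \<in> box a b") auto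
      then show "x \<in> cbox a b" using box_subset_cbox by blast
    qed
  qed (rule closed_cbox)
  moreover have "compact (closure {x. box_bump a b n x \<noteq> 0})"
    using compact_Int_closed[of "cbox a b" "closure {x. box_bump a b n x \<noteq> 0}"] sub
    by (simp add: Int_absorb1)
  ultimately show ?thesis
    using assms by (auto simp: C0inf_def)
qed


section \<open>The fundamental lemma of the calculus of variations\<close>

text \<open>The sets on which the integral of \<open>g\<close> vanishes form a Dynkin system; it contains the boxes,
  which are stable under intersection, hence all Borel sets, and then all Lebesgue sets.\<close>

lemma AE_zero_if_box_integrals_zero:
  fixes g :: "real^3 \<Rightarrow> 'b::euclidean_space"
  assumes int: "integrable lebesgue g" and tot: "(\<integral>x. g x \<partial>lebesgue) = 0"
    and boxes: "\<And>c d. (LINT x:box c d|lebesgue. g x) = 0"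
  shows "AE x in lebesgue. g x = 0"
proof (rule sigma_finite_measure.density_zero[OF _ int])
  show "sigma_finite_measure (lebesgue :: (real^3) measure)"
  proof
    obtain A :: "(real^3) set set" where "countable A" "A \<subseteq> sets lborel" "\<Union>A = space lborel"
      "\<forall>a\<in>A. emeasure lborel a \<noteq> \<infinity>"
      using lborel.sigma_finite_countable by blast
    then show "\<exists>A :: (real^3) set set. countable A \<and> A \<subseteq> sets lebesgue \<and> \<Union>A = space lebesgue
        \<and> (\<forall>a\<in>A. emeasure lebesgue a \<noteq> \<infinity>)"
      by (intro exI[of _ A]) auto
  qed
  have si: "set_integrable lebesgue A g" if "A \<in> sets lebesgue" for A
    using int that unfolding set_integrable_def by (intro integrable_mult_indicator)
  have borel: "(LINT x:A|lebesgue. g x) = 0" if A: "A \<in> sets borel" for A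
  proof -
    let ?E = "range (\<lambda>(a, b). box a b :: (real^3) set)"
    have "Int_stable ?E" by (auto simp: Int_stable_def box_Int_box)
    moreover have "?E \<subseteq> Pow UNIV" by auto
    moreover have "A \<in> sigma_sets UNIV ?E"
      using A by (simp add: borel_eq_box)
    ultimately show ?thesis
    proof (induction rule: sigma_sets_induct_disjoint)
      case (basic A)
      then show ?case using boxes by auto
    next
      case empty
      then show ?case by (simp add: set_lebesgue_integral_def)
    next
      case (compl A)
      then have A: "A \<in> sets lebesgue"
        using sets_completionI_sets[of A lborel] by (simp add: borel_eq_box)
      have "(LINT x:UNIV|lebesgue. g x) = (LINT x:A|lebesgue. g x) + (LINT x:UNIV - A|lebesgue. g x)"
      proof -
        have "UNIV - A \<in> sets lebesgue"
          using sets.compl_sets[OF A] by simp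
        then show ?thesis
          using A set_integral_Un[of A "UNIV - A" lebesgue g] si by simp
      qed
      then show ?case using compl tot by (simp add: set_lebesgue_integral_def)
    next
      case (union A)
      then have A: "A i \<in> sets lebesgue" for i
      proof -
        have "A i \<in> sigma_sets UNIV ?E" using union(2) by blast
        then have "A i \<in> sets borel" by (simp add: borel_eq_box)
        then show ?thesis using sets_completionI_sets[of "A i" lborel] by simp
      qed
      have "(LINT x:(\<Union>i. A i)|lebesgue. g x) = (\<Sum>i. (LINT x:(A i)|lebesgue. g x))"
        using union(1) A by (intro lebesgue_integral_countable_add si) (auto simp: disjoint_family_on_def)
      then show ?case using union by simp
    qed
  qed
  show "(LINT x:A|lebesgue. g x) = 0" if A: "A \<in> sets lebesgue" for A
  proof -
    obtain S N N' where S: "A = S \<union> N" "N \<subseteq> N'" "N' \<in> null_sets lborel" "S \<in> sets lborel"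
      using A by (rule sets_completionE)
    have Sl: "S \<in> sets lebesgue" using S(4) by (rule sets_completionI_sets)
    have "(A - S) \<union> (S - A) \<subseteq> N'" using S(1,2) by blast
    moreover have "N' \<in> null_sets lebesgue" using S(3) by (rule null_sets_completionI)
    ultimately have "(A - S) \<union> (S - A) \<in> null_sets lebesgue"
      by (rule null_sets_completion_subset)
    then have "(LINT x:A|lebesgue. g x) = (LINT x:S|lebesgue. g x)"
      using int A Sl by (intro set_integral_null_delta)
    then show ?thesis using borel S(4) by simp
  qed
qed

text \<open>Testing with bump functions and passing to the limit shows that \<open>G\<close> has integral \<open>0\<close> over every
  box whose closure lies in \<open>\<Omega>\<close>. For a fixed such box \<open>B\<close>, the integrable field \<open>G\<close> cut off outside
  \<open>B\<close> has vanishing integrals over all boxes, so it is \<open>0\<close> almost everywhere; countably many such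
  boxes cover \<open>\<Omega>\<close> up to a null set.\<close>

lemma fundamental_lemma:
  fixes G :: "real^3 \<Rightarrow> 'b::euclidean_space"
  assumes "open \<Omega>" and G: "G \<in> L2 \<Omega>"
    and test: "\<And>\<phi>. \<phi> \<in> C0inf \<Omega> \<Longrightarrow> (\<integral>x. \<phi> x *\<^sub>R G x \<partial>lebesgue_on \<Omega>) = 0"
  shows "eq_ae \<Omega> G (\<lambda>x. 0)"
proof -
  have \<Omega>: "\<Omega> \<in> sets lebesgue" using \<open>open \<Omega>\<close> by simp
  have Gm: "G \<in> borel_measurable (lebesgue_on \<Omega>)" using G by (rule L2_measurable)
  have int: "integrable (lebesgue_on \<Omega>) (\<lambda>x. indicat_real (box a b) x *\<^sub>R G x)"
    and zero: "(\<integral>x. indicat_real (box a b) x *\<^sub>R G x \<partial>lebesgue_on \<Omega>) = 0"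
    if ab: "cbox a b \<subseteq> \<Omega>" for a b
  proof -
    \<comment> \<open>An integrable majorant of \<open>\<bar>G\<bar>\<close> on the box, because \<open>y \<le> 1 + y\<^sup>2\<close>.\<close>
    let ?w = "\<lambda>x. indicat_real (box a b) x + (norm (G x))\<^sup>2"
    have "integrable lebesgue (indicat_real (box a b))"
      by (intro integrable_real_indicator) (auto simp: emeasure_lborel_box_eq)
    then have "integrable (lebesgue_on \<Omega>) (indicat_real (box a b))"
      using \<Omega> integrable_mult_indicator[of \<Omega> lebesgue "indicat_real (box a b)"]
      by (simp add: integrable_restrict_space)
    then have w: "integrable (lebesgue_on \<Omega>) ?w"
      using G by (simp add: L2_def)
    have im: "(\<lambda>x. indicat_real (box a b) x *\<^sub>R G x) \<in> borel_measurable (lebesgue_on \<Omega>)"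
      using Gm \<open>integrable (lebesgue_on \<Omega>) (indicat_real (box a b))\<close>
      by (intro borel_measurable_scaleR) auto
    have le: "norm (c *\<^sub>R G x) \<le> ?w x" if "0 \<le> c" "c \<le> indicat_real (box a b) x" for c x
    proof -
      have "norm (c *\<^sub>R G x) \<le> indicat_real (box a b) x * norm (G x)"
        using that by (simp add: mult_right_mono)
      also have "\<dots> \<le> ?w x"
        using sum_squares_bound[of 1 "norm (G x)"] by (auto simp: indicator_def intro: order_trans[rotated])
      finally show ?thesis .
    qed
    show "integrable (lebesgue_on \<Omega>) (\<lambda>x. indicat_real (box a b) x *\<^sub>R G x)"
    proof (rule Bochner_Integration.integrable_bound[OF w im], rule AE_I2)
      fix x
      have "norm (indicat_real (box a b) x *\<^sub>R G x) \<le> ?w x" by (rule le) auto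
      then show "norm (indicat_real (box a b) x *\<^sub>R G x) \<le> norm (?w x)" by simp
    qed
    have "(\<lambda>n. \<integral>x. box_bump a b n x *\<^sub>R G x \<partial>lebesgue_on \<Omega>)
        \<longlonglongrightarrow> (\<integral>x. indicat_real (box a b) x *\<^sub>R G x \<partial>lebesgue_on \<Omega>)"
    proof (rule integral_dominated_convergence[OF im _ w])
      show "(\<lambda>x. box_bump a b n x *\<^sub>R G x) \<in> borel_measurable (lebesgue_on \<Omega>)" for n
        using C0inf_smooth[OF box_bump_C0inf[OF ab, of n]]
        by (intro borel_measurable_scaleR Gm lebesgue_on_measurable_continuous smooth_on_continuous)
      show "AE x in lebesgue_on \<Omega>. (\<lambda>n. box_bump a b n x *\<^sub>R G x) \<longlonglongrightarrow> indicat_real (box a b) x *\<^sub>R G x"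
        by (intro AE_I2 tendsto_scaleR box_bump_tendsto tendsto_const)
      show "AE x in lebesgue_on \<Omega>. norm (box_bump a b n x *\<^sub>R G x) \<le> ?w x" for n
        by (intro AE_I2 le box_bump_bounds)
    qed
    moreover have "(\<integral>x. box_bump a b n x *\<^sub>R G x \<partial>lebesgue_on \<Omega>) = 0" for n
      using test box_bump_C0inf[OF ab] by blast
    ultimately show "(\<integral>x. indicat_real (box a b) x *\<^sub>R G x \<partial>lebesgue_on \<Omega>) = 0"
      by (simp add: LIMSEQ_const_iff)
  qed
  have on_box: "AE x in lebesgue. x \<in> box a b \<longrightarrow> G x = 0" if ab: "cbox a b \<subseteq> \<Omega>" for a b
  proof -
    have sub: "box a b \<subseteq> \<Omega>" using ab box_subset_cbox by blast
    let ?g = "\<lambda>x. indicat_real (box a b) x *\<^sub>R G x"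
    have *: "indicat_real \<Omega> x *\<^sub>R indicat_real (box c d) x *\<^sub>R G x = indicat_real (box c d) x *\<^sub>R G x"
      if "box c d \<subseteq> \<Omega>" for c d x
      using that by (auto simp: indicator_def)
    have z: "(\<integral>x. indicat_real (box c d) x *\<^sub>R G x \<partial>lebesgue) = 0" if "cbox c d \<subseteq> \<Omega>" for c d
    proof -
      have "box c d \<subseteq> \<Omega>" using that box_subset_cbox by blast
      then show ?thesis
        using zero[OF that] \<Omega> *[of c d]
        by (simp add: integral_restrict_space del: scaleR_scaleR)
    qed
    have "AE x in lebesgue. ?g x = 0"
    proof (rule AE_zero_if_box_integrals_zero)
      show "integrable lebesgue ?g"
        using int[OF ab] \<Omega> *[OF sub]
        by (simp add: integrable_restrict_space del: scaleR_scaleR)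
      show "integral\<^sup>L lebesgue ?g = 0" using z[OF ab] .
      fix c d
      have "indicat_real (box c d) x *\<^sub>R ?g x = indicat_real (box c d \<inter> box a b) x *\<^sub>R G x" for x
        by (simp add: indicator_def)
      moreover obtain e f where ef: "box c d \<inter> box a b = box e f" "cbox e f \<subseteq> cbox a b"
        unfolding box_Int_box by (auto simp: subset_box)
      ultimately have "indicat_real (box c d) x *\<^sub>R ?g x = indicat_real (box e f) x *\<^sub>R G x" for x
        by simp
      then have "(LINT x:box c d|lebesgue. ?g x) = (\<integral>x. indicat_real (box e f) x *\<^sub>R G x \<partial>lebesgue)"
        unfolding set_lebesgue_integral_def by (rule Bochner_Integration.integral_cong[OF refl])
      also have "\<dots> = 0" using ef(2) ab by (intro z) blast
      finally show "(LINT x:box c d|lebesgue. ?g x) = 0" .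
    qed
    then show ?thesis by eventually_elim (auto simp: indicator_def)
  qed
  obtain \<D> where D: "countable \<D>" "\<D> \<subseteq> Pow \<Omega>" "\<And>X. X \<in> \<D> \<Longrightarrow> \<exists>a b. X = cbox a b" "\<Union>\<D> = \<Omega>"
    using open_countable_Union_open_cbox[OF \<open>open \<Omega>\<close>] by metis
  have "AE x in lebesgue. \<forall>X\<in>\<D>. x \<in> X \<longrightarrow> G x = 0"
  proof (subst AE_ball_countable[OF D(1)], intro ballI)
    fix X assume X: "X \<in> \<D>"
    then obtain a b where ab: "X = cbox a b" "cbox a b \<subseteq> \<Omega>" using D by blast
    have "AE x in lebesgue. x \<notin> cbox a b - box a b"
      using negligible_frontier_interval[of a b] by (intro AE_not_in) (simp add: negligible_iff_null_sets)
    with on_box[OF ab(2)] show "AE x in lebesgue. x \<in> X \<longrightarrow> G x = 0"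
      unfolding ab(1) by eventually_elim auto
  qed
  then have "AE x in lebesgue. x \<in> \<Omega> \<longrightarrow> G x = 0"
    using D(4) by (auto elim!: eventually_mono)
  then show ?thesis
    unfolding eq_ae_def using \<Omega> by (subst AE_restrict_space_iff) auto
qed


section \<open>Weak first order differential operators\<close>

abbreviation pd :: "3 \<Rightarrow> (real^3 \<Rightarrow> 'a::real_normed_vector) \<Rightarrow> real^3 \<Rightarrow> 'a" where
  "pd j \<phi> x \<equiv> frechet_derivative \<phi> (at x) (axis j 1)"

lemma frechet_derivative_linear_image:
  assumes "bounded_linear h" "smooth_on UNIV \<phi>"
  shows "frechet_derivative (\<lambda>x. h (\<phi> x)) (at x) = (\<lambda>v. h (frechet_derivative \<phi> (at x) v))"
proof -
  have "(\<phi> has_derivative frechet_derivative \<phi> (at x)) (at x)"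
    using smooth_on_differentiable[OF assms(2)] frechet_derivative_works by blast
  from bounded_linear.has_derivative[OF assms(1) this] show ?thesis
    by (rule frechet_derivative_at[symmetric])
qed

lemma L2_inner: "f \<in> L2 \<Omega> \<Longrightarrow> (\<lambda>x. f x \<bullet> b) \<in> L2 \<Omega>"
  by (rule L2_linear_image[where h = "\<lambda>y. y \<bullet> b"]) (auto intro!: linearI simp: inner_add_left)

lemma integrable_scaleR_L2:
  assumes "\<phi> \<in> L2 \<Omega>" "g \<in> L2 \<Omega>"
  shows "integrable (lebesgue_on \<Omega>) (\<lambda>x. \<phi> x *\<^sub>R g x)"
proof -
  have "integrable (lebesgue_on \<Omega>) (\<lambda>x. \<Sum>b\<in>Basis. (\<phi> x \<bullet> (g x \<bullet> b)) *\<^sub>R b)"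
    using assms by (intro Bochner_Integration.integrable_sum integrable_scaleR_left integrable_inner L2_inner)
  moreover have "(\<Sum>b\<in>Basis. (\<phi> x \<bullet> (g x \<bullet> b)) *\<^sub>R b) = \<phi> x *\<^sub>R g x" for x
    using euclidean_representation[of "\<phi> x *\<^sub>R g x"] by simp
  ultimately show ?thesis by simp
qed

text \<open>\<open>g = \<Sum>\<^sub>j B\<^sub>j \<partial>\<^sub>j f\<close> in the sense of distributions, for constant coefficients \<open>B\<^sub>j\<close>. Testing with
  scalar functions and vector-valued integrals avoids coordinates in the target space.\<close>

definition weak_op :: "(real^3) set \<Rightarrow> (3 \<Rightarrow> 'a::euclidean_space \<Rightarrow> 'b::euclidean_space)
    \<Rightarrow> (real^3 \<Rightarrow> 'a) \<Rightarrow> (real^3 \<Rightarrow> 'b) \<Rightarrow> bool" where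
  "weak_op \<Omega> B f g \<longleftrightarrow> g \<in> L2 \<Omega> \<and> (\<forall>\<phi>\<in>C0inf \<Omega>.
     (\<integral>x. \<phi> x *\<^sub>R g x \<partial>lebesgue_on \<Omega>) = - (\<integral>x. (\<Sum>j\<in>UNIV. pd j \<phi> x *\<^sub>R B j (f x)) \<partial>lebesgue_on \<Omega>))"

lemma weak_op_unique:
  fixes B :: "3 \<Rightarrow> 'a::euclidean_space \<Rightarrow> 'b::euclidean_space"
  assumes "open \<Omega>" "weak_op \<Omega> B f g" "weak_op \<Omega> B f h"
  shows "eq_ae \<Omega> g h"
proof -
  have "eq_ae \<Omega> (\<lambda>x. g x - h x) (\<lambda>x. 0)"
  proof (rule fundamental_lemma[OF \<open>open \<Omega>\<close>])
    show "(\<lambda>x. g x - h x) \<in> L2 \<Omega>" using assms by (simp add: weak_op_def L2_diff)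
    fix \<phi> :: "real^3 \<Rightarrow> real" assume \<phi>: "\<phi> \<in> C0inf \<Omega>"
    have L: "\<phi> \<in> L2 \<Omega>" "g \<in> L2 \<Omega>" "h \<in> L2 \<Omega>"
      using assms C0inf_L2[OF \<phi>] by (auto simp: weak_op_def)
    have "(\<integral>x. \<phi> x *\<^sub>R g x - \<phi> x *\<^sub>R h x \<partial>lebesgue_on \<Omega>)
        = (\<integral>x. \<phi> x *\<^sub>R g x \<partial>lebesgue_on \<Omega>) - (\<integral>x. \<phi> x *\<^sub>R h x \<partial>lebesgue_on \<Omega>)"
      by (intro Bochner_Integration.integral_diff integrable_scaleR_L2 L)
    also have "\<dots> = 0" using assms(2,3) \<phi> by (simp add: weak_op_def)
    finally show "(\<integral>x. \<phi> x *\<^sub>R (g x - h x) \<partial>lebesgue_on \<Omega>) = 0"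
      by (simp add: scaleR_diff_right)
  qed
  then show ?thesis by (simp add: eq_ae_def)
qed

lemma L2_first_order:
  fixes B :: "3 \<Rightarrow> 'a::euclidean_space \<Rightarrow> 'b::euclidean_space" and \<phi> :: "real^3 \<Rightarrow> real"
  assumes "open \<Omega>" "\<And>j. linear (B j)" "f \<in> L2 \<Omega>" "\<phi> \<in> C0inf \<Omega>"
  shows "integrable (lebesgue_on \<Omega>) (\<lambda>x. \<Sum>j\<in>UNIV. pd j \<phi> x *\<^sub>R B j (f x))"
proof (intro Bochner_Integration.integrable_sum integrable_scaleR_L2)
  show "(\<lambda>x. pd j \<phi> x) \<in> L2 \<Omega>" for j
    by (rule C0inf_L2[OF C0inf_derivative[OF assms(4)] assms(1)])
  show "(\<lambda>x. B j (f x)) \<in> L2 \<Omega>" for j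
    by (rule L2_linear_image[OF assms(2,3)])
qed

lemma weak_op_lincomb:
  fixes B :: "3 \<Rightarrow> 'a::euclidean_space \<Rightarrow> 'b::euclidean_space"
  assumes "open \<Omega>" "\<And>j. linear (B j)" "f \<in> L2 \<Omega>" "f' \<in> L2 \<Omega>" "weak_op \<Omega> B f g" "weak_op \<Omega> B f' g'"
  shows "weak_op \<Omega> B (\<lambda>x. a *\<^sub>R f x + b *\<^sub>R f' x) (\<lambda>x. a *\<^sub>R g x + b *\<^sub>R g' x)"
  unfolding weak_op_def
proof (intro conjI ballI)
  have L: "g \<in> L2 \<Omega>" "g' \<in> L2 \<Omega>" using assms by (auto simp: weak_op_def)
  then show "(\<lambda>x. a *\<^sub>R g x + b *\<^sub>R g' x) \<in> L2 \<Omega>" by (simp add: L2_closure)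
  fix \<phi> :: "real^3 \<Rightarrow> real" assume \<phi>: "\<phi> \<in> C0inf \<Omega>"
  let ?F = "\<lambda>f x. \<Sum>j\<in>UNIV. pd j \<phi> x *\<^sub>R B j (f x)"
  have "(\<integral>x. \<phi> x *\<^sub>R (a *\<^sub>R g x + b *\<^sub>R g' x) \<partial>lebesgue_on \<Omega>)
      = (\<integral>x. a *\<^sub>R (\<phi> x *\<^sub>R g x) + b *\<^sub>R (\<phi> x *\<^sub>R g' x) \<partial>lebesgue_on \<Omega>)"
    by (simp add: algebra_simps)
  also have "\<dots> = a *\<^sub>R (\<integral>x. \<phi> x *\<^sub>R g x \<partial>lebesgue_on \<Omega>) + b *\<^sub>R (\<integral>x. \<phi> x *\<^sub>R g' x \<partial>lebesgue_on \<Omega>)"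
    using integrable_scaleR_L2[OF C0inf_L2[OF \<phi> \<open>open \<Omega>\<close>] L(1)]
      integrable_scaleR_L2[OF C0inf_L2[OF \<phi> \<open>open \<Omega>\<close>] L(2)]
    by (simp add: Bochner_Integration.integral_add del: scaleR_scaleR)
  also have "\<dots> = - (a *\<^sub>R (\<integral>x. ?F f x \<partial>lebesgue_on \<Omega>) + b *\<^sub>R (\<integral>x. ?F f' x \<partial>lebesgue_on \<Omega>))"
    using assms(5,6) \<phi> by (simp add: weak_op_def)
  also have "\<dots> = - (\<integral>x. a *\<^sub>R ?F f x + b *\<^sub>R ?F f' x \<partial>lebesgue_on \<Omega>)"
    using L2_first_order[OF assms(1,2) _ \<phi>] assms(3,4) by simp
  also have "(\<lambda>x. a *\<^sub>R ?F f x + b *\<^sub>R ?F f' x) = ?F (\<lambda>x. a *\<^sub>R f x + b *\<^sub>R f' x)"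
    using assms(2) by (simp add: linear_add linear_scale scaleR_sum_right sum.distrib algebra_simps)
  finally show "(\<integral>x. \<phi> x *\<^sub>R (a *\<^sub>R g x + b *\<^sub>R g' x) \<partial>lebesgue_on \<Omega>)
      = - (\<integral>x. ?F (\<lambda>x. a *\<^sub>R f x + b *\<^sub>R f' x) x \<partial>lebesgue_on \<Omega>)" .
qed

text \<open>For each \<open>j\<close> the integral of \<open>\<partial>\<^sub>j (\<psi> B\<^sub>j \<phi>)\<close> is \<open>0\<close>, because \<open>\<psi> B\<^sub>j \<phi>\<close> is a test function.\<close>

lemma weak_op_C0inf:
  fixes B :: "3 \<Rightarrow> 'a::euclidean_space \<Rightarrow> 'b::euclidean_space"
  assumes "open \<Omega>" and B: "\<And>j. linear (B j)" and \<phi>: "\<phi> \<in> C0inf \<Omega>"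
  shows "weak_op \<Omega> B \<phi> (\<lambda>x. \<Sum>j\<in>UNIV. B j (pd j \<phi> x))"
  unfolding weak_op_def
proof (intro conjI ballI)
  have \<phi>j: "(\<lambda>x. B j (pd j \<phi> x)) \<in> L2 \<Omega>" for j
    using \<phi> B \<open>open \<Omega>\<close> by (intro L2_linear_image[of "B _"] C0inf_L2 C0inf_derivative)
  then show "(\<lambda>x. \<Sum>j\<in>UNIV. B j (pd j \<phi> x)) \<in> L2 \<Omega>" by (intro L2_sum)
  fix \<psi> :: "real^3 \<Rightarrow> real" assume \<psi>: "\<psi> \<in> C0inf \<Omega>"
  have zero: "(\<integral>x. \<psi> x *\<^sub>R B j (pd j \<phi> x) + pd j \<psi> x *\<^sub>R B j (\<phi> x) \<partial>lebesgue_on \<Omega>) = 0" for j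
  proof -
    have bl: "bounded_linear (B j)" using B by (simp add: linear_conv_bounded_linear)
    let ?B = "\<lambda>x. B j (\<phi> x)"
    have sm: "smooth_on UNIV \<psi>" "smooth_on UNIV ?B"
      using C0inf_smooth[OF \<psi>] smooth_on_linear[OF bl C0inf_smooth[OF \<phi>]] by auto
    have "(\<lambda>x. \<psi> x *\<^sub>R ?B x) \<in> C0inf \<Omega>"
    proof (rule C0infI[OF smooth_on_scaleR[OF sm] \<psi>])
      show "\<psi> x *\<^sub>R ?B x = 0" if "x \<notin> closure {x. \<psi> x \<noteq> 0}" for x
        using that closure_subset[of "{x. \<psi> x \<noteq> 0}"] by auto
    qed
    then have "(\<integral>x. pd j (\<lambda>x. \<psi> x *\<^sub>R ?B x) x \<partial>lebesgue_on \<Omega>) = 0"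
      using \<open>open \<Omega>\<close> by (rule C0inf_integral_derivative[rotated])
    moreover have "pd j (\<lambda>x. \<psi> x *\<^sub>R ?B x) x = \<psi> x *\<^sub>R B j (pd j \<phi> x) + pd j \<psi> x *\<^sub>R ?B x" for x
      using frechet_derivative_linear_image[OF bl C0inf_smooth[OF \<phi>]]
        frechet_derivative_at[OF bounded_bilinear.has_frechet_derivative_prod[OF bounded_bilinear_scaleR
          smooth_on_differentiable[OF sm(1)] smooth_on_differentiable[OF sm(2)]], symmetric]
      by simp
    ultimately show ?thesis by simp
  qed
  have int: "integrable (lebesgue_on \<Omega>) (\<lambda>x. \<psi> x *\<^sub>R B j (pd j \<phi> x) + pd j \<psi> x *\<^sub>R B j (\<phi> x))" for j
    using \<phi> \<psi> B \<open>open \<Omega>\<close> \<phi>j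
    by (intro Bochner_Integration.integrable_add integrable_scaleR_L2 L2_linear_image[of "B _"] C0inf_L2 C0inf_derivative)
  have "(\<integral>x. \<psi> x *\<^sub>R (\<Sum>j\<in>UNIV. B j (pd j \<phi> x)) \<partial>lebesgue_on \<Omega>)
      + (\<integral>x. (\<Sum>j\<in>UNIV. pd j \<psi> x *\<^sub>R B j (\<phi> x)) \<partial>lebesgue_on \<Omega>)
      = (\<integral>x. (\<Sum>j\<in>UNIV. \<psi> x *\<^sub>R B j (pd j \<phi> x) + pd j \<psi> x *\<^sub>R B j (\<phi> x)) \<partial>lebesgue_on \<Omega>)"
    by (subst Bochner_Integration.integral_add[symmetric, OF
          integrable_scaleR_L2[OF C0inf_L2[OF \<psi> \<open>open \<Omega>\<close>] L2_sum[OF \<phi>j]]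
          L2_first_order[OF \<open>open \<Omega>\<close> B C0inf_L2[OF \<phi> \<open>open \<Omega>\<close>] \<psi>]])
       (simp add: scaleR_sum_right sum.distrib)
  also have "\<dots> = 0" using int zero by (simp add: Bochner_Integration.integral_sum)
  finally show "(\<integral>x. \<psi> x *\<^sub>R (\<Sum>j\<in>UNIV. B j (pd j \<phi> x)) \<partial>lebesgue_on \<Omega>)
      = - (\<integral>x. (\<Sum>j\<in>UNIV. pd j \<psi> x *\<^sub>R B j (\<phi> x)) \<partial>lebesgue_on \<Omega>)"
    by (simp add: eq_neg_iff_add_eq_0)
qed

text \<open>The weak equation for \<open>z = \<Sum>\<^sub>j B\<^sub>j\<^sup>* \<partial>\<^sub>j S\<close> admits scalar test functions only; it is applied to the
  coordinates of \<open>\<phi>\<close> in an orthonormal basis.\<close>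

lemma weak_op_parts_C0inf:
  fixes B :: "3 \<Rightarrow> 'a::euclidean_space \<Rightarrow> 'b::euclidean_space"
  assumes "open \<Omega>" and B': "\<And>j. linear (B' j)"
    and adj: "\<And>j x y. B j x \<bullet> y = x \<bullet> B' j y"
    and S: "S \<in> L2 \<Omega>" and z: "weak_op \<Omega> B' S z" and \<phi>: "\<phi> \<in> C0inf \<Omega>"
  shows "ip \<Omega> z \<phi> = - ip \<Omega> S (\<lambda>x. \<Sum>j\<in>UNIV. B j (pd j \<phi> x))"
proof -
  have zL: "z \<in> L2 \<Omega>" using z by (simp add: weak_op_def)
  have \<phi>b: "(\<lambda>x. \<phi> x \<bullet> b) \<in> C0inf \<Omega>" for b
    by (rule C0inf_linear[OF bounded_linear_inner_left \<phi>])
  have pd\<phi>: "pd j (\<lambda>x. \<phi> x \<bullet> b) x = pd j \<phi> x \<bullet> b" for j b x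
    using frechet_derivative_linear_image[OF bounded_linear_inner_left C0inf_smooth[OF \<phi>]] by simp
  have eq: "(\<integral>x. (\<phi> x \<bullet> b) * (z x \<bullet> b) \<partial>lebesgue_on \<Omega>)
      = - (\<integral>x. (\<Sum>j\<in>UNIV. (pd j \<phi> x \<bullet> b) * (B' j (S x) \<bullet> b)) \<partial>lebesgue_on \<Omega>)" (is "_ = - (\<integral>x. ?R b x \<partial>_)") for b
  proof -
    have "(\<integral>x. ((\<phi> x \<bullet> b) *\<^sub>R z x) \<bullet> b \<partial>lebesgue_on \<Omega>) = (\<integral>x. (\<phi> x \<bullet> b) *\<^sub>R z x \<partial>lebesgue_on \<Omega>) \<bullet> b"
      by (rule integral_inner_left[OF integrable_scaleR_L2[OF C0inf_L2[OF \<phi>b \<open>open \<Omega>\<close>] zL]])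
    also have "\<dots> = - ((\<integral>x. (\<Sum>j\<in>UNIV. pd j (\<lambda>x. \<phi> x \<bullet> b) x *\<^sub>R B' j (S x)) \<partial>lebesgue_on \<Omega>) \<bullet> b)"
      using z \<phi>b[of b] by (simp add: weak_op_def)
    also have "\<dots> = - (\<integral>x. (\<Sum>j\<in>UNIV. pd j (\<lambda>x. \<phi> x \<bullet> b) x *\<^sub>R B' j (S x)) \<bullet> b \<partial>lebesgue_on \<Omega>)"
      using S B' \<open>open \<Omega>\<close> \<phi>b by (subst integral_inner_left) (auto intro!: L2_first_order)
    finally show ?thesis by (simp add: pd\<phi> inner_sum_left)
  qed
  have intz: "integrable (lebesgue_on \<Omega>) (\<lambda>x. (\<phi> x \<bullet> b) * (z x \<bullet> b))" for b
    using integrable_inner[OF L2_inner L2_inner, OF C0inf_L2[OF \<phi> \<open>open \<Omega>\<close>] zL, of b b] by simp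
  have intR: "integrable (lebesgue_on \<Omega>) (?R b)" for b
  proof (rule Bochner_Integration.integrable_sum)
    fix j :: 3
    have "(\<lambda>x. pd j \<phi> x) \<in> L2 \<Omega>" "(\<lambda>x. B' j (S x)) \<in> L2 \<Omega>"
      by (rule C0inf_L2[OF C0inf_derivative[OF \<phi>] \<open>open \<Omega>\<close>], rule L2_linear_image[OF B' S])
    from integrable_inner[OF L2_inner[OF this(1), of b] L2_inner[OF this(2), of b]]
    show "integrable (lebesgue_on \<Omega>) (\<lambda>x. (pd j \<phi> x \<bullet> b) * (B' j (S x) \<bullet> b))" by simp
  qed
  have "ip \<Omega> z \<phi> = (\<integral>x. (\<Sum>b\<in>Basis. (\<phi> x \<bullet> b) * (z x \<bullet> b)) \<partial>lebesgue_on \<Omega>)"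
    unfolding ip_def by (subst euclidean_inner) (simp add: mult.commute)
  also have "\<dots> = (\<Sum>b\<in>Basis. \<integral>x. (\<phi> x \<bullet> b) * (z x \<bullet> b) \<partial>lebesgue_on \<Omega>)"
    using intz by (rule Bochner_Integration.integral_sum)
  also have "\<dots> = - (\<Sum>b\<in>Basis. \<integral>x. ?R b x \<partial>lebesgue_on \<Omega>)"
    by (simp add: eq sum_negf)
  also have "\<dots> = - (\<integral>x. (\<Sum>b\<in>Basis. ?R b x) \<partial>lebesgue_on \<Omega>)"
    using intR by (simp add: Bochner_Integration.integral_sum)
  also have "(\<lambda>x. \<Sum>b\<in>Basis. ?R b x) = (\<lambda>x. S x \<bullet> (\<Sum>j\<in>UNIV. B j (pd j \<phi> x)))"
  proof
    fix x
    have "(\<Sum>b\<in>Basis. ?R b x) = (\<Sum>j\<in>UNIV. \<Sum>b\<in>Basis. (pd j \<phi> x \<bullet> b) * (B' j (S x) \<bullet> b))"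
      by (rule sum.swap)
    also have "\<dots> = (\<Sum>j\<in>UNIV. pd j \<phi> x \<bullet> B' j (S x))"
      by (simp add: euclidean_inner[symmetric])
    also have "\<dots> = S x \<bullet> (\<Sum>j\<in>UNIV. B j (pd j \<phi> x))"
      unfolding inner_sum_right
      by (rule sum.cong[OF refl]) (simp only: adj[symmetric] inner_commute[of "S x"])
    finally show "(\<Sum>b\<in>Basis. ?R b x) = S x \<bullet> (\<Sum>j\<in>UNIV. B j (pd j \<phi> x))" .
  qed
  finally show ?thesis by (simp add: ip_def)
qed

text \<open>Both sides are continuous in the pair \<open>(f, g)\<close> for the \<open>L\<^sup>2\<close> norm, so the identity for test functions
  extends to fields approximated by test functions in the graph norm of \<open>\<Sum>\<^sub>j B\<^sub>j \<partial>\<^sub>j\<close>.\<close>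

lemma weak_op_parts:
  fixes B :: "3 \<Rightarrow> 'a::euclidean_space \<Rightarrow> 'b::euclidean_space"
  assumes "open \<Omega>" and B: "\<And>j. linear (B j)" and B': "\<And>j. linear (B' j)"
    and adj: "\<And>j x y. B j x \<bullet> y = x \<bullet> B' j y"
    and S: "S \<in> L2 \<Omega>" and z: "weak_op \<Omega> B' S z"
    and f: "f \<in> L2 \<Omega>" and g: "g \<in> L2 \<Omega>"
    and dense: "\<And>\<epsilon>. \<epsilon> > 0 \<Longrightarrow> \<exists>\<phi>\<in>C0inf \<Omega>. L2_norm \<Omega> (\<lambda>x. f x - \<phi> x) < \<epsilon> \<and>
        L2_norm \<Omega> (\<lambda>x. g x - (\<Sum>j\<in>UNIV. B j (pd j \<phi> x))) < \<epsilon>"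
  shows "ip \<Omega> z f = - ip \<Omega> S g"
proof -
  have zL: "z \<in> L2 \<Omega>" using z by (simp add: weak_op_def)
  let ?c = "L2_norm \<Omega> z + L2_norm \<Omega> S"
  have "\<bar>ip \<Omega> z f + ip \<Omega> S g\<bar> \<le> 0 + e" if "e > 0" for e
  proof -
    define d where "d = e / (?c + 1)"
    have c: "?c \<ge> 0" by simp
    then have d: "d > 0" unfolding d_def using that by (intro divide_pos_pos) linarith+
    have "?c + 1 \<noteq> 0" using c by linarith
    then have "(?c + 1) * d = e" unfolding d_def times_divide_eq_right by (rule nonzero_mult_div_cancel_left)
    then have cd: "?c * d \<le> e" using d by (simp add: algebra_simps)
    obtain \<phi> where \<phi>: "\<phi> \<in> C0inf \<Omega>" "L2_norm \<Omega> (\<lambda>x. f x - \<phi> x) < d"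
        "L2_norm \<Omega> (\<lambda>x. g x - (\<Sum>j\<in>UNIV. B j (pd j \<phi> x))) < d"
      using dense[OF d] by blast
    let ?D = "\<lambda>x. \<Sum>j\<in>UNIV. B j (pd j \<phi> x)"
    have L: "\<phi> \<in> L2 \<Omega>" "?D \<in> L2 \<Omega>"
      using \<phi>(1) \<open>open \<Omega>\<close> weak_op_C0inf[OF \<open>open \<Omega>\<close> B \<phi>(1)] by (auto simp: C0inf_L2 weak_op_def)
    have "ip \<Omega> z f + ip \<Omega> S g = ip \<Omega> z (\<lambda>x. f x - \<phi> x) + ip \<Omega> S (\<lambda>x. g x - ?D x)"
      using weak_op_parts_C0inf[OF \<open>open \<Omega>\<close> B' adj S z \<phi>(1)] zL S f g L by (simp add: ip_diff_right)
    also have "\<bar>\<dots>\<bar> \<le> L2_norm \<Omega> z * L2_norm \<Omega> (\<lambda>x. f x - \<phi> x) + L2_norm \<Omega> S * L2_norm \<Omega> (\<lambda>x. g x - ?D x)"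
      using zL S f g L by (intro order_trans[OF abs_triangle_ineq] add_mono ip_Cauchy_Schwarz L2_diff)
    also have "\<dots> \<le> L2_norm \<Omega> z * d + L2_norm \<Omega> S * d"
      using \<phi> by (intro add_mono mult_left_mono) auto
    also have "\<dots> \<le> e" using cd by (simp add: algebra_simps)
    finally show ?thesis by simp
  qed
  then have "\<bar>ip \<Omega> z f + ip \<Omega> S g\<bar> \<le> 0" by (rule field_le_epsilon)
  then show ?thesis by simp
qed


section \<open>Gradient, divergence and curl\<close>

text \<open>The coefficients \<open>B\<^sub>j\<close> of the three operators: \<open>B\<^sub>j u\<close> is the matrix with \<open>j\<close>-th column \<open>u\<close>,
  \<open>B\<^sub>j S\<close> is the \<open>j\<close>-th column of \<open>S\<close>, and \<open>B\<^sub>j P\<close> has the rows \<open>e\<^sub>j \<times> P\<^sub>i\<close>, respectively.\<close>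

definition grad_op :: "3 \<Rightarrow> real^3 \<Rightarrow> real^3^3" where
  "grad_op j u = (\<chi> i k. if k = j then u $ i else 0)"

definition div_op :: "3 \<Rightarrow> real^3^3 \<Rightarrow> real^3" where
  "div_op j S = (\<chi> i. S $ i $ j)"

definition curl_op :: "3 \<Rightarrow> real^3^3 \<Rightarrow> real^3^3" where
  "curl_op j P = (\<chi> i. cross3 (axis j 1) (P $ i))"

lemma linear_grad_op: "linear (grad_op j)"
  by (rule linearI) (auto simp: grad_op_def vec_eq_iff)

lemma linear_div_op: "linear (div_op j)"
  by (rule linearI) (auto simp: div_op_def vec_eq_iff)

lemma linear_curl_op: "linear (curl_op j)"
  by (rule linearI) (auto simp: curl_op_def vec_eq_iff cross_add_right cross_mult_right)

lemma linear_minus_curl_op: "linear (\<lambda>P. - curl_op j P)"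
  by (intro linear_compose_neg linear_curl_op)

lemma grad_op_adjoint: "grad_op j u \<bullet> S = u \<bullet> div_op j S"
  by (simp add: grad_op_def div_op_def inner_vec_def mult_delta_left)

text \<open>Multiplication with \<open>e\<^sub>j\<close> from the left is skew, so \<open>Curl\<close> is formally self-adjoint: \<open>- \<Sum>\<^sub>j B\<^sub>j\<^sup>* \<partial>\<^sub>j\<close>
  is again \<open>Curl\<close>.\<close>

lemma curl_op_adjoint: "curl_op j P \<bullet> S = P \<bullet> - curl_op j S"
proof -
  have "cross3 a p \<bullet> s = p \<bullet> - cross3 a s" for a p s :: "real^3"
    by (simp add: cross3_def inner_vec_def sum_3 algebra_simps)
  then show ?thesis by (simp add: curl_op_def inner_vec_def[of "vec_lambda _"] inner_vec_def[of P] sum_negf)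
qed

lemma weak_op_iff_inner:
  fixes B :: "3 \<Rightarrow> 'a::euclidean_space \<Rightarrow> 'b::euclidean_space"
  assumes "open \<Omega>" and B: "\<And>j. linear (B j)" and f: "f \<in> L2 \<Omega>" and g: "g \<in> L2 \<Omega>"
  shows "weak_op \<Omega> B f g \<longleftrightarrow> (\<forall>\<phi>\<in>C0inf \<Omega>. \<forall>b\<in>Basis.
     (\<integral>x. \<phi> x * (g x \<bullet> b) \<partial>lebesgue_on \<Omega>)
      = - (\<integral>x. (\<Sum>j\<in>UNIV. pd j \<phi> x * (B j (f x) \<bullet> b)) \<partial>lebesgue_on \<Omega>))"
proof -
  have 1: "(\<integral>x. \<phi> x *\<^sub>R g x \<partial>lebesgue_on \<Omega>) \<bullet> b = (\<integral>x. \<phi> x * (g x \<bullet> b) \<partial>lebesgue_on \<Omega>)"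
    if "\<phi> \<in> C0inf \<Omega>" for \<phi> b
    using integral_inner_left[OF integrable_scaleR_L2[OF C0inf_L2[OF that \<open>open \<Omega>\<close>] g], of b] by simp
  have 2: "(\<integral>x. (\<Sum>j\<in>UNIV. pd j \<phi> x *\<^sub>R B j (f x)) \<partial>lebesgue_on \<Omega>) \<bullet> b
      = (\<integral>x. (\<Sum>j\<in>UNIV. pd j \<phi> x * (B j (f x) \<bullet> b)) \<partial>lebesgue_on \<Omega>)"
    if "\<phi> \<in> C0inf \<Omega>" for \<phi> b
    using integral_inner_left[OF L2_first_order[OF \<open>open \<Omega>\<close> B f that], where c = b]
    by (simp add: inner_sum_left)
  show ?thesis
    unfolding weak_op_def using g by (simp add: euclidean_eq_iff[where 'a = 'b] 1 2)
qed

lemma ball_Basis_matrix: "(\<forall>b\<in>Basis. Q b) \<longleftrightarrow> (\<forall>i k. Q (axis i (axis k 1) :: real^3^3))"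
  by (auto simp: Basis_vec_def)

lemma ball_Basis_vector: "(\<forall>b\<in>Basis. Q b) \<longleftrightarrow> (\<forall>i. Q (axis i 1 :: real^3))"
  by (auto simp: Basis_vec_def)

lemma L2_nth: "f \<in> L2 \<Omega> \<Longrightarrow> (\<lambda>x. f x $ i) \<in> L2 \<Omega>"
  by (rule L2_linear_image[where h = "\<lambda>y. y $ i"]) (auto intro!: linearI)

lemma integrable_pd_L2:
  fixes g :: "real^3 \<Rightarrow> real"
  assumes "open \<Omega>" "\<phi> \<in> C0inf \<Omega>" "g \<in> L2 \<Omega>"
  shows "integrable (lebesgue_on \<Omega>) (\<lambda>x. g x * pd j \<phi> x)"
  using integrable_inner[OF assms(3) C0inf_L2[OF C0inf_derivative[OF assms(2)] assms(1)], of "axis j 1"]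
  by simp

lemma is_grad_iff:
  assumes "open \<Omega>" and u: "u \<in> L2 \<Omega>"
  shows "is_grad \<Omega> u G \<longleftrightarrow> weak_op \<Omega> grad_op u G"
proof (cases "G \<in> L2 \<Omega>")
  case True
  have sum: "(\<Sum>j\<in>UNIV. pd j \<phi> x * (grad_op j w \<bullet> axis i (axis k 1))) = w $ i * pd k \<phi> x"
    for \<phi> :: "real^3 \<Rightarrow> real" and x w i k
    by (simp add: inner_axis grad_op_def mult_delta_right mult.commute)
  have 1: "(\<integral>x. \<phi> x * (G x \<bullet> axis i (axis k 1)) \<partial>lebesgue_on \<Omega>) = dist_of \<Omega> (\<lambda>x. G x $ i $ k) \<phi>"
    for \<phi> i k
    by (simp add: dist_of_def inner_axis mult.commute)
  have 2: "- (\<integral>x. (\<Sum>j\<in>UNIV. pd j \<phi> x * (grad_op j (u x) \<bullet> axis i (axis k 1))) \<partial>lebesgue_on \<Omega>)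
      = dist_pd \<Omega> k (\<lambda>x. u x $ i) \<phi>" for \<phi> i k
    by (simp only: sum dist_pd_def)
  show ?thesis
    unfolding weak_op_iff_inner[OF \<open>open \<Omega>\<close> linear_grad_op u True] is_grad_def ball_Basis_matrix 1 2
    using True by auto
qed (auto simp: is_grad_def weak_op_def)

lemma dist_curl_eq:
  assumes "open \<Omega>" and p: "p \<in> L2 \<Omega>" and \<phi>: "\<phi> \<in> C0inf \<Omega>"
  shows "dist_curl \<Omega> p \<phi> $ k
    = - (\<integral>x. (\<Sum>j\<in>UNIV. pd j \<phi> x * cross3 (axis j 1) (p x) $ k) \<partial>lebesgue_on \<Omega>)"
proof -
  have int: "integrable (lebesgue_on \<Omega>) (\<lambda>x. p x $ i * pd j \<phi> x)" for i j
    by (rule integrable_pd_L2[OF \<open>open \<Omega>\<close> \<phi> L2_nth[OF p]])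
  have "(\<integral>x. p x $ a * pd b \<phi> x - p x $ b * pd a \<phi> x \<partial>lebesgue_on \<Omega>)
      = - (dist_pd \<Omega> b (\<lambda>x. p x $ a) \<phi> - dist_pd \<Omega> a (\<lambda>x. p x $ b) \<phi>)" for a b
    using int by (simp add: dist_pd_def)
  moreover have "(\<Sum>j\<in>UNIV. pd j \<phi> x * cross3 (axis j 1) (p x) $ 1) = p x $ 3 * pd 2 \<phi> x - p x $ 2 * pd 3 \<phi> x"
    "(\<Sum>j\<in>UNIV. pd j \<phi> x * cross3 (axis j 1) (p x) $ 2) = p x $ 1 * pd 3 \<phi> x - p x $ 3 * pd 1 \<phi> x"
    "(\<Sum>j\<in>UNIV. pd j \<phi> x * cross3 (axis j 1) (p x) $ 3) = p x $ 2 * pd 1 \<phi> x - p x $ 1 * pd 2 \<phi> x" for x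
    by (simp_all add: sum_3 cross3_def axis_def)
  moreover have "k = 1 \<or> k = 2 \<or> k = 3" by (rule exhaust_3)
  ultimately show ?thesis
    by (auto simp: dist_curl_def)
qed

lemma dist_Curl_eq:
  assumes "open \<Omega>" and P: "P \<in> L2 \<Omega>" and \<phi>: "\<phi> \<in> C0inf \<Omega>"
  shows "dist_Curl \<Omega> P \<phi> $ i $ k
    = - (\<integral>x. (\<Sum>j\<in>UNIV. pd j \<phi> x * (curl_op j (P x) \<bullet> axis i (axis k 1))) \<partial>lebesgue_on \<Omega>)"
  using dist_curl_eq[OF \<open>open \<Omega>\<close> L2_nth[OF P] \<phi>] by (simp add: dist_Curl_def curl_op_def inner_axis)

lemma is_Curl_iff:
  assumes "open \<Omega>" and P: "P \<in> L2 \<Omega>"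
  shows "is_Curl \<Omega> P Q \<longleftrightarrow> weak_op \<Omega> curl_op P Q"
proof (cases "Q \<in> L2 \<Omega>")
  case True
  have 1: "(\<integral>x. \<phi> x * (Q x \<bullet> axis i (axis k 1)) \<partial>lebesgue_on \<Omega>) = dist_of \<Omega> (\<lambda>x. Q x $ i $ k) \<phi>"
    for \<phi> i k
    by (simp add: dist_of_def inner_axis mult.commute)
  show ?thesis
    unfolding weak_op_iff_inner[OF \<open>open \<Omega>\<close> linear_curl_op P True] is_Curl_def ball_Basis_matrix 1
    using True dist_Curl_eq[OF assms] by auto
qed (auto simp: is_Curl_def weak_op_def)

lemma weak_div_iff:
  assumes "open \<Omega>" and S: "S \<in> L2 \<Omega>" and z: "z \<in> L2 \<Omega>"
  shows "weak_op \<Omega> div_op S z \<longleftrightarrow>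
    (\<forall>\<phi>\<in>C0inf \<Omega>. \<forall>i. dist_of \<Omega> (\<lambda>x. z x $ i) \<phi> = dist_Div \<Omega> S \<phi> $ i)"
proof -
  have 1: "dist_Div \<Omega> S \<phi> $ i = - (\<integral>x. (\<Sum>j\<in>UNIV. pd j \<phi> x * (div_op j (S x) \<bullet> axis i 1)) \<partial>lebesgue_on \<Omega>)"
    if "\<phi> \<in> C0inf \<Omega>" for \<phi> i
    using integrable_pd_L2[OF \<open>open \<Omega>\<close> that L2_nth[OF L2_nth[OF S]]]
    by (simp add: dist_Div_def dist_pd_def div_op_def inner_axis sum_negf mult.commute[of "pd _ _ _"]
        Bochner_Integration.integral_sum)
  have 2: "(\<integral>x. \<phi> x * (z x \<bullet> axis i 1) \<partial>lebesgue_on \<Omega>) = dist_of \<Omega> (\<lambda>x. z x $ i) \<phi>" for \<phi> i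
    by (simp add: dist_of_def inner_axis mult.commute)
  show ?thesis
    unfolding weak_op_iff_inner[OF \<open>open \<Omega>\<close> linear_div_op S z] ball_Basis_vector 2
    using 1 by auto
qed

text \<open>If \<open>z = - Curl R + W\<close> in the sense of distributions, then \<open>z - W\<close> is the operator with the adjoint
  coefficients applied to \<open>R\<close>, which is the form that \<open>weak_op_parts\<close> expects.\<close>

lemma weak_Curl_adjoint:
  assumes "open \<Omega>" and R: "R \<in> L2 \<Omega>" and z: "z \<in> L2 \<Omega>" and W: "W \<in> L2 \<Omega>"
    and eq: "\<And>\<phi> i k. \<phi> \<in> C0inf \<Omega> \<Longrightarrow> dist_of \<Omega> (\<lambda>x. z x $ i $ k) \<phi>
        = - dist_Curl \<Omega> R \<phi> $ i $ k + dist_of \<Omega> (\<lambda>x. W x $ i $ k) \<phi>"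
  shows "weak_op \<Omega> (\<lambda>j P. - curl_op j P) R (\<lambda>x. z x - W x)"
  unfolding weak_op_iff_inner[OF \<open>open \<Omega>\<close> linear_minus_curl_op R L2_diff[OF z W]] ball_Basis_matrix
proof (intro ballI allI)
  fix \<phi> :: "real^3 \<Rightarrow> real" and i k :: 3
  assume \<phi>: "\<phi> \<in> C0inf \<Omega>"
  have int: "integrable (lebesgue_on \<Omega>) (\<lambda>x. F x $ i $ k * \<phi> x)" if "F \<in> L2 \<Omega>" for F :: "real^3 \<Rightarrow> real^3^3"
    using integrable_inner[OF L2_nth[OF L2_nth[OF that]] C0inf_L2[OF \<phi> \<open>open \<Omega>\<close>], of i k] by simp
  have "(\<integral>x. \<phi> x * ((z x - W x) \<bullet> axis i (axis k 1)) \<partial>lebesgue_on \<Omega>)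
      = (\<integral>x. z x $ i $ k * \<phi> x - W x $ i $ k * \<phi> x \<partial>lebesgue_on \<Omega>)"
    by (simp add: inner_axis algebra_simps)
  also have "\<dots> = dist_of \<Omega> (\<lambda>x. z x $ i $ k) \<phi> - dist_of \<Omega> (\<lambda>x. W x $ i $ k) \<phi>"
    using int[OF z] int[OF W] by (simp add: dist_of_def)
  also have "\<dots> = - dist_Curl \<Omega> R \<phi> $ i $ k"
    using eq[OF \<phi>] by simp
  finally show "(\<integral>x. \<phi> x * ((z x - W x) \<bullet> axis i (axis k 1)) \<partial>lebesgue_on \<Omega>)
      = - (\<integral>x. (\<Sum>j\<in>UNIV. pd j \<phi> x * (- curl_op j (R x) \<bullet> axis i (axis k 1))) \<partial>lebesgue_on \<Omega>)"
    using dist_Curl_eq[OF \<open>open \<Omega>\<close> R \<phi>, of i k] by (simp add: sum_negf)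
qed


section \<open>The energy spaces\<close>

text \<open>The graph norm of \<open>f - \<phi>\<close> is computed with some weak derivative \<open>h\<close> of \<open>f - \<phi>\<close>. By uniqueness \<open>h\<close> is
  the difference of \<open>g\<close> and the classical derivative of \<open>\<phi>\<close>. The premise on \<open>h\<close> is what the choice
  operator guarantees: \<open>h\<close> is a weak derivative as soon as there is one.\<close>

lemma graph_norm_approx:
  fixes B :: "3 \<Rightarrow> 'a::euclidean_space \<Rightarrow> 'b::euclidean_space"
  assumes "open \<Omega>" and B: "\<And>j. linear (B j)" and f: "f \<in> L2 \<Omega>" "weak_op \<Omega> B f g"
    and \<phi>: "\<phi> \<in> C0inf \<Omega>"
    and h: "\<And>k. weak_op \<Omega> B (f - \<phi>) k \<Longrightarrow> weak_op \<Omega> B (f - \<phi>) h"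
    and less: "sqrt ((L2_norm \<Omega> (f - \<phi>))\<^sup>2 + (L2_norm \<Omega> h)\<^sup>2) < \<epsilon>"
  shows "L2_norm \<Omega> (\<lambda>x. f x - \<phi> x) < \<epsilon> \<and> L2_norm \<Omega> (\<lambda>x. g x - (\<Sum>j\<in>UNIV. B j (pd j \<phi> x))) < \<epsilon>"
proof -
  let ?D = "\<lambda>x. \<Sum>j\<in>UNIV. B j (pd j \<phi> x)"
  have eq: "(f - \<phi>) = (\<lambda>x. f x - \<phi> x)" by (simp add: fun_eq_iff)
  have w: "weak_op \<Omega> B (f - \<phi>) (\<lambda>x. g x - ?D x)"
    using weak_op_lincomb[OF \<open>open \<Omega>\<close> B f(1) C0inf_L2[OF \<phi> \<open>open \<Omega>\<close>] f(2) weak_op_C0inf[OF \<open>open \<Omega>\<close> B \<phi>], of 1 "-1"]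
    by (simp add: eq)
  have "eq_ae \<Omega> h (\<lambda>x. g x - ?D x)"
    by (rule weak_op_unique[OF \<open>open \<Omega>\<close> h[OF w] w])
  then have "L2_norm \<Omega> h = L2_norm \<Omega> (\<lambda>x. g x - ?D x)"
    using h[OF w] w by (intro L2_norm_cong_ae) (auto simp: weak_op_def)
  moreover have "L2_norm \<Omega> (f - \<phi>) \<le> sqrt ((L2_norm \<Omega> (f - \<phi>))\<^sup>2 + (L2_norm \<Omega> h)\<^sup>2)"
    "L2_norm \<Omega> h \<le> sqrt ((L2_norm \<Omega> (f - \<phi>))\<^sup>2 + (L2_norm \<Omega> h)\<^sup>2)"
    by (auto intro: real_le_rsqrt)
  ultimately have "L2_norm \<Omega> (f - \<phi>) < \<epsilon> \<and> L2_norm \<Omega> (\<lambda>x. g x - ?D x) < \<epsilon>"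
    using less by linarith
  then show ?thesis by (simp only: eq)
qed

lemma H1_grad:
  assumes "open \<Omega>" "u \<in> H1 \<Omega>"
  shows "u \<in> L2 \<Omega>" "weak_op \<Omega> grad_op u (grad \<Omega> u)"
proof -
  show u: "u \<in> L2 \<Omega>" using assms(2) by (simp add: H1_def)
  have "is_grad \<Omega> u (grad \<Omega> u)"
  proof -
    have "\<exists>G. is_grad \<Omega> u G" using assms(2) by (simp add: H1_def)
    then show ?thesis unfolding grad_def by (rule someI_ex)
  qed
  then show "weak_op \<Omega> grad_op u (grad \<Omega> u)" by (simp add: is_grad_iff[OF assms(1) u])
qed

lemma HCurl_Curl:
  assumes "open \<Omega>" "P \<in> HCurl \<Omega>"
  shows "P \<in> L2 \<Omega>" "weak_op \<Omega> curl_op P (Curl \<Omega> P)"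
proof -
  show P: "P \<in> L2 \<Omega>" using assms(2) by (simp add: HCurl_def)
  have "is_Curl \<Omega> P (Curl \<Omega> P)"
  proof -
    have "\<exists>Q. is_Curl \<Omega> P Q" using assms(2) by (simp add: HCurl_def)
    then show ?thesis unfolding Curl_def by (rule someI_ex)
  qed
  then show "weak_op \<Omega> curl_op P (Curl \<Omega> P)" by (simp add: is_Curl_iff[OF assms(1) P])
qed

lemma H1I: "open \<Omega> \<Longrightarrow> u \<in> L2 \<Omega> \<Longrightarrow> weak_op \<Omega> grad_op u G \<Longrightarrow> u \<in> H1 \<Omega>"
  by (auto simp: H1_def is_grad_iff)

lemma HCurlI: "open \<Omega> \<Longrightarrow> P \<in> L2 \<Omega> \<Longrightarrow> weak_op \<Omega> curl_op P Q \<Longrightarrow> P \<in> HCurl \<Omega>"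
  by (auto simp: HCurl_def is_Curl_iff)

lemma H10_parts:
  assumes "open \<Omega>" and u: "u \<in> H10 \<Omega>" and S: "S \<in> L2 \<Omega>" and z: "weak_op \<Omega> div_op S z"
  shows "ip \<Omega> z u = - ip \<Omega> S (grad \<Omega> u)"
proof -
  have H1: "u \<in> H1 \<Omega>" using u by (simp add: H10_def)
  note g = H1_grad[OF \<open>open \<Omega>\<close> H1]
  show ?thesis
  proof (rule weak_op_parts[OF \<open>open \<Omega>\<close> linear_grad_op linear_div_op grad_op_adjoint S z g(1)])
    show "grad \<Omega> u \<in> L2 \<Omega>" using g(2) by (simp add: weak_op_def)
    fix \<epsilon> :: real assume "\<epsilon> > 0"
    then obtain \<phi> where \<phi>: "\<phi> \<in> C0inf \<Omega>" "H1_norm \<Omega> (u - \<phi>) < \<epsilon>"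
      using u by (auto simp: H10_def)
    have "u - \<phi> \<in> L2 \<Omega>"
      using L2_diff[OF g(1) C0inf_L2[OF \<phi>(1) \<open>open \<Omega>\<close>]] by (simp add: fun_diff_def)
    then have "weak_op \<Omega> grad_op (u - \<phi>) (grad \<Omega> (u - \<phi>))" if "weak_op \<Omega> grad_op (u - \<phi>) k" for k
      using H1_grad(2)[OF \<open>open \<Omega>\<close> H1I[OF \<open>open \<Omega>\<close> _ that]] by simp
    then show "\<exists>\<phi>\<in>C0inf \<Omega>. L2_norm \<Omega> (\<lambda>x. u x - \<phi> x) < \<epsilon> \<and>
        L2_norm \<Omega> (\<lambda>x. grad \<Omega> u x - (\<Sum>j\<in>UNIV. grad_op j (pd j \<phi> x))) < \<epsilon>"
      using graph_norm_approx[OF \<open>open \<Omega>\<close> linear_grad_op g \<phi>(1), of "grad \<Omega> (u - \<phi>)" \<epsilon>] \<phi>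
      unfolding H1_norm_def by blast
  qed
qed

lemma H0Curl_parts:
  assumes "open \<Omega>" and P: "P \<in> H0Curl \<Omega>" and S: "S \<in> L2 \<Omega>" and z: "weak_op \<Omega> (\<lambda>j P. - curl_op j P) S z"
  shows "ip \<Omega> z P = - ip \<Omega> S (Curl \<Omega> P)"
proof -
  have HC: "P \<in> HCurl \<Omega>" using P by (simp add: H0Curl_def)
  note g = HCurl_Curl[OF \<open>open \<Omega>\<close> HC]
  show ?thesis
  proof (rule weak_op_parts[OF \<open>open \<Omega>\<close> linear_curl_op linear_minus_curl_op curl_op_adjoint S z g(1)])
    show "Curl \<Omega> P \<in> L2 \<Omega>" using g(2) by (simp add: weak_op_def)
    fix \<epsilon> :: real assume "\<epsilon> > 0"
    then obtain \<phi> where \<phi>: "\<phi> \<in> C0inf \<Omega>" "HCurl_norm \<Omega> (P - \<phi>) < \<epsilon>"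
      using P by (auto simp: H0Curl_def)
    have "P - \<phi> \<in> L2 \<Omega>"
      using L2_diff[OF g(1) C0inf_L2[OF \<phi>(1) \<open>open \<Omega>\<close>]] by (simp add: fun_diff_def)
    then have "weak_op \<Omega> curl_op (P - \<phi>) (Curl \<Omega> (P - \<phi>))" if "weak_op \<Omega> curl_op (P - \<phi>) k" for k
      using HCurl_Curl(2)[OF \<open>open \<Omega>\<close> HCurlI[OF \<open>open \<Omega>\<close> _ that]] by simp
    then show "\<exists>\<phi>\<in>C0inf \<Omega>. L2_norm \<Omega> (\<lambda>x. P x - \<phi> x) < \<epsilon> \<and>
        L2_norm \<Omega> (\<lambda>x. Curl \<Omega> P x - (\<Sum>j\<in>UNIV. curl_op j (pd j \<phi> x))) < \<epsilon>"
      using graph_norm_approx[OF \<open>open \<Omega>\<close> linear_curl_op g \<phi>(1), of "Curl \<Omega> (P - \<phi>)" \<epsilon>] \<phi>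
      unfolding HCurl_norm_def by blast
  qed
qed


section \<open>Coefficient operators\<close>

text \<open>Fields of symmetric, positive semidefinite operators with a common upper bound. The tensors acting
  on symmetric matrices become such operators on all matrices when precomposed with \<open>sym\<close>, so
  that the three elastic energies have the same shape.\<close>

definition psd_op :: "(real^3) set \<Rightarrow> (real^3 \<Rightarrow> 'b::euclidean_space \<Rightarrow> 'b) \<Rightarrow> real \<Rightarrow> bool" where
  "psd_op \<Omega> A M \<longleftrightarrow> 0 \<le> M \<and>
     (\<forall>x\<in>\<Omega>. linear (A x) \<and> (\<forall>X Y. A x X \<bullet> Y = X \<bullet> A x Y) \<and>
        (\<forall>X. 0 \<le> A x X \<bullet> X \<and> A x X \<bullet> X \<le> M * (norm X)\<^sup>2)) \<and>
     (\<forall>F\<in>borel_measurable (lebesgue_on \<Omega>). (\<lambda>x. A x (F x)) \<in> borel_measurable (lebesgue_on \<Omega>))"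

text \<open>By polarization a symmetric form is controlled by its diagonal; the vector \<open>Y\<close> is \<open>A X\<close> scaled to the
  length of \<open>X\<close>.\<close>

lemma psd_bounded:
  fixes A :: "'b::euclidean_space \<Rightarrow> 'b"
  assumes lin: "linear A" and symm: "\<And>X Y. A X \<bullet> Y = X \<bullet> A Y"
    and bnd: "\<And>X. 0 \<le> A X \<bullet> X \<and> A X \<bullet> X \<le> M * (norm X)\<^sup>2" and "0 \<le> M"
  shows "norm (A X) \<le> M * norm X"
proof (cases "A X = 0 \<or> X = 0")
  case True
  then show ?thesis using \<open>0 \<le> M\<close> linear_0[OF lin] by auto
next
  case False
  define Y where "Y = (norm X / norm (A X)) *\<^sub>R A X"
  have nY: "norm Y = norm X" using False by (simp add: Y_def)
  have "4 * (A X \<bullet> Y) = A (X + Y) \<bullet> (X + Y) - A (X - Y) \<bullet> (X - Y)"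
    using symm[of Y X] by (simp add: linear_add[OF lin] linear_diff[OF lin] inner_simps inner_commute)
  also have "\<dots> \<le> M * (norm (X + Y))\<^sup>2"
    using bnd[of "X + Y"] bnd[of "X - Y"] by linarith
  also have "\<dots> \<le> M * (2 * norm X)\<^sup>2"
    using norm_triangle_ineq[of X Y] nY \<open>0 \<le> M\<close> by (intro mult_left_mono power_mono) auto
  finally have "4 * (A X \<bullet> Y) \<le> 4 * (M * norm X * norm X)"
    by (simp add: power2_eq_square)
  moreover have "A X \<bullet> Y = norm X * norm (A X)"
    using False by (simp add: Y_def dot_square_norm power2_eq_square)
  ultimately show ?thesis using False by (simp add: mult.commute[of "norm X"])
qed

lemma psd_op_L2:
  assumes "psd_op \<Omega> A M" "F \<in> L2 \<Omega>"
  shows "(\<lambda>x. A x (F x)) \<in> L2 \<Omega>" "L2_norm \<Omega> (\<lambda>x. A x (F x)) \<le> M * L2_norm \<Omega> F"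
proof -
  have le: "norm (A x (F x)) \<le> M * norm (F x)" if "x \<in> \<Omega>" for x
    using assms(1) that by (intro psd_bounded) (auto simp: psd_op_def)
  show L: "(\<lambda>x. A x (F x)) \<in> L2 \<Omega>"
    using assms le by (intro L2_bound[OF assms(2) _ le]) (auto simp: psd_op_def L2_def)
  show "L2_norm \<Omega> (\<lambda>x. A x (F x)) \<le> M * L2_norm \<Omega> F"
    using assms(1) le by (intro L2_norm_bound[OF assms(2) L]) (auto simp: psd_op_def)
qed

lemma ip_cong:
  assumes "\<And>x. x \<in> \<Omega> \<Longrightarrow> f x \<bullet> g x = f' x \<bullet> g' x"
  shows "ip \<Omega> f g = ip \<Omega> f' g'"
  unfolding ip_def using assms by (intro Bochner_Integration.integral_cong) auto

lemma psd_op_ip: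
  assumes "psd_op \<Omega> A M"
  shows "ip \<Omega> (\<lambda>x. A x (F x)) G = ip \<Omega> F (\<lambda>x. A x (G x))" "0 \<le> ip \<Omega> (\<lambda>x. A x (F x)) F"
proof -
  show "ip \<Omega> (\<lambda>x. A x (F x)) G = ip \<Omega> F (\<lambda>x. A x (G x))"
    using assms by (intro ip_cong) (auto simp: psd_op_def)
  show "0 \<le> ip \<Omega> (\<lambda>x. A x (F x)) F"
    unfolding ip_def using assms by (intro integral_nonneg_AE AE_I2) (auto simp: psd_op_def)
qed

lemma psd_op_id: "psd_op \<Omega> (\<lambda>x X. X) 1"
  by (auto simp: psd_op_def power2_norm_eq_inner linear_id[unfolded id_def])

lemma tensor_act_add: "tensor_act A (X + Y) = tensor_act A X + tensor_act A Y"
  by (simp add: tensor_act_def vec_eq_iff algebra_simps sum.distrib)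

lemma tensor_act_scaleR: "tensor_act A (c *\<^sub>R X) = c *\<^sub>R tensor_act A X"
  by (simp add: tensor_act_def vec_eq_iff sum_distrib_left mult.left_commute)

lemma bounded_bilinear_tensor_act: "bounded_bilinear tensor_act"
proof -
  have "bilinear tensor_act"
    unfolding bilinear_def
  proof (intro conjI allI)
    show "linear (tensor_act A)" for A
      by (rule linearI) (auto simp: tensor_act_add tensor_act_scaleR)
    show "linear (\<lambda>A. tensor_act A X)" for X
      by (rule linearI) (auto simp: tensor_act_def vec_eq_iff algebra_simps sum.distrib sum_distrib_left)
  qed
  then show ?thesis by (simp add: bilinear_conv_bounded_bilinear)
qed

lemma tensor_act_measurable:
  fixes F :: "real^3 \<Rightarrow> real^3^3"
  assumes "open \<Omega>" "Ck_on (Suc k) \<Omega> A" "F \<in> borel_measurable (lebesgue_on \<Omega>)"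
  shows "(\<lambda>x. tensor_act (A x) (F x)) \<in> borel_measurable (lebesgue_on \<Omega>)"
proof -
  have "continuous_on \<Omega> A"
    using assms(2) by (simp add: continuous_at_imp_continuous_on differentiable_imp_continuous_within)
  then have "A \<in> borel_measurable (lebesgue_on \<Omega>)"
    using \<open>open \<Omega>\<close> by (intro continuous_imp_measurable_on_sets_lebesgue) auto
  moreover have "continuous_on UNIV (\<lambda>p. tensor_act (fst p) (snd p))"
    by (intro bounded_bilinear.continuous_on[OF bounded_bilinear_tensor_act] continuous_intros)
  ultimately show ?thesis
    using borel_measurable_continuous_Pair[of A _ F tensor_act] assms(3) by blast
qed

lemma tensor_act_symmetric:
  assumes "major_symmetric A"
  shows "tensor_act A X \<bullet> Y = X \<bullet> tensor_act A Y"
proof -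
  have "tensor_act A X \<bullet> Y = (\<Sum>i\<in>UNIV. \<Sum>j\<in>UNIV. \<Sum>k\<in>UNIV. \<Sum>l\<in>UNIV. A$i$j$k$l * X$k$l * Y$i$j)"
    by (simp add: tensor_act_def inner_vec_def sum_distrib_right)
  also have "\<dots> = (\<Sum>i\<in>UNIV. \<Sum>k\<in>UNIV. \<Sum>j\<in>UNIV. \<Sum>l\<in>UNIV. A$i$j$k$l * X$k$l * Y$i$j)"
    by (intro sum.cong refl sum.swap)
  also have "\<dots> = (\<Sum>k\<in>UNIV. \<Sum>i\<in>UNIV. \<Sum>l\<in>UNIV. \<Sum>j\<in>UNIV. A$i$j$k$l * X$k$l * Y$i$j)"
    by (subst sum.swap) (intro sum.cong refl sum.swap)
  also have "\<dots> = (\<Sum>k\<in>UNIV. \<Sum>l\<in>UNIV. \<Sum>i\<in>UNIV. \<Sum>j\<in>UNIV. A$i$j$k$l * X$k$l * Y$i$j)"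
    by (intro sum.cong refl sum.swap)
  also have "\<dots> = (\<Sum>k\<in>UNIV. \<Sum>l\<in>UNIV. \<Sum>i\<in>UNIV. \<Sum>j\<in>UNIV. X$k$l * (A$k$l$i$j * Y$i$j))"
    using assms by (intro sum.cong refl) (simp add: major_symmetric_def)
  also have "\<dots> = X \<bullet> tensor_act A Y"
    by (simp add: tensor_act_def inner_vec_def sum_distrib_left)
  finally show ?thesis .
qed

lemma linear_symm: "linear symm"
  by (rule linearI) (auto simp: symm_def transpose_def vec_eq_iff algebra_simps)

lemma transpose_inner: "transpose X \<bullet> Y = X \<bullet> transpose (Y :: real^3^3)"
  by (simp add: transpose_def inner_vec_def) (rule sum.swap)

lemma symm_Sym3: "symm X \<in> Sym3"
  by (simp add: symm_def Sym3_def transpose_def vec_eq_iff add.commute)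

text \<open>The skew part of a matrix is orthogonal to the symmetric matrices.\<close>

lemma inner_symm:
  assumes "S \<in> Sym3"
  shows "S \<bullet> symm Y = S \<bullet> Y"
proof -
  have "S \<bullet> transpose Y = S \<bullet> Y"
    using transpose_inner[of S Y] assms by (simp add: Sym3_def)
  then show ?thesis by (simp add: symm_def inner_add_right)
qed

lemma norm_symm_le: "norm (symm X) \<le> norm X"
proof -
  have "(norm (transpose X))\<^sup>2 = (norm X)\<^sup>2"
    using transpose_inner[of X "transpose X"] by (simp add: power2_norm_eq_inner)
  then have "norm (transpose X) = norm X" by simp
  then show ?thesis
    using norm_triangle_ineq[of X "transpose X"] by (simp add: symm_def)
qed

text \<open>By minor symmetry the values of \<open>C\<close> are symmetric matrices, hence \<open>\<langle>C. sym X, Y\<rangle> = \<langle>C. sym X, sym Y\<rangle>\<close>, and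
  the bounds on symmetric matrices carry over.\<close>

lemma psd_op_elastic:
  assumes "open \<Omega>" "Ck_on 1 \<Omega> C" "0 \<le> m" "0 \<le> M"
    and symmC: "\<And>x. x \<in> \<Omega> \<Longrightarrow> major_symmetric (C x) \<and> minor_symmetric (C x)"
    and bnd: "\<And>x. x \<in> \<Omega> \<Longrightarrow> form_bounds Sym3 m M (C x)"
  shows "psd_op \<Omega> (\<lambda>x X. tensor_act (C x) (symm X)) M"
  unfolding psd_op_def
proof (intro conjI ballI allI)
  have S: "tensor_act (C x) X \<in> Sym3" if "x \<in> \<Omega>" for x X
    using symmC[OF that] by (auto simp: Sym3_def transpose_def tensor_act_def vec_eq_iff minor_symmetric_def)
  have eq: "tensor_act (C x) (symm X) \<bullet> Y = tensor_act (C x) (symm X) \<bullet> symm Y" if "x \<in> \<Omega>" for x X Y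
    using inner_symm[OF S[OF that]] by simp
  fix x assume x: "x \<in> \<Omega>"
  show "linear (\<lambda>X. tensor_act (C x) (symm X))"
    using linear_compose[OF linear_symm, of "tensor_act (C x)"]
    by (simp add: o_def linearI tensor_act_add tensor_act_scaleR)
  fix X
  show "tensor_act (C x) (symm X) \<bullet> Y = X \<bullet> tensor_act (C x) (symm Y)" for Y
    using eq[OF x, of X Y] eq[OF x, of Y X] tensor_act_symmetric[of "C x" "symm X" "symm Y"] symmC[OF x]
    by (simp add: inner_commute)
  have *: "m * (norm (symm X))\<^sup>2 \<le> tensor_act (C x) (symm X) \<bullet> X"
    "tensor_act (C x) (symm X) \<bullet> X \<le> M * (norm (symm X))\<^sup>2"
    using bnd[OF x] symm_Sym3[of X] eq[OF x, of X X] by (auto simp: form_bounds_def)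
  show "0 \<le> tensor_act (C x) (symm X) \<bullet> X"
    by (rule order_trans[OF _ *(1)]) (simp add: \<open>0 \<le> m\<close>)
  show "tensor_act (C x) (symm X) \<bullet> X \<le> M * (norm X)\<^sup>2"
    using \<open>0 \<le> M\<close> by (intro order_trans[OF *(2)] mult_left_mono power_mono norm_symm_le) auto
next
  fix F :: "real^3 \<Rightarrow> real^3^3" assume F: "F \<in> borel_measurable (lebesgue_on \<Omega>)"
  have "symm \<in> borel_measurable borel"
    using linear_symm by (intro borel_measurable_continuous_onI linear_continuous_on)
      (simp add: linear_conv_bounded_linear)
  then have "(\<lambda>x. symm (F x)) \<in> borel_measurable (lebesgue_on \<Omega>)" using F by measurable
  then show "(\<lambda>x. tensor_act (C x) (symm (F x))) \<in> borel_measurable (lebesgue_on \<Omega>)"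
    using assms(1,2) by (intro tensor_act_measurable[of _ 0]) auto
qed (rule \<open>0 \<le> M\<close>)

lemma psd_op_full:
  assumes "open \<Omega>" "Ck_on 1 \<Omega> L" "0 \<le> m" "0 \<le> M"
    and symmL: "\<And>x. x \<in> \<Omega> \<Longrightarrow> major_symmetric (L x)"
    and bnd: "\<And>x. x \<in> \<Omega> \<Longrightarrow> form_bounds UNIV m M (L x)"
  shows "psd_op \<Omega> (\<lambda>x. tensor_act (L x)) M"
  unfolding psd_op_def
proof (intro conjI ballI allI)
  fix x assume x: "x \<in> \<Omega>"
  show "linear (tensor_act (L x))"
    by (simp add: linearI tensor_act_add tensor_act_scaleR)
  fix X
  show "tensor_act (L x) X \<bullet> Y = X \<bullet> tensor_act (L x) Y" for Y
    by (rule tensor_act_symmetric[OF symmL[OF x]])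
  have *: "m * (norm X)\<^sup>2 \<le> tensor_act (L x) X \<bullet> X" "tensor_act (L x) X \<bullet> X \<le> M * (norm X)\<^sup>2"
    using bnd[OF x] by (auto simp: form_bounds_def)
  show "0 \<le> tensor_act (L x) X \<bullet> X"
    by (rule order_trans[OF _ *(1)]) (simp add: \<open>0 \<le> m\<close>)
  show "tensor_act (L x) X \<bullet> X \<le> M * (norm X)\<^sup>2" by (rule *(2))
next
  fix F :: "real^3 \<Rightarrow> real^3^3" assume F: "F \<in> borel_measurable (lebesgue_on \<Omega>)"
  then show "(\<lambda>x. tensor_act (L x) (F x)) \<in> borel_measurable (lebesgue_on \<Omega>)"
    using assms(1,2) by (intro tensor_act_measurable[of _ 0]) auto
qed (rule \<open>0 \<le> M\<close>)


section \<open>Curves of square integrable fields\<close>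

definition L2_continuous_on ::
    "(real^3) set \<Rightarrow> real set \<Rightarrow> (real \<Rightarrow> real^3 \<Rightarrow> 'b::euclidean_space) \<Rightarrow> bool" where
  "L2_continuous_on \<Omega> I F \<longleftrightarrow> (\<forall>t\<in>I. F t \<in> L2 \<Omega> \<and>
     ((\<lambda>s. L2_norm \<Omega> (\<lambda>x. F s x - F t x)) \<longlongrightarrow> 0) (at t within I))"

lemma eventually_within_mem: "\<forall>\<^sub>F s in at t within I. s \<in> I \<and> s \<noteq> t" for t :: real
  by (simp add: eventually_at_filter)

lemma L2_deriv_imp_continuous:
  assumes D: "L2_deriv_on \<Omega> I F F'"
  shows "L2_continuous_on \<Omega> I F"
  unfolding L2_continuous_on_def
proof (intro ballI conjI)
  fix t assume t: "t \<in> I"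
  have L: "F s \<in> L2 \<Omega>" "F' s \<in> L2 \<Omega>" if "s \<in> I" for s using D that by (auto simp: L2_deriv_on_def)
  then show "F t \<in> L2 \<Omega>" using t by simp
  let ?r = "\<lambda>s x. (1 / (s - t)) *\<^sub>R (F s x - F t x) - F' t x"
  have r: "((\<lambda>s. L2_norm \<Omega> (?r s)) \<longlongrightarrow> 0) (at t within I)"
    using D t by (auto simp: L2_deriv_on_def)
  have "((\<lambda>s. \<bar>s - t\<bar> * (L2_norm \<Omega> (?r s) + L2_norm \<Omega> (F' t))) \<longlongrightarrow> \<bar>t - t\<bar> * (0 + L2_norm \<Omega> (F' t))) (at t within I)"
    by (intro tendsto_intros r)
  then have lim: "((\<lambda>s. \<bar>s - t\<bar> * (L2_norm \<Omega> (?r s) + L2_norm \<Omega> (F' t))) \<longlongrightarrow> 0) (at t within I)"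
    by simp
  show "((\<lambda>s. L2_norm \<Omega> (\<lambda>x. F s x - F t x)) \<longlongrightarrow> 0) (at t within I)"
  proof (rule tendsto_sandwich[OF _ _ tendsto_const lim])
    show "\<forall>\<^sub>F s in at t within I. L2_norm \<Omega> (\<lambda>x. F s x - F t x)
        \<le> \<bar>s - t\<bar> * (L2_norm \<Omega> (?r s) + L2_norm \<Omega> (F' t))"
      using eventually_within_mem
    proof eventually_elim
      case (elim s)
      have "(\<lambda>x. F s x - F t x) = (\<lambda>x. (s - t) *\<^sub>R (?r s x + F' t x))"
        using elim by simp
      then have "L2_norm \<Omega> (\<lambda>x. F s x - F t x) = \<bar>s - t\<bar> * L2_norm \<Omega> (\<lambda>x. ?r s x + F' t x)"
        by (simp only: L2_norm_scaleR)
      also have "\<dots> \<le> \<bar>s - t\<bar> * (L2_norm \<Omega> (?r s) + L2_norm \<Omega> (F' t))"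
        using L t elim by (intro mult_left_mono L2_norm_triangle L2_closure) auto
      finally show ?case .
    qed
  qed simp
qed

lemma L2_deriv_on_diff:
  assumes "L2_deriv_on \<Omega> I F F'" "L2_deriv_on \<Omega> I G G'"
  shows "L2_deriv_on \<Omega> I (\<lambda>t x. F t x - G t x) (\<lambda>t x. F' t x - G' t x)"
  unfolding L2_deriv_on_def
proof (intro conjI ballI)
  fix t assume t: "t \<in> I"
  have L: "F s \<in> L2 \<Omega>" "F' s \<in> L2 \<Omega>" "G s \<in> L2 \<Omega>" "G' s \<in> L2 \<Omega>" if "s \<in> I" for s
    using assms that by (auto simp: L2_deriv_on_def)
  then show "(\<lambda>x. F t x - G t x) \<in> L2 \<Omega>" "(\<lambda>x. F' t x - G' t x) \<in> L2 \<Omega>"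
    using t by (simp_all add: L2_diff)
  let ?r = "\<lambda>F F' s x. (1 / (s - t)) *\<^sub>R (F s x - F t x) - F' t x"
  have "((\<lambda>s. L2_norm \<Omega> (?r F F' s) + L2_norm \<Omega> (?r G G' s)) \<longlongrightarrow> 0 + 0) (at t within I)"
    using assms t by (intro tendsto_add) (auto simp: L2_deriv_on_def)
  then have lim: "((\<lambda>s. L2_norm \<Omega> (?r F F' s) + L2_norm \<Omega> (?r G G' s)) \<longlongrightarrow> 0) (at t within I)"
    by simp
  show "((\<lambda>s. L2_norm \<Omega> (\<lambda>x. (1 / (s - t)) *\<^sub>R ((F s x - G s x) - (F t x - G t x)) - (F' t x - G' t x))) \<longlongrightarrow> 0)
      (at t within I)"
  proof (rule tendsto_sandwich[OF _ _ tendsto_const lim])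
    show "\<forall>\<^sub>F s in at t within I. L2_norm \<Omega> (\<lambda>x. (1 / (s - t)) *\<^sub>R ((F s x - G s x) - (F t x - G t x)) - (F' t x - G' t x))
        \<le> L2_norm \<Omega> (?r F F' s) + L2_norm \<Omega> (?r G G' s)"
      using eventually_within_mem
    proof eventually_elim
      case (elim s)
      have "(\<lambda>x. (1 / (s - t)) *\<^sub>R ((F s x - G s x) - (F t x - G t x)) - (F' t x - G' t x))
          = (\<lambda>x. ?r F F' s x - ?r G G' s x)"
        by (simp add: scaleR_diff_right algebra_simps)
      then show ?case
        using L2_norm_triangle_diff[of "?r F F' s" \<Omega> "?r G G' s"] L t elim by (simp add: L2_closure)
    qed
  qed simp
qed

lemma L2_continuous_on_diff:
  assumes "L2_continuous_on \<Omega> I F" "L2_continuous_on \<Omega> I G"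
  shows "L2_continuous_on \<Omega> I (\<lambda>t x. F t x - G t x)"
  unfolding L2_continuous_on_def
proof (intro conjI ballI)
  fix t assume t: "t \<in> I"
  have L: "F s \<in> L2 \<Omega>" "G s \<in> L2 \<Omega>" if "s \<in> I" for s
    using assms that by (auto simp: L2_continuous_on_def)
  then show "(\<lambda>x. F t x - G t x) \<in> L2 \<Omega>"
    using t by (simp add: L2_diff)
  let ?r = "\<lambda>F s x. F s x - F t x"
  have "((\<lambda>s. L2_norm \<Omega> (?r F s) + L2_norm \<Omega> (?r G s)) \<longlongrightarrow> 0 + 0) (at t within I)"
    using assms t by (intro tendsto_add) (auto simp: L2_continuous_on_def)
  then have lim: "((\<lambda>s. L2_norm \<Omega> (?r F s) + L2_norm \<Omega> (?r G s)) \<longlongrightarrow> 0) (at t within I)"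
    by simp
  show "((\<lambda>s. L2_norm \<Omega> (\<lambda>x. (F s x - G s x) - (F t x - G t x))) \<longlongrightarrow> 0) (at t within I)"
  proof (rule tendsto_sandwich[OF _ _ tendsto_const lim])
    show "\<forall>\<^sub>F s in at t within I. L2_norm \<Omega> (\<lambda>x. (F s x - G s x) - (F t x - G t x))
        \<le> L2_norm \<Omega> (?r F s) + L2_norm \<Omega> (?r G s)"
      using eventually_within_mem
    proof eventually_elim
      case (elim s)
      have "(\<lambda>x. (F s x - G s x) - (F t x - G t x)) = (\<lambda>x. ?r F s x - ?r G s x)"
        by (simp add: algebra_simps)
      then show ?case
        using L2_norm_triangle_diff[of "?r F s" \<Omega> "?r G s"] L t elim by (simp add: L2_closure)
    qed
  qed simp
qed

definition quad :: "(real^3) set \<Rightarrow> (real^3 \<Rightarrow> 'b::euclidean_space \<Rightarrow> 'b) \<Rightarrow> (real^3 \<Rightarrow> 'b) \<Rightarrow> real" where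
  "quad \<Omega> A F = ip \<Omega> (\<lambda>x. A x (F x)) F"

text \<open>Symmetry of the form lets a difference of squares factor as \<open>a(F,F) - a(G,G) = a(F - G, F + G)\<close>; this turns
  difference quotients of the quadratic functional into difference quotients of the field.\<close>

lemma quad_diff:
  assumes A: "psd_op \<Omega> A M" and L: "F \<in> L2 \<Omega>" "G \<in> L2 \<Omega>"
  shows "quad \<Omega> A F - quad \<Omega> A G = ip \<Omega> (\<lambda>x. F x - G x) (\<lambda>x. A x (F x)) + ip \<Omega> (\<lambda>x. F x - G x) (\<lambda>x. A x (G x))"
proof -
  note AL = psd_op_L2(1)[OF A L(1)] psd_op_L2(1)[OF A L(2)]
  have "ip \<Omega> F (\<lambda>x. A x (G x)) = ip \<Omega> G (\<lambda>x. A x (F x))"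
    using psd_op_ip(1)[OF A, of F G] ip_commute[of \<Omega> G] by metis
  then show ?thesis
    unfolding quad_def using L AL
    by (simp add: ip_diff_left ip_commute[of \<Omega> "\<lambda>x. A x (F x)" F] ip_commute[of \<Omega> "\<lambda>x. A x (G x)" G])
qed

lemma tendsto_ip:
  fixes t :: real
  assumes lim: "((\<lambda>s. L2_norm \<Omega> (\<lambda>x. R s x - R0 x)) \<longlongrightarrow> 0) (at t within I)"
    and L: "\<And>s. s \<in> I \<Longrightarrow> R s \<in> L2 \<Omega>" "R0 \<in> L2 \<Omega>" "S0 \<in> L2 \<Omega>" "\<And>s. s \<in> I \<Longrightarrow> S s \<in> L2 \<Omega>"
    and lim2: "((\<lambda>s. L2_norm \<Omega> (\<lambda>x. S s x - S0 x)) \<longlongrightarrow> 0) (at t within I)"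
  shows "((\<lambda>s. ip \<Omega> (R s) (S s)) \<longlongrightarrow> ip \<Omega> R0 S0) (at t within I)"
proof -
  let ?r = "\<lambda>s. L2_norm \<Omega> (\<lambda>x. R s x - R0 x)" and ?q = "\<lambda>s. L2_norm \<Omega> (\<lambda>x. S s x - S0 x)"
  have "((\<lambda>s. ?r s * (?q s + L2_norm \<Omega> S0) + L2_norm \<Omega> R0 * ?q s)
      \<longlongrightarrow> 0 * (0 + L2_norm \<Omega> S0) + L2_norm \<Omega> R0 * 0) (at t within I)"
    by (intro tendsto_intros lim lim2)
  then have b: "((\<lambda>s. ?r s * (?q s + L2_norm \<Omega> S0) + L2_norm \<Omega> R0 * ?q s) \<longlongrightarrow> 0) (at t within I)"
    by simp
  have "((\<lambda>s. ip \<Omega> (R s) (S s) - ip \<Omega> R0 S0) \<longlongrightarrow> 0) (at t within I)"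
  proof (rule Lim_null_comparison[OF _ b])
    show "\<forall>\<^sub>F s in at t within I. norm (ip \<Omega> (R s) (S s) - ip \<Omega> R0 S0)
        \<le> ?r s * (?q s + L2_norm \<Omega> S0) + L2_norm \<Omega> R0 * ?q s"
      using eventually_within_mem
    proof eventually_elim
      case (elim s)
      have s: "R s \<in> L2 \<Omega>" "S s \<in> L2 \<Omega>" using L elim by auto
      have "ip \<Omega> (R s) (S s) - ip \<Omega> R0 S0
          = ip \<Omega> (\<lambda>x. R s x - R0 x) (S s) + ip \<Omega> R0 (\<lambda>x. S s x - S0 x)"
        using s L by (simp add: ip_diff_left ip_diff_right)
      moreover have "\<bar>ip \<Omega> (\<lambda>x. R s x - R0 x) (S s)\<bar> \<le> ?r s * L2_norm \<Omega> (S s)"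
        "\<bar>ip \<Omega> R0 (\<lambda>x. S s x - S0 x)\<bar> \<le> L2_norm \<Omega> R0 * ?q s"
        using s L by (auto intro!: ip_Cauchy_Schwarz L2_diff)
      moreover have "L2_norm \<Omega> (S s) \<le> ?q s + L2_norm \<Omega> S0"
        using L2_norm_triangle[OF L2_diff[OF s(2) L(3)] L(3)] by simp
      then have "?r s * L2_norm \<Omega> (S s) \<le> ?r s * (?q s + L2_norm \<Omega> S0)"
        by (intro mult_left_mono) auto
      ultimately show ?case by simp
    qed
  qed
  then show ?thesis by (simp add: LIM_zero_cancel)
qed

lemma L2_continuous_psd_op:
  assumes A: "psd_op \<Omega> A M" and F: "L2_continuous_on \<Omega> I F"
  shows "L2_continuous_on \<Omega> I (\<lambda>t x. A x (F t x))"
  unfolding L2_continuous_on_def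
proof (intro conjI ballI)
  fix t assume t: "t \<in> I"
  have L: "F s \<in> L2 \<Omega>" if "s \<in> I" for s using F that by (auto simp: L2_continuous_on_def)
  then show "(\<lambda>x. A x (F t x)) \<in> L2 \<Omega>" using psd_op_L2(1)[OF A] t by blast
  have "((\<lambda>s. M * L2_norm \<Omega> (\<lambda>x. F s x - F t x)) \<longlongrightarrow> M * 0) (at t within I)"
    using F t by (intro tendsto_mult_left) (auto simp: L2_continuous_on_def)
  then have lim: "((\<lambda>s. M * L2_norm \<Omega> (\<lambda>x. F s x - F t x)) \<longlongrightarrow> 0) (at t within I)" by simp
  show "((\<lambda>s. L2_norm \<Omega> (\<lambda>x. A x (F s x) - A x (F t x))) \<longlongrightarrow> 0) (at t within I)"
  proof (rule tendsto_sandwich[OF _ _ tendsto_const lim])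
    show "\<forall>\<^sub>F s in at t within I. L2_norm \<Omega> (\<lambda>x. A x (F s x) - A x (F t x)) \<le> M * L2_norm \<Omega> (\<lambda>x. F s x - F t x)"
      using eventually_within_mem
    proof eventually_elim
      case (elim s)
      have d: "(\<lambda>x. F s x - F t x) \<in> L2 \<Omega>" using L elim t by (simp add: L2_diff)
      have "L2_norm \<Omega> (\<lambda>x. A x (F s x) - A x (F t x)) = L2_norm \<Omega> (\<lambda>x. A x (F s x - F t x))"
        unfolding L2_norm_def using A
        by (intro arg_cong[where f = sqrt] Bochner_Integration.integral_cong) (auto simp: psd_op_def linear_diff)
      then show ?case using psd_op_L2(2)[OF A d] by simp
    qed
  qed simp
qed

lemma continuous_on_quad:
  assumes A: "psd_op \<Omega> A M" and F: "L2_continuous_on \<Omega> I F"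
  shows "continuous_on I (\<lambda>t. quad \<Omega> A (F t))"
  unfolding continuous_on_def quad_def
  using L2_continuous_psd_op[OF A F] F
  by (intro ballI tendsto_ip) (auto simp: L2_continuous_on_def)

text \<open>By \<open>quad_diff\<close> the difference quotient of the quadratic functional is the sum of two pairings of the
  difference quotient of \<open>F\<close> with fields that tend to \<open>A F(t)\<close>.\<close>

lemma quad_has_derivative:
  assumes A: "psd_op \<Omega> A M" and D: "L2_deriv_on \<Omega> I F F'" and t: "t \<in> I"
  shows "((\<lambda>t. quad \<Omega> A (F t)) has_real_derivative 2 * ip \<Omega> (F' t) (\<lambda>x. A x (F t x))) (at t within I)"
proof -
  have L: "F s \<in> L2 \<Omega>" "F' s \<in> L2 \<Omega>" if "s \<in> I" for s using D that by (auto simp: L2_deriv_on_def)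
  let ?r = "\<lambda>s x. (1 / (s - t)) *\<^sub>R (F s x - F t x)"
  have cont: "L2_continuous_on \<Omega> I (\<lambda>t x. A x (F t x))"
    by (rule L2_continuous_psd_op[OF A L2_deriv_imp_continuous[OF D]])
  have r: "((\<lambda>s. L2_norm \<Omega> (\<lambda>x. ?r s x - F' t x)) \<longlongrightarrow> 0) (at t within I)"
    using D t by (auto simp: L2_deriv_on_def)
  have rL: "?r s \<in> L2 \<Omega>" if "s \<in> I" for s using L that t by (simp add: L2_closure)
  have lim: "((\<lambda>s. ip \<Omega> (?r s) (\<lambda>x. A x (F s x)) + ip \<Omega> (?r s) (\<lambda>x. A x (F t x)))
      \<longlongrightarrow> ip \<Omega> (F' t) (\<lambda>x. A x (F t x)) + ip \<Omega> (F' t) (\<lambda>x. A x (F t x))) (at t within I)"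
    using cont t L rL psd_op_L2(1)[OF A L(1)]
    by (intro tendsto_add tendsto_ip r) (auto simp: L2_continuous_on_def L2_norm_def)
  have ev: "\<forall>\<^sub>F s in at t within I. ip \<Omega> (?r s) (\<lambda>x. A x (F s x)) + ip \<Omega> (?r s) (\<lambda>x. A x (F t x))
      = (quad \<Omega> A (F s) - quad \<Omega> A (F t)) / (s - t)"
    using eventually_within_mem
  proof eventually_elim
    case (elim s)
    then show ?case
      using quad_diff[OF A L(1) L(1), of s t] t
      by (simp add: ip_scaleR_left add_divide_distrib del: scaleR_right_diff_distrib)
  qed
  from Lim_transform_eventually[OF lim ev] show ?thesis
    by (simp add: has_field_derivative_iff)
qed


section \<open>Energy formulation of solutions\<close>

lemma weak_op_diff:
  fixes B :: "3 \<Rightarrow> 'a::euclidean_space \<Rightarrow> 'b::euclidean_space"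
  assumes "open \<Omega>" "\<And>j. linear (B j)" "f \<in> L2 \<Omega>" "f' \<in> L2 \<Omega>" "weak_op \<Omega> B f g" "weak_op \<Omega> B f' g'"
  shows "weak_op \<Omega> B (\<lambda>x. c *\<^sub>R f x - f' x) (\<lambda>x. c *\<^sub>R g x - g' x)"
  using weak_op_lincomb[OF assms, of c "-1"] by simp

lemma weak_op_difference_quotient:
  fixes B :: "3 \<Rightarrow> 'a::euclidean_space \<Rightarrow> 'b::euclidean_space"
  assumes "open \<Omega>" "\<And>j. linear (B j)" "f \<in> L2 \<Omega>" "f' \<in> L2 \<Omega>" "h \<in> L2 \<Omega>"
    and "weak_op \<Omega> B f g" "weak_op \<Omega> B f' g'" "weak_op \<Omega> B h k"
  shows "weak_op \<Omega> B (\<lambda>x. c *\<^sub>R (f x - f' x) - h x) (\<lambda>x. c *\<^sub>R (g x - g' x) - k x)"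
  using weak_op_diff[OF assms(1,2) L2_diff[OF assms(3,4)] assms(5) _ assms(8), where c = c]
    weak_op_diff[OF assms(1-4,6,7), where c = 1] by simp

lemma weak_op_cong_ae:
  fixes B :: "3 \<Rightarrow> 'a::euclidean_space \<Rightarrow> 'b::euclidean_space"
  assumes "open \<Omega>" "\<And>j. linear (B j)" "f \<in> L2 \<Omega>" "f' \<in> L2 \<Omega>" "eq_ae \<Omega> f f'" "weak_op \<Omega> B f g"
  shows "weak_op \<Omega> B f' g"
proof -
  have "(\<integral>x. (\<Sum>j\<in>UNIV. pd j \<phi> x *\<^sub>R B j (f x)) \<partial>lebesgue_on \<Omega>)
      = (\<integral>x. (\<Sum>j\<in>UNIV. pd j \<phi> x *\<^sub>R B j (f' x)) \<partial>lebesgue_on \<Omega>)" if \<phi>: "\<phi> \<in> C0inf \<Omega>" for \<phi>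
  proof (rule integral_cong_AE)
    show "AE x in lebesgue_on \<Omega>. (\<Sum>j\<in>UNIV. pd j \<phi> x *\<^sub>R B j (f x)) = (\<Sum>j\<in>UNIV. pd j \<phi> x *\<^sub>R B j (f' x))"
      using assms(5) unfolding eq_ae_def by eventually_elim simp
  qed (use assms \<phi> in \<open>auto intro!: borel_measurable_integrable L2_first_order\<close>)
  then show ?thesis using assms(6) by (simp add: weak_op_def)
qed

text \<open>The norm of the chosen representative of the gradient is that of any weak gradient; the same
  holds for \<open>Curl\<close> below. Thus the state space norm of a difference controls the differences of the
  gradients and of the curls.\<close>

lemma grad_norm_eq:
  assumes "open \<Omega>" "u \<in> L2 \<Omega>" "weak_op \<Omega> grad_op u G"
  shows "L2_norm \<Omega> (grad \<Omega> u) = L2_norm \<Omega> G"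
proof (rule L2_norm_cong_ae)
  have w: "weak_op \<Omega> grad_op u (grad \<Omega> u)"
    by (rule H1_grad(2)[OF assms(1) H1I[OF assms]])
  then show "grad \<Omega> u \<in> L2 \<Omega>" "G \<in> L2 \<Omega>" using assms(3) by (auto simp: weak_op_def)
  show "eq_ae \<Omega> (grad \<Omega> u) G" by (rule weak_op_unique[OF assms(1) w assms(3)])
qed

lemma Curl_norm_eq:
  assumes "open \<Omega>" "P \<in> L2 \<Omega>" "weak_op \<Omega> curl_op P Q"
  shows "L2_norm \<Omega> (Curl \<Omega> P) = L2_norm \<Omega> Q"
proof (rule L2_norm_cong_ae)
  have w: "weak_op \<Omega> curl_op P (Curl \<Omega> P)"
    by (rule HCurl_Curl(2)[OF assms(1) HCurlI[OF assms]])
  then show "Curl \<Omega> P \<in> L2 \<Omega>" "Q \<in> L2 \<Omega>" using assms(3) by (auto simp: weak_op_def)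
  show "eq_ae \<Omega> (Curl \<Omega> P) Q" by (rule weak_op_unique[OF assms(1) w assms(3)])
qed

lemma X_norm_ge:
  "L2_norm \<Omega> u \<le> X_norm \<Omega> (u, v, P, K)" "L2_norm \<Omega> (grad \<Omega> u) \<le> X_norm \<Omega> (u, v, P, K)"
  "L2_norm \<Omega> v \<le> X_norm \<Omega> (u, v, P, K)"
  "L2_norm \<Omega> P \<le> X_norm \<Omega> (u, v, P, K)" "L2_norm \<Omega> (Curl \<Omega> P) \<le> X_norm \<Omega> (u, v, P, K)"
  "L2_norm \<Omega> K \<le> X_norm \<Omega> (u, v, P, K)"
  by (auto intro!: real_le_rsqrt simp: H1_norm_def HCurl_norm_def add_nonneg_nonneg)

lemma X_space_iff: "(u, v, P, K) \<in> X_space \<Omega> \<longleftrightarrow> u \<in> H10 \<Omega> \<and> v \<in> L2 \<Omega> \<and> P \<in> H0Curl \<Omega> \<and> K \<in> L2 \<Omega>"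
  by (auto simp: X_space_def)

lemma H10_grad:
  assumes "open \<Omega>" "u \<in> H10 \<Omega>"
  shows "u \<in> L2 \<Omega>" "weak_op \<Omega> grad_op u (grad \<Omega> u)" "grad \<Omega> u \<in> L2 \<Omega>"
  using H1_grad[OF assms(1), of u] assms(2) by (auto simp: H10_def weak_op_def)

lemma H0Curl_Curl:
  assumes "open \<Omega>" "P \<in> H0Curl \<Omega>"
  shows "P \<in> L2 \<Omega>" "weak_op \<Omega> curl_op P (Curl \<Omega> P)" "Curl \<Omega> P \<in> L2 \<Omega>"
  using HCurl_Curl[OF assms(1), of P] assms(2) by (auto simp: H0Curl_def weak_op_def)

lemma L2_continuous_onI:
  assumes "\<And>t. t \<in> I \<Longrightarrow> F t \<in> L2 \<Omega>"
    and "\<And>t. t \<in> I \<Longrightarrow> ((\<lambda>s. N s t) \<longlongrightarrow> 0) (at t within I)"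
    and "\<And>s t. s \<in> I \<Longrightarrow> t \<in> I \<Longrightarrow> L2_norm \<Omega> (\<lambda>x. F s x - F t x) \<le> N s t"
  shows "L2_continuous_on \<Omega> I F"
  unfolding L2_continuous_on_def
proof (intro ballI conjI)
  fix t assume t: "t \<in> I"
  show "F t \<in> L2 \<Omega>" using assms(1) t .
  show "((\<lambda>s. L2_norm \<Omega> (\<lambda>x. F s x - F t x)) \<longlongrightarrow> 0) (at t within I)"
  proof (rule tendsto_sandwich[OF _ _ tendsto_const assms(2)[OF t]])
    show "\<forall>\<^sub>F s in at t within I. L2_norm \<Omega> (\<lambda>x. F s x - F t x) \<le> N s t"
      using eventually_within_mem by eventually_elim (use assms(3) t in auto)
  qed simp
qed

lemma L2_deriv_onI:
  assumes "\<And>t. t \<in> I \<Longrightarrow> F t \<in> L2 \<Omega> \<and> F' t \<in> L2 \<Omega>"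
    and "\<And>t. t \<in> I \<Longrightarrow> ((\<lambda>s. N s t) \<longlongrightarrow> 0) (at t within I)"
    and "\<And>s t. s \<in> I \<Longrightarrow> t \<in> I \<Longrightarrow> L2_norm \<Omega> (\<lambda>x. (1 / (s - t)) *\<^sub>R (F s x - F t x) - F' t x) \<le> N s t"
  shows "L2_deriv_on \<Omega> I F F'"
  unfolding L2_deriv_on_def
proof (intro ballI conjI)
  fix t assume t: "t \<in> I"
  show "F t \<in> L2 \<Omega>" "F' t \<in> L2 \<Omega>" using assms(1) t by auto
  show "((\<lambda>s. L2_norm \<Omega> (\<lambda>x. (1 / (s - t)) *\<^sub>R (F s x - F t x) - F' t x)) \<longlongrightarrow> 0) (at t within I)"
  proof (rule tendsto_sandwich[OF _ _ tendsto_const assms(2)[OF t]])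
    show "\<forall>\<^sub>F s in at t within I. L2_norm \<Omega> (\<lambda>x. (1 / (s - t)) *\<^sub>R (F s x - F t x) - F' t x) \<le> N s t"
      using eventually_within_mem by eventually_elim (use assms(3) t in auto)
  qed simp
qed

lemma X_continuous_on_components:
  assumes "open \<Omega>" and X: "X_continuous_on \<Omega> I (\<lambda>t. (u t, v t, P t, K t))"
  shows "L2_continuous_on \<Omega> I v" "L2_continuous_on \<Omega> I K" "L2_continuous_on \<Omega> I P"
    "L2_continuous_on \<Omega> I (\<lambda>t. grad \<Omega> (u t))" "L2_continuous_on \<Omega> I (\<lambda>t. Curl \<Omega> (P t))"
proof -
  let ?d = "\<lambda>s t. (\<lambda>x. u s x - u t x, \<lambda>x. v s x - v t x, \<lambda>x. P s x - P t x, \<lambda>x. K s x - K t x)"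
  let ?N = "\<lambda>s t. X_norm \<Omega> (?d s t)"
  have lim: "((\<lambda>s. ?N s t) \<longlongrightarrow> 0) (at t within I)" if "t \<in> I" for t
    using X that by (simp add: X_continuous_on_def fun_diff_def)
  have mem: "u t \<in> H10 \<Omega> \<and> v t \<in> L2 \<Omega> \<and> P t \<in> H0Curl \<Omega> \<and> K t \<in> L2 \<Omega>" if "t \<in> I" for t
    using X that by (auto simp: X_continuous_on_def X_space_iff)
  note u = H10_grad[OF \<open>open \<Omega>\<close>] and P = H0Curl_Curl[OF \<open>open \<Omega>\<close>]
  show "L2_continuous_on \<Omega> I v" "L2_continuous_on \<Omega> I K" "L2_continuous_on \<Omega> I P"
    using mem P(1) by (auto intro!: L2_continuous_onI[OF _ lim] X_norm_ge)
  show "L2_continuous_on \<Omega> I (\<lambda>t. grad \<Omega> (u t))"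
  proof (rule L2_continuous_onI[OF _ lim])
    show "grad \<Omega> (u t) \<in> L2 \<Omega>" if "t \<in> I" for t using mem[OF that] u(3) by blast
    fix s t assume "s \<in> I" "t \<in> I"
    then have U: "u s \<in> H10 \<Omega>" "u t \<in> H10 \<Omega>" using mem by auto
    have "weak_op \<Omega> grad_op (\<lambda>x. u s x - u t x) (\<lambda>x. grad \<Omega> (u s) x - grad \<Omega> (u t) x)"
      using weak_op_diff[OF \<open>open \<Omega>\<close> linear_grad_op U[THEN u(1)] U[THEN u(2)], where c = 1] by simp
    then have "L2_norm \<Omega> (\<lambda>x. grad \<Omega> (u s) x - grad \<Omega> (u t) x) = L2_norm \<Omega> (grad \<Omega> (\<lambda>x. u s x - u t x))"
      by (rule grad_norm_eq[OF \<open>open \<Omega>\<close> L2_diff[OF U[THEN u(1)]], symmetric])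
    also have "\<dots> \<le> ?N s t" by (rule X_norm_ge)
    finally show "L2_norm \<Omega> (\<lambda>x. grad \<Omega> (u s) x - grad \<Omega> (u t) x) \<le> ?N s t" .
  qed
  show "L2_continuous_on \<Omega> I (\<lambda>t. Curl \<Omega> (P t))"
  proof (rule L2_continuous_onI[OF _ lim])
    show "Curl \<Omega> (P t) \<in> L2 \<Omega>" if "t \<in> I" for t using mem[OF that] P(3) by blast
    fix s t assume "s \<in> I" "t \<in> I"
    then have U: "P s \<in> H0Curl \<Omega>" "P t \<in> H0Curl \<Omega>" using mem by auto
    have "weak_op \<Omega> curl_op (\<lambda>x. P s x - P t x) (\<lambda>x. Curl \<Omega> (P s) x - Curl \<Omega> (P t) x)"
      using weak_op_diff[OF \<open>open \<Omega>\<close> linear_curl_op U[THEN P(1)] U[THEN P(2)], where c = 1] by simp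
    then have "L2_norm \<Omega> (\<lambda>x. Curl \<Omega> (P s) x - Curl \<Omega> (P t) x) = L2_norm \<Omega> (Curl \<Omega> (\<lambda>x. P s x - P t x))"
      by (rule Curl_norm_eq[OF \<open>open \<Omega>\<close> L2_diff[OF U[THEN P(1)]], symmetric])
    also have "\<dots> \<le> ?N s t" by (rule X_norm_ge)
    finally show "L2_norm \<Omega> (\<lambda>x. Curl \<Omega> (P s) x - Curl \<Omega> (P t) x) \<le> ?N s t" .
  qed
qed

lemma X_deriv_on_components:
  assumes "open \<Omega>" and X: "X_deriv_on \<Omega> I (\<lambda>t. (u t, v t, P t, K t)) (\<lambda>t. (u' t, v' t, P' t, K' t))"
    and mem: "\<And>t. t \<in> I \<Longrightarrow> u t \<in> H10 \<Omega> \<and> v t \<in> L2 \<Omega> \<and> P t \<in> H0Curl \<Omega> \<and> K t \<in> L2 \<Omega>"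
  shows "L2_deriv_on \<Omega> I v v'" "L2_deriv_on \<Omega> I K K'" "L2_deriv_on \<Omega> I P P'"
    "L2_deriv_on \<Omega> I (\<lambda>t. grad \<Omega> (u t)) (\<lambda>t. grad \<Omega> (u' t))"
    "L2_deriv_on \<Omega> I (\<lambda>t. Curl \<Omega> (P t)) (\<lambda>t. Curl \<Omega> (P' t))"
proof -
  let ?q = "\<lambda>F F' s t x. (1 / (s - t)) *\<^sub>R (F s x - F t x) - F' t x"
  let ?N = "\<lambda>s t. X_norm \<Omega> (?q u u' s t, ?q v v' s t, ?q P P' s t, ?q K K' s t)"
  have lim: "((\<lambda>s. ?N s t) \<longlongrightarrow> 0) (at t within I)" if "t \<in> I" for t
    using X that by (simp add: X_deriv_on_def fun_diff_def)
  have mem': "u' t \<in> H10 \<Omega> \<and> v' t \<in> L2 \<Omega> \<and> P' t \<in> H0Curl \<Omega> \<and> K' t \<in> L2 \<Omega>" if "t \<in> I" for t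
    using X that by (auto simp: X_deriv_on_def X_space_iff)
  note u = H10_grad[OF \<open>open \<Omega>\<close>] and P = H0Curl_Curl[OF \<open>open \<Omega>\<close>]
  show "L2_deriv_on \<Omega> I v v'" "L2_deriv_on \<Omega> I K K'" "L2_deriv_on \<Omega> I P P'"
    by (rule L2_deriv_onI[OF _ lim], use mem mem' P(1) in blast, blast, rule X_norm_ge)+
  have g: "L2_norm \<Omega> (grad \<Omega> (?q u u' s t)) = L2_norm \<Omega> (?q (\<lambda>t. grad \<Omega> (u t)) (\<lambda>t. grad \<Omega> (u' t)) s t)"
    if "s \<in> I" "t \<in> I" for s t
  proof (rule grad_norm_eq[OF \<open>open \<Omega>\<close>])
    have U: "u s \<in> H10 \<Omega>" "u t \<in> H10 \<Omega>" "u' t \<in> H10 \<Omega>" using mem mem' that by auto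
    show "?q u u' s t \<in> L2 \<Omega>" using U[THEN u(1)] by (intro L2_closure)
    show "weak_op \<Omega> grad_op (?q u u' s t) (?q (\<lambda>t. grad \<Omega> (u t)) (\<lambda>t. grad \<Omega> (u' t)) s t)"
      by (rule weak_op_difference_quotient[OF \<open>open \<Omega>\<close> linear_grad_op U[THEN u(1)] U[THEN u(2)]])
  qed
  show "L2_deriv_on \<Omega> I (\<lambda>t. grad \<Omega> (u t)) (\<lambda>t. grad \<Omega> (u' t))"
  proof (rule L2_deriv_onI[OF _ lim])
    show "grad \<Omega> (u t) \<in> L2 \<Omega> \<and> grad \<Omega> (u' t) \<in> L2 \<Omega>" if "t \<in> I" for t
      using mem[OF that] mem'[OF that] u(3) by blast
    show "L2_norm \<Omega> (?q (\<lambda>t. grad \<Omega> (u t)) (\<lambda>t. grad \<Omega> (u' t)) s t) \<le> ?N s t" if "s \<in> I" "t \<in> I" for s t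
      unfolding g[OF that, symmetric] by (rule X_norm_ge)
  qed
  have c: "L2_norm \<Omega> (Curl \<Omega> (?q P P' s t)) = L2_norm \<Omega> (?q (\<lambda>t. Curl \<Omega> (P t)) (\<lambda>t. Curl \<Omega> (P' t)) s t)"
    if "s \<in> I" "t \<in> I" for s t
  proof (rule Curl_norm_eq[OF \<open>open \<Omega>\<close>])
    have U: "P s \<in> H0Curl \<Omega>" "P t \<in> H0Curl \<Omega>" "P' t \<in> H0Curl \<Omega>" using mem mem' that by auto
    show "?q P P' s t \<in> L2 \<Omega>" using U[THEN P(1)] by (intro L2_closure)
    show "weak_op \<Omega> curl_op (?q P P' s t) (?q (\<lambda>t. Curl \<Omega> (P t)) (\<lambda>t. Curl \<Omega> (P' t)) s t)"
      by (rule weak_op_difference_quotient[OF \<open>open \<Omega>\<close> linear_curl_op U[THEN P(1)] U[THEN P(2)]])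
  qed
  show "L2_deriv_on \<Omega> I (\<lambda>t. Curl \<Omega> (P t)) (\<lambda>t. Curl \<Omega> (P' t))"
  proof (rule L2_deriv_onI[OF _ lim])
    show "Curl \<Omega> (P t) \<in> L2 \<Omega> \<and> Curl \<Omega> (P' t) \<in> L2 \<Omega>" if "t \<in> I" for t
      using mem[OF that] mem'[OF that] P(3) by blast
    show "L2_norm \<Omega> (?q (\<lambda>t. Curl \<Omega> (P t)) (\<lambda>t. Curl \<Omega> (P' t)) s t) \<le> ?N s t" if "s \<in> I" "t \<in> I" for s t
      unfolding c[OF that, symmetric] by (rule X_norm_ge)
  qed
qed

text \<open>A solution as a family of curves in \<open>L\<^sup>2\<close>. The functions \<open>z\<close> and \<open>y\<close> are the second and fourth
  components of \<open>\<A> w\<close>, that is the accelerations \<open>v'\<close> and \<open>K'\<close> without the forces \<open>f\<close> and \<open>M\<close>. The time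
  derivatives \<open>u'\<close> and \<open>P'\<close> in the state space are kept apart from the velocities \<open>v\<close> and \<open>K\<close>: they agree
  only almost everywhere, and it is \<open>u'\<close> and \<open>P'\<close> that are known to satisfy the boundary
  conditions.\<close>

definition energy_solution where
  "energy_solution \<Omega> T C H L f M u v P K u' v' P' K' z y \<longleftrightarrow>
     L2_deriv_on \<Omega> {0..T} u v \<and> L2_deriv_on \<Omega> {0..T} P K \<and>
     L2_continuous_on \<Omega> {0..T} v \<and> L2_continuous_on \<Omega> {0..T} K \<and> L2_continuous_on \<Omega> {0..T} P \<and>
     L2_continuous_on \<Omega> {0..T} (\<lambda>t. grad \<Omega> (u t)) \<and> L2_continuous_on \<Omega> {0..T} (\<lambda>t. Curl \<Omega> (P t)) \<and>
     L2_deriv_on \<Omega> {0<..T} v v' \<and> L2_deriv_on \<Omega> {0<..T} K K' \<and> L2_deriv_on \<Omega> {0<..T} P P' \<and>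
     L2_deriv_on \<Omega> {0<..T} (\<lambda>t. grad \<Omega> (u t)) (\<lambda>t. grad \<Omega> (u' t)) \<and>
     L2_deriv_on \<Omega> {0<..T} (\<lambda>t. Curl \<Omega> (P t)) (\<lambda>t. Curl \<Omega> (P' t)) \<and>
     u 0 \<in> H10 \<Omega> \<and> P 0 \<in> H0Curl \<Omega> \<and>
     (\<forall>t\<in>{0<..T}. u' t \<in> H10 \<Omega> \<and> P' t \<in> H0Curl \<Omega> \<and> eq_ae \<Omega> (u' t) (v t) \<and> eq_ae \<Omega> (P' t) (K t) \<and>
        z t \<in> L2 \<Omega> \<and> y t \<in> L2 \<Omega> \<and>
        eq_ae \<Omega> (v' t) (\<lambda>x. z t x + f t x) \<and> eq_ae \<Omega> (K' t) (\<lambda>x. y t x + M t x) \<and>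
        weak_op \<Omega> div_op (stress \<Omega> C (u t) (P t)) (z t) \<and>
        weak_op \<Omega> (\<lambda>j P. - curl_op j P) (\<lambda>x. tensor_act (L x) (Curl \<Omega> (P t) x))
          (\<lambda>x. y t x - (stress \<Omega> C (u t) (P t) x - tensor_act (H x) (symm (P t x)))))"

text \<open>As the coefficient operators are bounded on \<open>L\<^sup>2\<close>, stress and \<open>L. Curl P\<close> are square integrable fields,
  so the distributional equations of \<open>\<A>\<close> become instances of \<open>weak_op\<close>.\<close>

lemma solution_energy_solution:
  fixes f :: "real \<Rightarrow> real^3 \<Rightarrow> real^3" and M :: "real \<Rightarrow> real^3 \<Rightarrow> real^3^3"
  assumes "open \<Omega>" "T > 0"
    and C: "psd_op \<Omega> (\<lambda>x X. tensor_act (C x) (symm X)) c"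
    and H: "psd_op \<Omega> (\<lambda>x X. tensor_act (H x) (symm X)) h"
    and L: "psd_op \<Omega> (\<lambda>x. tensor_act (L x)) l"
    and sol: "is_solution \<Omega> T C H L f M u0 v0 P0 K0 u P"
  obtains v K u' v' P' K' z y where
    "energy_solution \<Omega> T C H L f M u v P K u' v' P' K' z y"
    "eq_ae \<Omega> (u 0) u0" "eq_ae \<Omega> (v 0) v0" "eq_ae \<Omega> (P 0) P0" "eq_ae \<Omega> (K 0) K0"
proof -
  obtain v K w' where
    d: "L2_deriv_on \<Omega> {0..T} u v" "L2_deriv_on \<Omega> {0..T} P K" and
    Xc: "X_continuous_on \<Omega> {0..T} (\<lambda>t. (u t, v t, P t, K t))" and
    Xd: "X_deriv_on \<Omega> {0<..T} (\<lambda>t. (u t, v t, P t, K t)) w'" and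
    eqn: "\<forall>t\<in>{0<..T}. \<exists>z\<in>X_space \<Omega>. is_A \<Omega> C H L (u t, v t, P t, K t) z \<and>
        X_eq \<Omega> (w' t) (X_add z ((\<lambda>_. 0), f t, (\<lambda>_. 0), M t))" and
    init: "X_eq \<Omega> (u 0, v 0, P 0, K 0) (u0, v0, P0, K0)"
    using sol unfolding is_solution_def Let_def by blast
  obtain u' v' P' K' where w': "w' = (\<lambda>t. (u' t, v' t, P' t, K' t))"
  proof
    show "w' = (\<lambda>t. (fst (w' t), fst (snd (w' t)), fst (snd (snd (w' t))), snd (snd (snd (w' t)))))"
      by simp
  qed
  obtain zz where zz: "\<And>t. t \<in> {0<..T} \<Longrightarrow> zz t \<in> X_space \<Omega> \<and> is_A \<Omega> C H L (u t, v t, P t, K t) (zz t) \<and>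
        X_eq \<Omega> (w' t) (X_add (zz t) ((\<lambda>_. 0), f t, (\<lambda>_. 0), M t))"
    using eqn by metis
  obtain z1 z z3 y where zz': "zz = (\<lambda>t. (z1 t, z t, z3 t, y t))"
  proof
    show "zz = (\<lambda>t. (fst (zz t), fst (snd (zz t)), fst (snd (snd (zz t))), snd (snd (snd (zz t)))))"
      by simp
  qed
  have mem: "u t \<in> H10 \<Omega> \<and> v t \<in> L2 \<Omega> \<and> P t \<in> H0Curl \<Omega> \<and> K t \<in> L2 \<Omega>" if "t \<in> {0..T}" for t
    using Xc that by (auto simp: X_continuous_on_def X_space_iff)
  have mem': "u' t \<in> H10 \<Omega> \<and> v' t \<in> L2 \<Omega> \<and> P' t \<in> H0Curl \<Omega> \<and> K' t \<in> L2 \<Omega>" if "t \<in> {0<..T}" for t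
    using Xd that by (auto simp: X_deriv_on_def X_space_iff w')
  have "energy_solution \<Omega> T C H L f M u v P K u' v' P' K' z y"
    unfolding energy_solution_def
  proof (intro conjI ballI)
    fix t assume t: "t \<in> {0<..T}"
    then have t': "t \<in> {0..T}" by auto
    from zz[OF t] have A: "eq_ae \<Omega> (z1 t) (v t)" "eq_ae \<Omega> (z3 t) (K t)"
      "\<forall>\<phi>\<in>C0inf \<Omega>. \<forall>i. dist_of \<Omega> (\<lambda>x. z t x $ i) \<phi> = dist_Div \<Omega> (stress \<Omega> C (u t) (P t)) \<phi> $ i"
      "\<forall>\<phi>\<in>C0inf \<Omega>. \<forall>i k. dist_of \<Omega> (\<lambda>x. y t x $ i $ k) \<phi> =
        - dist_Curl \<Omega> (\<lambda>x. tensor_act (L x) (Curl \<Omega> (P t) x)) \<phi> $ i $ k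
        + dist_of \<Omega> (\<lambda>x. (stress \<Omega> C (u t) (P t) x - tensor_act (H x) (symm (P t x))) $ i $ k) \<phi>"
      by (auto simp: zz')
    from zz[OF t] have X: "eq_ae \<Omega> (u' t) (z1 t)" "eq_ae \<Omega> (P' t) (z3 t)"
      "eq_ae \<Omega> (v' t) (\<lambda>x. z t x + f t x)" "eq_ae \<Omega> (K' t) (\<lambda>x. y t x + M t x)"
      by (auto simp: zz' w')
    show zL: "z t \<in> L2 \<Omega>" "y t \<in> L2 \<Omega>" using zz[OF t] by (auto simp: zz' X_space_iff)
    show "eq_ae \<Omega> (v' t) (\<lambda>x. z t x + f t x)" "eq_ae \<Omega> (K' t) (\<lambda>x. y t x + M t x)" using X by auto
    show "eq_ae \<Omega> (u' t) (v t)" "eq_ae \<Omega> (P' t) (K t)"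
      using A(1,2) X(1,2) unfolding eq_ae_def by (eventually_elim, simp)+
    show "u' t \<in> H10 \<Omega>" "P' t \<in> H0Curl \<Omega>" using mem'[OF t] by auto
    have G: "grad \<Omega> (u t) \<in> L2 \<Omega>" "P t \<in> L2 \<Omega>" "Curl \<Omega> (P t) \<in> L2 \<Omega>"
      using mem[OF t'] H10_grad[OF \<open>open \<Omega>\<close>] H0Curl_Curl[OF \<open>open \<Omega>\<close>] by auto
    have S: "stress \<Omega> C (u t) (P t) \<in> L2 \<Omega>"
      using psd_op_L2(1)[OF C L2_diff[OF G(1,2)]] by (simp add: stress_def[abs_def])
    show "weak_op \<Omega> div_op (stress \<Omega> C (u t) (P t)) (z t)"
      using weak_div_iff[OF \<open>open \<Omega>\<close> S zL(1)] A(3) by blast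
    show "weak_op \<Omega> (\<lambda>j P. - curl_op j P) (\<lambda>x. tensor_act (L x) (Curl \<Omega> (P t) x))
          (\<lambda>x. y t x - (stress \<Omega> C (u t) (P t) x - tensor_act (H x) (symm (P t x))))"
      using A(4) by (intro weak_Curl_adjoint[OF \<open>open \<Omega>\<close> psd_op_L2(1)[OF L G(3)] zL(2)
            L2_diff[OF S psd_op_L2(1)[OF H G(2)]]]) blast
  next
    show "u 0 \<in> H10 \<Omega>" "P 0 \<in> H0Curl \<Omega>" using mem[of 0] \<open>T > 0\<close> by auto
  qed (use d X_continuous_on_components[OF \<open>open \<Omega>\<close> Xc]
        X_deriv_on_components[OF \<open>open \<Omega>\<close> Xd[unfolded w']] mem in \<open>force+\<close>)
  then show thesis using that init by auto
qed


section \<open>Conservation of energy and uniqueness\<close>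

lemma constant_if_derivative_zero:
  fixes E :: "real \<Rightarrow> real"
  assumes "continuous_on {0..T} E"
    and D: "\<And>t. t \<in> {0<..T} \<Longrightarrow> (E has_real_derivative 0) (at t within {0<..T})"
    and t: "t \<in> {0..T}"
  shows "E t = E 0"
proof (cases "t = 0")
  case False
  show ?thesis
  proof (rule DERIV_isconst_end[of 0 t E])
    show "0 < t" using False t by auto
    show "continuous_on {0..t} E"
      using assms(1) t by (auto intro: continuous_on_subset)
    show "(E has_real_derivative 0) (at x)" if "0 < x" "x < t" for x
    proof -
      have "x \<in> interior {0<..T}"
        by (rule interiorI[of "{0<..<t}"]) (use that t in auto)
      then have "at x within {0<..T} = at x" by (rule at_within_interior)
      then show ?thesis using D[of x] that t by simp
    qed
  qed
qed simp

lemma quad_eq_0: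
  assumes "psd_op \<Omega> A M" "F \<in> L2 \<Omega>" "eq_ae \<Omega> F (\<lambda>x. 0)"
  shows "quad \<Omega> A F = 0"
proof -
  have "L2_norm \<Omega> F = 0"
    using L2_norm_cong_ae[OF assms(2) L2_zero assms(3)] by (simp add: L2_norm_def)
  then show ?thesis
    using ip_Cauchy_Schwarz[OF psd_op_L2(1)[OF assms(1,2)] assms(2)] by (simp add: quad_def)
qed

text \<open>The derivative of \<open>\<integral> \<bar>F\<bar>\<^sup>2\<close> is twice the pairing of \<open>V\<close> and \<open>F\<close>, which is \<open>0\<close> by Cauchy--Schwarz.\<close>

lemma zero_if_velocity_zero:
  assumes "T > 0" and D: "L2_deriv_on \<Omega> {0..T} F V"
    and V: "\<And>t. t \<in> {0..T} \<Longrightarrow> L2_norm \<Omega> (V t) = 0" and F0: "eq_ae \<Omega> (F 0) (\<lambda>x. 0)"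
    and t: "t \<in> {0..T}"
  shows "eq_ae \<Omega> (F t) (\<lambda>x. 0)"
proof -
  have L: "F t \<in> L2 \<Omega>" "V t \<in> L2 \<Omega>" if "t \<in> {0..T}" for t
    using D that by (auto simp: L2_deriv_on_def)
  have "quad \<Omega> (\<lambda>x X. X) (F t) = quad \<Omega> (\<lambda>x X. X) (F 0)"
  proof (rule constant_if_derivative_zero[OF _ _ t])
    show "continuous_on {0..T} (\<lambda>t. quad \<Omega> (\<lambda>x X. X) (F t))"
      by (rule continuous_on_quad[OF psd_op_id L2_deriv_imp_continuous[OF D]])
    fix s assume "s \<in> {0<..T}"
    then have s: "s \<in> {0..T}" by auto
    have "ip \<Omega> (V s) (F s) = 0"
      using ip_Cauchy_Schwarz[OF L(2)[OF s] L(1)[OF s]] V[OF s] by simp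
    then have "((\<lambda>t. quad \<Omega> (\<lambda>x X. X) (F t)) has_real_derivative 0) (at s within {0..T})"
      using quad_has_derivative[OF psd_op_id D s] by simp
    then show "((\<lambda>t. quad \<Omega> (\<lambda>x X. X) (F t)) has_real_derivative 0) (at s within {0<..T})"
      by (rule DERIV_subset) auto
  qed
  also have "\<dots> = 0"
    using \<open>T > 0\<close> by (intro quad_eq_0[OF psd_op_id L(1) F0]) auto
  finally have "L2_norm \<Omega> (F t) = 0"
    by (simp add: quad_def L2_norm_power2[symmetric])
  then show ?thesis by (rule L2_norm_zeroD[OF L(1)[OF t]])
qed

text \<open>By bilinearity the four mixed partial integrations for two solutions combine to the one for their
  differences, so membership in the energy space is used for each single time derivative.\<close>

lemma ip_difference_parts:
  assumes L: "z1 \<in> L2 \<Omega>" "z2 \<in> L2 \<Omega>" "f1 \<in> L2 \<Omega>" "f2 \<in> L2 \<Omega>" "S1 \<in> L2 \<Omega>" "S2 \<in> L2 \<Omega>" "g1 \<in> L2 \<Omega>" "g2 \<in> L2 \<Omega>"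
    and "ip \<Omega> z1 f1 = - ip \<Omega> S1 g1" "ip \<Omega> z1 f2 = - ip \<Omega> S1 g2"
    and "ip \<Omega> z2 f1 = - ip \<Omega> S2 g1" "ip \<Omega> z2 f2 = - ip \<Omega> S2 g2"
  shows "ip \<Omega> (\<lambda>x. z1 x - z2 x) (\<lambda>x. f1 x - f2 x) = - ip \<Omega> (\<lambda>x. S1 x - S2 x) (\<lambda>x. g1 x - g2 x)"
  using assms by (simp add: ip_diff_left ip_diff_right L2_diff)

lemma eq_ae_diff:
  assumes "eq_ae \<Omega> f f'" "eq_ae \<Omega> g g'"
  shows "eq_ae \<Omega> (\<lambda>x. f x - g x) (\<lambda>x. f' x - g' x)"
  using assms unfolding eq_ae_def by eventually_elim simp


lemma psd_op_diff:
  assumes A: "psd_op \<Omega> A M" and L: "F \<in> L2 \<Omega>" "G \<in> L2 \<Omega>" and W: "W \<in> L2 \<Omega>"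
  shows "ip \<Omega> W (\<lambda>x. A x (F x - G x)) = ip \<Omega> W (\<lambda>x. A x (F x) - A x (G x))"
  using A by (intro ip_cong) (auto simp: psd_op_def linear_diff)

text \<open>In the proof \<open>kin_u\<close> and \<open>kin_P\<close> are the two equations of motion tested with the time derivatives, and \<open>el\<close>
  splits the rate of change of the energy stored by \<open>C\<close>; together they make the derivative of the energy
  \<open>E\<close> vanish.\<close>

lemma energy_solution_unique:
  fixes f :: "real \<Rightarrow> real^3 \<Rightarrow> real^3" and M :: "real \<Rightarrow> real^3 \<Rightarrow> real^3^3"
  assumes op: "open \<Omega>" and "T > 0"
    and C: "psd_op \<Omega> (\<lambda>x X. tensor_act (C x) (symm X)) c"
    and H: "psd_op \<Omega> (\<lambda>x X. tensor_act (H x) (symm X)) h"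
    and L: "psd_op \<Omega> (\<lambda>x. tensor_act (L x)) l"
    and sol1: "energy_solution \<Omega> T C H L f M u1 v1 P1 K1 u1' v1' P1' K1' z1 y1"
    and sol2: "energy_solution \<Omega> T C H L f M u2 v2 P2 K2 u2' v2' P2' K2' z2 y2"
    and init: "eq_ae \<Omega> (u1 0) (u2 0)" "eq_ae \<Omega> (v1 0) (v2 0)" "eq_ae \<Omega> (P1 0) (P2 0)" "eq_ae \<Omega> (K1 0) (K2 0)"
    and t: "t \<in> {0..T}"
  shows "eq_ae \<Omega> (u1 t) (u2 t) \<and> eq_ae \<Omega> (P1 t) (P2 t)"
proof -
  let ?I = "{0<..T}" and ?J = "{0..T}"
  let ?C = "\<lambda>x X. tensor_act (C x) (symm X)" and ?H = "\<lambda>x X. tensor_act (H x) (symm X)"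
    and ?L = "\<lambda>x. tensor_act (L x)"
  define U where "U = (\<lambda>t x. u1 t x - u2 t x)"
  define V where "V = (\<lambda>t x. v1 t x - v2 t x)"
  define V' where "V' = (\<lambda>t x. v1' t x - v2' t x)"
  define P where "P = (\<lambda>t x. P1 t x - P2 t x)"
  define P' where "P' = (\<lambda>t x. P1' t x - P2' t x)"
  define K where "K = (\<lambda>t x. K1 t x - K2 t x)"
  define K' where "K' = (\<lambda>t x. K1' t x - K2' t x)"
  define e1 where "e1 = (\<lambda>t x. grad \<Omega> (u1 t) x - P1 t x)"
  define e2 where "e2 = (\<lambda>t x. grad \<Omega> (u2 t) x - P2 t x)"
  define e where "e = (\<lambda>t x. e1 t x - e2 t x)"
  define G' where "G' = (\<lambda>t x. grad \<Omega> (u1' t) x - grad \<Omega> (u2' t) x)"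
  define e' where "e' = (\<lambda>t x. (grad \<Omega> (u1' t) x - P1' t x) - (grad \<Omega> (u2' t) x - P2' t x))"
  define Q where "Q = (\<lambda>t x. Curl \<Omega> (P1 t) x - Curl \<Omega> (P2 t) x)"
  define Q' where "Q' = (\<lambda>t x. Curl \<Omega> (P1' t) x - Curl \<Omega> (P2' t) x)"
  define E where "E = (\<lambda>t. quad \<Omega> (\<lambda>x X. X) (V t) + quad \<Omega> (\<lambda>x X. X) (K t)
      + quad \<Omega> ?C (e t) + quad \<Omega> ?H (P t) + quad \<Omega> ?L (Q t))"
  have s1: "L2_deriv_on \<Omega> ?J u1 v1" "L2_deriv_on \<Omega> ?J P1 K1"
    "L2_continuous_on \<Omega> ?J v1" "L2_continuous_on \<Omega> ?J K1" "L2_continuous_on \<Omega> ?J P1"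
    "L2_continuous_on \<Omega> ?J (\<lambda>t. grad \<Omega> (u1 t))" "L2_continuous_on \<Omega> ?J (\<lambda>t. Curl \<Omega> (P1 t))"
    "L2_deriv_on \<Omega> ?I v1 v1'" "L2_deriv_on \<Omega> ?I K1 K1'" "L2_deriv_on \<Omega> ?I P1 P1'"
    "L2_deriv_on \<Omega> ?I (\<lambda>t. grad \<Omega> (u1 t)) (\<lambda>t. grad \<Omega> (u1' t))"
    "L2_deriv_on \<Omega> ?I (\<lambda>t. Curl \<Omega> (P1 t)) (\<lambda>t. Curl \<Omega> (P1' t))" "u1 0 \<in> H10 \<Omega>" "P1 0 \<in> H0Curl \<Omega>"
    using sol1 unfolding energy_solution_def by blast+
  have s2: "L2_deriv_on \<Omega> ?J u2 v2" "L2_deriv_on \<Omega> ?J P2 K2"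
    "L2_continuous_on \<Omega> ?J v2" "L2_continuous_on \<Omega> ?J K2" "L2_continuous_on \<Omega> ?J P2"
    "L2_continuous_on \<Omega> ?J (\<lambda>t. grad \<Omega> (u2 t))" "L2_continuous_on \<Omega> ?J (\<lambda>t. Curl \<Omega> (P2 t))"
    "L2_deriv_on \<Omega> ?I v2 v2'" "L2_deriv_on \<Omega> ?I K2 K2'" "L2_deriv_on \<Omega> ?I P2 P2'"
    "L2_deriv_on \<Omega> ?I (\<lambda>t. grad \<Omega> (u2 t)) (\<lambda>t. grad \<Omega> (u2' t))"
    "L2_deriv_on \<Omega> ?I (\<lambda>t. Curl \<Omega> (P2 t)) (\<lambda>t. Curl \<Omega> (P2' t))" "u2 0 \<in> H10 \<Omega>" "P2 0 \<in> H0Curl \<Omega>"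
    using sol2 unfolding energy_solution_def by blast+
  have D: "L2_deriv_on \<Omega> ?I V V'" "L2_deriv_on \<Omega> ?I K K'" "L2_deriv_on \<Omega> ?I e e'"
    "L2_deriv_on \<Omega> ?I P P'" "L2_deriv_on \<Omega> ?I Q Q'"
    unfolding V_def V'_def K_def K'_def e_def e1_def e2_def e'_def P_def P'_def Q_def Q'_def
    by (intro L2_deriv_on_diff s1 s2)+
  have cont: "L2_continuous_on \<Omega> ?J V" "L2_continuous_on \<Omega> ?J K" "L2_continuous_on \<Omega> ?J e"
    "L2_continuous_on \<Omega> ?J P" "L2_continuous_on \<Omega> ?J Q"
    unfolding V_def K_def e_def e1_def e2_def P_def Q_def
    by (intro L2_continuous_on_diff s1 s2)+
  have D0: "L2_deriv_on \<Omega> ?J U V" "L2_deriv_on \<Omega> ?J P K"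
    unfolding U_def V_def P_def K_def by (intro L2_deriv_on_diff s1 s2)+
  have contE: "continuous_on ?J E"
    unfolding E_def
    by (intro continuous_on_add continuous_on_quad[OF psd_op_id] continuous_on_quad[OF C]
        continuous_on_quad[OF H] continuous_on_quad[OF L] cont)
  have derE: "(E has_real_derivative 0) (at s within ?I)" if s: "s \<in> ?I" for s
  proof -
    have a1: "u1' s \<in> H10 \<Omega>" "P1' s \<in> H0Curl \<Omega>" "eq_ae \<Omega> (u1' s) (v1 s)" "eq_ae \<Omega> (P1' s) (K1 s)"
        "z1 s \<in> L2 \<Omega>" "y1 s \<in> L2 \<Omega>"
        "eq_ae \<Omega> (v1' s) (\<lambda>x. z1 s x + f s x)" "eq_ae \<Omega> (K1' s) (\<lambda>x. y1 s x + M s x)"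
        "weak_op \<Omega> div_op (\<lambda>x. ?C x (e1 s x)) (z1 s)"
        "weak_op \<Omega> (\<lambda>j P. - curl_op j P) (\<lambda>x. ?L x (Curl \<Omega> (P1 s) x))
          (\<lambda>x. y1 s x - (?C x (e1 s x) - ?H x (P1 s x)))"
      using sol1 s unfolding energy_solution_def stress_def[abs_def] e1_def by blast+
    have a2: "u2' s \<in> H10 \<Omega>" "P2' s \<in> H0Curl \<Omega>" "eq_ae \<Omega> (u2' s) (v2 s)" "eq_ae \<Omega> (P2' s) (K2 s)"
        "z2 s \<in> L2 \<Omega>" "y2 s \<in> L2 \<Omega>"
        "eq_ae \<Omega> (v2' s) (\<lambda>x. z2 s x + f s x)" "eq_ae \<Omega> (K2' s) (\<lambda>x. y2 s x + M s x)"
        "weak_op \<Omega> div_op (\<lambda>x. ?C x (e2 s x)) (z2 s)"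
        "weak_op \<Omega> (\<lambda>j P. - curl_op j P) (\<lambda>x. ?L x (Curl \<Omega> (P2 s) x))
          (\<lambda>x. y2 s x - (?C x (e2 s x) - ?H x (P2 s x)))"
      using sol2 s unfolding energy_solution_def stress_def[abs_def] e2_def by blast+
    note u' = H10_grad[OF op a1(1)] H10_grad[OF op a2(1)]
    note P' = H0Curl_Curl[OF op a1(2)] H0Curl_Curl[OF op a2(2)]
    have Lc: "V s \<in> L2 \<Omega>" "V' s \<in> L2 \<Omega>" "K s \<in> L2 \<Omega>" "K' s \<in> L2 \<Omega>" "e s \<in> L2 \<Omega>" "e' s \<in> L2 \<Omega>"
        "P s \<in> L2 \<Omega>" "P' s \<in> L2 \<Omega>" "Q s \<in> L2 \<Omega>" "Q' s \<in> L2 \<Omega>"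
      using D s by (auto simp: L2_deriv_on_def)
    have Ls: "e1 s \<in> L2 \<Omega>" "e2 s \<in> L2 \<Omega>" "P1 s \<in> L2 \<Omega>" "P2 s \<in> L2 \<Omega>"
        "Curl \<Omega> (P1 s) \<in> L2 \<Omega>" "Curl \<Omega> (P2 s) \<in> L2 \<Omega>"
      using s1(10-12) s2(10-12) s by (auto simp: L2_deriv_on_def e1_def e2_def intro: L2_diff)
    have LC: "(\<lambda>x. ?C x (e1 s x)) \<in> L2 \<Omega>" "(\<lambda>x. ?C x (e2 s x)) \<in> L2 \<Omega>" "(\<lambda>x. ?C x (e s x)) \<in> L2 \<Omega>"
      by (rule psd_op_L2(1)[OF C], fact)+
    have LH: "(\<lambda>x. ?H x (P1 s x)) \<in> L2 \<Omega>" "(\<lambda>x. ?H x (P2 s x)) \<in> L2 \<Omega>" "(\<lambda>x. ?H x (P s x)) \<in> L2 \<Omega>"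
      by (rule psd_op_L2(1)[OF H], fact)+
    have LL: "(\<lambda>x. ?L x (Curl \<Omega> (P1 s) x)) \<in> L2 \<Omega>" "(\<lambda>x. ?L x (Curl \<Omega> (P2 s) x)) \<in> L2 \<Omega>"
      by (rule psd_op_L2(1)[OF L], fact)+
    have LG': "G' s \<in> L2 \<Omega>" unfolding G'_def by (rule L2_diff[OF u'(3) u'(6)])
    have vel: "eq_ae \<Omega> (V s) (\<lambda>x. u1' s x - u2' s x)" "eq_ae \<Omega> (K s) (P' s)"
      using eq_ae_diff[OF a1(3) a2(3)] eq_ae_diff[OF a1(4) a2(4)]
      unfolding eq_ae_def V_def K_def P'_def by (eventually_elim, simp)+
    have acc: "eq_ae \<Omega> (V' s) (\<lambda>x. z1 s x - z2 s x)" "eq_ae \<Omega> (K' s) (\<lambda>x. y1 s x - y2 s x)"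
      using eq_ae_diff[OF a1(7) a2(7)] eq_ae_diff[OF a1(8) a2(8)] by (simp_all add: V'_def K'_def)
    have "ip \<Omega> (V' s) (V s) = ip \<Omega> (\<lambda>x. z1 s x - z2 s x) (\<lambda>x. u1' s x - u2' s x)"
      by (rule ip_cong_ae[OF Lc(2) L2_diff[OF a1(5) a2(5)] Lc(1) L2_diff[OF u'(1) u'(4)] acc(1) vel(1)])
    also have "\<dots> = - ip \<Omega> (\<lambda>x. ?C x (e1 s x) - ?C x (e2 s x)) (G' s)"
      unfolding G'_def
      by (rule ip_difference_parts[OF a1(5) a2(5) u'(1) u'(4) LC(1,2) u'(3) u'(6)
          H10_parts[OF op a1(1) LC(1) a1(9)] H10_parts[OF op a2(1) LC(1) a1(9)]
          H10_parts[OF op a1(1) LC(2) a2(9)] H10_parts[OF op a2(1) LC(2) a2(9)]])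
    also have "\<dots> = - ip \<Omega> (G' s) (\<lambda>x. ?C x (e s x))"
      using psd_op_diff[OF C Ls(1,2) LG'] by (simp add: e_def ip_commute[of \<Omega> "G' s"])
    finally have kin_u: "ip \<Omega> (V' s) (V s) = - ip \<Omega> (G' s) (\<lambda>x. ?C x (e s x))" .
    \<comment> \<open>The parts \<open>- Curl (L. Curl P\<^sub>i)\<close> of the accelerations.\<close>
    define w1 where "w1 = (\<lambda>x. y1 s x - (?C x (e1 s x) - ?H x (P1 s x)))"
    define w2 where "w2 = (\<lambda>x. y2 s x - (?C x (e2 s x) - ?H x (P2 s x)))"
    have Lw: "w1 \<in> L2 \<Omega>" "w2 \<in> L2 \<Omega>"
      unfolding w1_def w2_def by (intro L2_diff a1 a2 LC LH)+
    have "ip \<Omega> (K' s) (K s) = ip \<Omega> (\<lambda>x. y1 s x - y2 s x) (P' s)"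
      by (rule ip_cong_ae[OF Lc(4) L2_diff[OF a1(6) a2(6)] Lc(3) Lc(8) acc(2) vel(2)])
    also have "(\<lambda>x. y1 s x - y2 s x) = (\<lambda>x. (w1 x - w2 x) + ((?C x (e1 s x) - ?C x (e2 s x))
        - (?H x (P1 s x) - ?H x (P2 s x))))"
      by (simp add: w1_def w2_def)
    also have "ip \<Omega> \<dots> (P' s) = ip \<Omega> (\<lambda>x. w1 x - w2 x) (P' s)
        + (ip \<Omega> (P' s) (\<lambda>x. ?C x (e1 s x) - ?C x (e2 s x)) - ip \<Omega> (P' s) (\<lambda>x. ?H x (P1 s x) - ?H x (P2 s x)))"
      using Lw LC LH Lc(8) by (simp add: ip_add_left ip_diff_left L2_closure ip_commute[of \<Omega> "P' s"])
    also have "ip \<Omega> (\<lambda>x. w1 x - w2 x) (P' s) = - ip \<Omega> (\<lambda>x. ?L x (Curl \<Omega> (P1 s) x) - ?L x (Curl \<Omega> (P2 s) x)) (Q' s)"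
      unfolding P'_def Q'_def
      by (rule ip_difference_parts[OF Lw P'(1) P'(4) LL P'(3) P'(6)
          H0Curl_parts[OF op a1(2) LL(1) a1(10)[folded w1_def]] H0Curl_parts[OF op a2(2) LL(1) a1(10)[folded w1_def]]
          H0Curl_parts[OF op a1(2) LL(2) a2(10)[folded w2_def]] H0Curl_parts[OF op a2(2) LL(2) a2(10)[folded w2_def]]])
    also have "\<dots> = - ip \<Omega> (Q' s) (\<lambda>x. ?L x (Q s x))"
      using psd_op_diff[OF L Ls(5,6) Lc(10)] by (simp add: Q_def ip_commute[of \<Omega> "Q' s"])
    finally have kin_P: "ip \<Omega> (K' s) (K s) = - ip \<Omega> (Q' s) (\<lambda>x. ?L x (Q s x))
        + (ip \<Omega> (P' s) (\<lambda>x. ?C x (e s x)) - ip \<Omega> (P' s) (\<lambda>x. ?H x (P s x)))"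
      using psd_op_diff[OF C Ls(1,2) Lc(8)] psd_op_diff[OF H Ls(3,4) Lc(8)] by (simp add: e_def P_def)
    have "e' s = (\<lambda>x. G' s x - P' s x)"
      by (simp add: e'_def G'_def P'_def algebra_simps)
    then have el: "ip \<Omega> (e' s) (\<lambda>x. ?C x (e s x)) = ip \<Omega> (G' s) (\<lambda>x. ?C x (e s x)) - ip \<Omega> (P' s) (\<lambda>x. ?C x (e s x))"
      using LG' Lc(8) LC(3) by (simp add: ip_diff_left)
    have "(E has_real_derivative 2 * ip \<Omega> (V' s) (V s) + 2 * ip \<Omega> (K' s) (K s)
        + 2 * ip \<Omega> (e' s) (\<lambda>x. ?C x (e s x)) + 2 * ip \<Omega> (P' s) (\<lambda>x. ?H x (P s x))
        + 2 * ip \<Omega> (Q' s) (\<lambda>x. ?L x (Q s x))) (at s within ?I)"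
      unfolding E_def
      by (intro DERIV_add quad_has_derivative[OF psd_op_id D(1) s] quad_has_derivative[OF psd_op_id D(2) s]
          quad_has_derivative[OF C D(3) s] quad_has_derivative[OF H D(4) s] quad_has_derivative[OF L D(5) s])
    then show ?thesis by (simp add: kin_u kin_P el)
  qed
  have E0: "E 0 = 0"
  proof -
    \<comment> \<open>The initial data determine \<open>u\<close> and \<open>P\<close> up to null sets, hence also their weak derivatives.\<close>
    have 0: "0 \<in> ?J" using \<open>T > 0\<close> by simp
    have L0: "V 0 \<in> L2 \<Omega>" "K 0 \<in> L2 \<Omega>" "e 0 \<in> L2 \<Omega>" "P 0 \<in> L2 \<Omega>" "Q 0 \<in> L2 \<Omega>"
      using cont 0 by (auto simp: L2_continuous_on_def)
    note u = H10_grad[OF op s1(13)] H10_grad[OF op s2(13)]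
    note P = H0Curl_Curl[OF op s1(14)] H0Curl_Curl[OF op s2(14)]
    have g: "eq_ae \<Omega> (grad \<Omega> (u1 0)) (grad \<Omega> (u2 0))"
      by (rule weak_op_unique[OF op weak_op_cong_ae[OF op linear_grad_op u(1) u(4) init(1) u(2)] u(5)])
    have q: "eq_ae \<Omega> (Curl \<Omega> (P1 0)) (Curl \<Omega> (P2 0))"
      by (rule weak_op_unique[OF op weak_op_cong_ae[OF op linear_curl_op P(1) P(4) init(3) P(2)] P(5)])
    have "eq_ae \<Omega> (V 0) (\<lambda>x. 0)" "eq_ae \<Omega> (K 0) (\<lambda>x. 0)" "eq_ae \<Omega> (P 0) (\<lambda>x. 0)" "eq_ae \<Omega> (Q 0) (\<lambda>x. 0)"
      using init(2-4) q by (simp_all add: eq_ae_def V_def K_def P_def Q_def)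
    moreover have "eq_ae \<Omega> (e 0) (\<lambda>x. 0)"
      using eq_ae_diff[OF g init(3)] by (simp add: eq_ae_def e_def e1_def e2_def)
    ultimately show ?thesis
      using quad_eq_0[OF psd_op_id L0(1)] quad_eq_0[OF psd_op_id L0(2)] quad_eq_0[OF C L0(3)]
        quad_eq_0[OF H L0(4)] quad_eq_0[OF L L0(5)]
      by (simp add: E_def)
  qed
  have VK: "L2_norm \<Omega> (V s) = 0" "L2_norm \<Omega> (K s) = 0" if s: "s \<in> ?J" for s
  proof -
    have "E s = 0" using constant_if_derivative_zero[OF contE derE s] E0 by simp
    moreover have "0 \<le> quad \<Omega> ?C (e s)" "0 \<le> quad \<Omega> ?H (P s)" "0 \<le> quad \<Omega> ?L (Q s)"
      unfolding quad_def by (rule psd_op_ip(2)[OF C] psd_op_ip(2)[OF H] psd_op_ip(2)[OF L])+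
    moreover have "quad \<Omega> (\<lambda>x X. X) (V s) = (L2_norm \<Omega> (V s))\<^sup>2" "quad \<Omega> (\<lambda>x X. X) (K s) = (L2_norm \<Omega> (K s))\<^sup>2"
      by (simp_all add: quad_def L2_norm_power2)
    moreover have "0 \<le> (L2_norm \<Omega> (V s))\<^sup>2" "0 \<le> (L2_norm \<Omega> (K s))\<^sup>2" by simp_all
    ultimately have "(L2_norm \<Omega> (V s))\<^sup>2 = 0" "(L2_norm \<Omega> (K s))\<^sup>2 = 0"
      unfolding E_def by linarith+
    then show "L2_norm \<Omega> (V s) = 0" "L2_norm \<Omega> (K s) = 0" by simp_all
  qed
  have "eq_ae \<Omega> (U 0) (\<lambda>x. 0)" "eq_ae \<Omega> (P 0) (\<lambda>x. 0)"
    using init(1,3) by (simp_all add: eq_ae_def U_def P_def)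
  then have "eq_ae \<Omega> (U t) (\<lambda>x. 0)" "eq_ae \<Omega> (P t) (\<lambda>x. 0)"
    using zero_if_velocity_zero[OF \<open>T > 0\<close> D0(1) VK(1) _ t] zero_if_velocity_zero[OF \<open>T > 0\<close> D0(2) VK(2) _ t]
    by blast+
  then show ?thesis by (simp add: eq_ae_def U_def P_def)
qed

theorem corollary5p4:
  fixes \<Omega> :: "(real^3) set" and T :: real
    and C H L :: "real^3 \<Rightarrow> tensor4"
    and c_m c_M h_m h_M L_m L_M :: real
    and f :: "real \<Rightarrow> real^3 \<Rightarrow> real^3" and M :: "real \<Rightarrow> real^3 \<Rightarrow> real^3^3"
    and u0 v0 :: "real^3 \<Rightarrow> real^3" and P0 K0 :: "real^3 \<Rightarrow> real^3^3"
    and u1 u2 :: "real \<Rightarrow> real^3 \<Rightarrow> real^3" and P1 P2 :: "real \<Rightarrow> real^3 \<Rightarrow> real^3^3"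
  assumes "bounded_domain \<Omega>" and "piecewise_smooth_boundary \<Omega>" and "T > 0"
    and "Ck_on 1 \<Omega> C" and "Ck_on 1 \<Omega> H" and "Ck_on 1 \<Omega> L"
    and "\<And>x. x \<in> \<Omega> \<Longrightarrow> major_symmetric (C x) \<and> minor_symmetric (C x)"
    and "\<And>x. x \<in> \<Omega> \<Longrightarrow> major_symmetric (H x) \<and> minor_symmetric (H x)"
    and "\<And>x. x \<in> \<Omega> \<Longrightarrow> major_symmetric (L x)"
    and "c_m > 0" and "c_M > 0" and "h_m > 0" and "h_M > 0" and "L_m > 0" and "L_M > 0"
    and "\<And>x. x \<in> \<Omega> \<Longrightarrow> form_bounds Sym3 c_m c_M (C x)"
    and "\<And>x. x \<in> \<Omega> \<Longrightarrow> form_bounds Sym3 h_m h_M (H x)"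
    and "\<And>x. x \<in> \<Omega> \<Longrightarrow> form_bounds UNIV L_m L_M (L x)"
    and "f \<in> L1_L2 T \<Omega>" and "M \<in> L1_L2 T \<Omega>"
    and "is_solution \<Omega> T C H L f M u0 v0 P0 K0 u1 P1"
    and "is_solution \<Omega> T C H L f M u0 v0 P0 K0 u2 P2"
  shows "\<forall>t\<in>{0..T}. eq_ae \<Omega> (u1 t) (u2 t) \<and> eq_ae \<Omega> (P1 t) (P2 t)"
proof
  fix t assume t: "t \<in> {0..T}"
  have op: "open \<Omega>" using assms(1) by (simp add: bounded_domain_def)
  have C: "psd_op \<Omega> (\<lambda>x X. tensor_act (C x) (symm X)) c_M"
    using assms(4,7,10,11,16) by (intro psd_op_elastic[OF op, where m = c_m]) auto
  have H: "psd_op \<Omega> (\<lambda>x X. tensor_act (H x) (symm X)) h_M"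
    using assms(5,8,12,13,17) by (intro psd_op_elastic[OF op, where m = h_m]) auto
  have L: "psd_op \<Omega> (\<lambda>x. tensor_act (L x)) L_M"
    using assms(6,9,14,15,18) by (intro psd_op_full[OF op, where m = L_m]) auto
  obtain v1 K1 u1' v1' P1' K1' z1 y1 where
    s1: "energy_solution \<Omega> T C H L f M u1 v1 P1 K1 u1' v1' P1' K1' z1 y1"
    and i1: "eq_ae \<Omega> (u1 0) u0" "eq_ae \<Omega> (v1 0) v0" "eq_ae \<Omega> (P1 0) P0" "eq_ae \<Omega> (K1 0) K0"
    using solution_energy_solution[OF op \<open>T > 0\<close> C H L assms(21)] .
  obtain v2 K2 u2' v2' P2' K2' z2 y2 where
    s2: "energy_solution \<Omega> T C H L f M u2 v2 P2 K2 u2' v2' P2' K2' z2 y2"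
    and i2: "eq_ae \<Omega> (u2 0) u0" "eq_ae \<Omega> (v2 0) v0" "eq_ae \<Omega> (P2 0) P0" "eq_ae \<Omega> (K2 0) K0"
    using solution_energy_solution[OF op \<open>T > 0\<close> C H L assms(22)] .
  have "eq_ae \<Omega> (u1 0) (u2 0)" "eq_ae \<Omega> (v1 0) (v2 0)" "eq_ae \<Omega> (P1 0) (P2 0)" "eq_ae \<Omega> (K1 0) (K2 0)"
    using i1 i2 unfolding eq_ae_def by (eventually_elim, simp)+
  then show "eq_ae \<Omega> (u1 t) (u2 t) \<and> eq_ae \<Omega> (P1 t) (P2 t)"
    by (rule energy_solution_unique[OF op \<open>T > 0\<close> C H L s1 s2 _ _ _ _ t])
qed

end
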